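(* Let $\mathbb{C}$ be a finitely complete Barr-exact category with coequalisers of reflexive graphs, and let $\mathbb{X}$ be a full reflective subcategory of $\mathbb{C}$ such that: (1) $\mathbb{X}$ is Barr-exact; (2) the inclusion $\mathbb{X}\to\mathbb{C}$ preserves regular epimorphisms; (3) the induced Galois structure (with fibrations the regular epimorphisms in $\mathbb{C}$ and in $\mathbb{X}$) is admissible; (4) $\mathbb{C}$ is $\mathcal{S}$-protomodular, where $\mathcal{S}$ is the class of split epimorphic trivial extensions. Then $\mathcal{S}$-special regular epimorphisms are reflective amongst regular epimorphisms: the full subcategory of the category of arrows of $\mathbb{C}$ determined by the $\mathcal{S}$-special regular epimorphisms is reflective in the full subcategory determined by the regular epimorphisms.
   Context: Let $I\colon\mathbb{C}\to\mathbb{X}$ be the reflector and $\eta$ the unit; the inclusion $\mathbb{X}\to\mathbb{C}$ is omitted from the notation. Admissibility: for every object $B$ of $\mathbb{C}$, the functor from the category of regular epimorphisms $X\to I(B)$ in $\mathbb{X}$ (full subcategory of the slice $(\mathbb{X}\downarrow I(B))$) to the category of regular epimorphisms over $B$ in $\mathbb{C}$ (full subcategory of the slice $(\mathbb{C}\downarrow B)$), given by pulling back along $\eta_B\colon B\to I(B)$, is full and faithful. A trivial extension is a regular epimorphism $f\colon A\to B$ in $\mathbb{C}$ such that the naturality square $I(f)\circ\eta_A=\eta_B\circ f$ is a pullback. A point $(f,s)$ in $\mathbb{C}$ is a split epimorphism $f\colon A\to B$ with a chosen section $s\colon B\to A$, $f\circ s=1_B$; $\mathrm{Pt}(\mathbb{C})$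 is the category of points, with morphisms the pairs of morphisms commuting with both the split epimorphisms and the sections. $\mathcal{S}$ is the class of points $(f,s)$ such that $f$ is a trivial extension (a pullback-stable class). For a pullback-stable class $\mathcal{S}$ of points, $\mathbb{C}$ is $\mathcal{S}$-protomodular when: (i) for every point $(f\colon A\to B,s)$ in $\mathcal{S}$ and every $g\colon C\to B$, with pullback $\pi_2\colon C\times_B A\to A$, the pair $(\pi_2,s)$ is jointly strongly epimorphic (for pointed $\mathbb{C}$ this is equivalent to: $(k,s)$ is jointly strongly epimorphic, where $k$ is a kernel of $f$); (ii) the full subcategory of $\mathrm{Pt}(\mathbb{C})$ determined by $\mathcal{S}$ is closed under finite limits in $\mathrm{Pt}(\mathbb{C})$. A morphism $f\colon A\to B$ is $\mathcal{S}$-special when the point $(\pi_1\colon\mathrm{Eq}(f)\to A,\Delta\colon A\to\mathrm{Eq}(f))$, given by the first kernel pair projection and the diagonal, belongs to $\mathcal{S}$. *)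

theory Defs
  imports Main
begin

section \<open>Categories, functors, finite limits\<close>

text \<open>A category is given by carrier sets of objects and arrows inside two arbitrary types.
  The operations are total functions whose values outside the carriers are irrelevant.\<close>

record ('o, 'm) cat =
  Ob :: "'o set"
  Ar :: "'m set"
  Dom :: "'m \<Rightarrow> 'o"
  Cod :: "'m \<Rightarrow> 'o"
  Id :: "'o \<Rightarrow> 'm"
  Comp :: "'m \<Rightarrow> 'm \<Rightarrow> 'm"  (infixr \<open>\<cdot>\<index>\<close> 75)

definition hom :: "('o, 'm) cat \<Rightarrow> 'o \<Rightarrow> 'o \<Rightarrow> 'm set" where
  "hom C A B = {f \<in> Ar C. Dom C f = A \<and> Cod C f = B}"

definition category :: "('o, 'm) cat \<Rightarrow> bool" where
  "category C \<longleftrightarrow>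
     (\<forall>f\<in>Ar C. Dom C f \<in> Ob C \<and> Cod C f \<in> Ob C) \<and>
     (\<forall>A\<in>Ob C. Id C A \<in> hom C A A) \<and>
     (\<forall>f\<in>Ar C. \<forall>g\<in>Ar C. Cod C f = Dom C g \<longrightarrow> g \<cdot>\<^bsub>C\<^esub> f \<in> hom C (Dom C f) (Cod C g)) \<and>
     (\<forall>f\<in>Ar C. f \<cdot>\<^bsub>C\<^esub> Id C (Dom C f) = f \<and> Id C (Cod C f) \<cdot>\<^bsub>C\<^esub> f = f) \<and>
     (\<forall>f\<in>Ar C. \<forall>g\<in>Ar C. \<forall>h\<in>Ar C. Cod C f = Dom C g \<longrightarrow> Cod C g = Dom C h \<longrightarrow>
        (h \<cdot>\<^bsub>C\<^esub> g) \<cdot>\<^bsub>C\<^esub> f = h \<cdot>\<^bsub>C\<^esub> (g \<cdot>\<^bsub>C\<^esub> f))"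

definition full_subcat :: "('o, 'm) cat \<Rightarrow> 'o set \<Rightarrow> ('o, 'm) cat" where
  "full_subcat C S =
     C\<lparr>Ob := Ob C \<inter> S, Ar := {f \<in> Ar C. Dom C f \<in> S \<and> Cod C f \<in> S}\<rparr>"

record ('o1, 'm1, 'o2, 'm2) ftor =
  FOb :: "'o1 \<Rightarrow> 'o2"
  FAr :: "'m1 \<Rightarrow> 'm2"

definition is_functor ::
    "('o1, 'm1) cat \<Rightarrow> ('o2, 'm2) cat \<Rightarrow> ('o1, 'm1, 'o2, 'm2) ftor \<Rightarrow> bool" where
  "is_functor C D F \<longleftrightarrow>
     (\<forall>A\<in>Ob C. FOb F A \<in> Ob D) \<and>
     (\<forall>f\<in>Ar C. FAr F f \<in> hom D (FOb F (Dom C f)) (FOb F (Cod C f))) \<and>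
     (\<forall>A\<in>Ob C. FAr F (Id C A) = Id D (FOb F A)) \<and>
     (\<forall>f\<in>Ar C. \<forall>g\<in>Ar C. Cod C f = Dom C g \<longrightarrow>
        FAr F (g \<cdot>\<^bsub>C\<^esub> f) = FAr F g \<cdot>\<^bsub>D\<^esub> FAr F f)"

definition full ::
    "('o1, 'm1) cat \<Rightarrow> ('o2, 'm2) cat \<Rightarrow> ('o1, 'm1, 'o2, 'm2) ftor \<Rightarrow> bool" where
  "full C D F \<longleftrightarrow>
     (\<forall>A\<in>Ob C. \<forall>B\<in>Ob C. FAr F ` hom C A B = hom D (FOb F A) (FOb F B))"

definition faithful ::
    "('o1, 'm1) cat \<Rightarrow> ('o1, 'm1, 'o2, 'm2) ftor \<Rightarrow> bool" where
  "faithful C F \<longleftrightarrow> (\<forall>A\<in>Ob C. \<forall>B\<in>Ob C. inj_on (FAr F) (hom C A B))"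

definition is_cone ::
    "('j, 'k) cat \<Rightarrow> ('o, 'm) cat \<Rightarrow> ('j, 'k, 'o, 'm) ftor \<Rightarrow> 'o \<Rightarrow> ('j \<Rightarrow> 'm) \<Rightarrow> bool" where
  "is_cone J C D L \<pi> \<longleftrightarrow>
     L \<in> Ob C \<and> (\<forall>j\<in>Ob J. \<pi> j \<in> hom C L (FOb D j)) \<and>
     (\<forall>a\<in>Ar J. FAr D a \<cdot>\<^bsub>C\<^esub> \<pi> (Dom J a) = \<pi> (Cod J a))"

definition is_limit ::
    "('j, 'k) cat \<Rightarrow> ('o, 'm) cat \<Rightarrow> ('j, 'k, 'o, 'm) ftor \<Rightarrow> 'o \<Rightarrow> ('j \<Rightarrow> 'm) \<Rightarrow> bool" where
  "is_limit J C D L \<pi> \<longleftrightarrow>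
     is_cone J C D L \<pi> \<and>
     (\<forall>M \<mu>. is_cone J C D M \<mu> \<longrightarrow>
        (\<exists>!w. w \<in> hom C M L \<and> (\<forall>j\<in>Ob J. \<pi> j \<cdot>\<^bsub>C\<^esub> w = \<mu> j)))"

text \<open>Finite index categories are taken with objects and arrows coded as natural numbers;
  every finite category is isomorphic to one of this form.\<close>

definition finite_category :: "(nat, nat) cat \<Rightarrow> bool" where
  "finite_category J \<longleftrightarrow> category J \<and> finite (Ob J) \<and> finite (Ar J)"

definition finitely_complete :: "('o, 'm) cat \<Rightarrow> bool" where
  "finitely_complete C \<longleftrightarrow>
     (\<forall>J D. finite_category J \<longrightarrow> is_functor J C D \<longrightarrow> (\<exists>L \<pi>. is_limit J C D L \<pi>))"

definition closed_under_finite_limits :: "('o, 'm) cat \<Rightarrow> 'o set \<Rightarrow> bool" where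
  "closed_under_finite_limits C S \<longleftrightarrow>
     (\<forall>J D L \<pi>. finite_category J \<longrightarrow> is_functor J C D \<longrightarrow> (\<forall>j\<in>Ob J. FOb D j \<in> S) \<longrightarrow>
        is_limit J C D L \<pi> \<longrightarrow> L \<in> S)"

section \<open>Pullbacks, regular epimorphisms, Barr-exactness\<close>

text \<open>In \<open>is_pullback C p q f g\<close> the arrows \<open>p\<close> and \<open>q\<close> are the projections to the domains
  of \<open>f\<close> and \<open>g\<close> respectively; the square is \<open>f \<cdot> p = g \<cdot> q\<close>.\<close>

definition is_pullback :: "('o, 'm) cat \<Rightarrow> 'm \<Rightarrow> 'm \<Rightarrow> 'm \<Rightarrow> 'm \<Rightarrow> bool" where
  "is_pullback C p q f g \<longleftrightarrow>
     f \<in> Ar C \<and> g \<in> Ar C \<and> Cod C f = Cod C g \<and>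
     p \<in> hom C (Dom C p) (Dom C f) \<and> q \<in> hom C (Dom C p) (Dom C g) \<and>
     f \<cdot>\<^bsub>C\<^esub> p = g \<cdot>\<^bsub>C\<^esub> q \<and>
     (\<forall>T u v. u \<in> hom C T (Dom C f) \<longrightarrow> v \<in> hom C T (Dom C g) \<longrightarrow>
        f \<cdot>\<^bsub>C\<^esub> u = g \<cdot>\<^bsub>C\<^esub> v \<longrightarrow>
        (\<exists>!w. w \<in> hom C T (Dom C p) \<and> p \<cdot>\<^bsub>C\<^esub> w = u \<and> q \<cdot>\<^bsub>C\<^esub> w = v))"

definition is_kernel_pair :: "('o, 'm) cat \<Rightarrow> 'm \<Rightarrow> 'm \<Rightarrow> 'm \<Rightarrow> bool" where
  "is_kernel_pair C p q f \<longleftrightarrow> is_pullback C p q f f"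

definition parallel :: "('o, 'm) cat \<Rightarrow> 'm \<Rightarrow> 'm \<Rightarrow> bool" where
  "parallel C u v \<longleftrightarrow>
     u \<in> Ar C \<and> v \<in> Ar C \<and> Dom C u = Dom C v \<and> Cod C u = Cod C v"

definition is_coequaliser :: "('o, 'm) cat \<Rightarrow> 'm \<Rightarrow> 'm \<Rightarrow> 'm \<Rightarrow> bool" where
  "is_coequaliser C q u v \<longleftrightarrow>
     parallel C u v \<and> q \<in> Ar C \<and> Dom C q = Cod C u \<and> q \<cdot>\<^bsub>C\<^esub> u = q \<cdot>\<^bsub>C\<^esub> v \<and>
     (\<forall>h\<in>Ar C. Dom C h = Cod C u \<longrightarrow> h \<cdot>\<^bsub>C\<^esub> u = h \<cdot>\<^bsub>C\<^esub> v \<longrightarrow>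
        (\<exists>!w. w \<in> hom C (Cod C q) (Cod C h) \<and> w \<cdot>\<^bsub>C\<^esub> q = h))"

definition regular_epi :: "('o, 'm) cat \<Rightarrow> 'm \<Rightarrow> bool" where
  "regular_epi C f \<longleftrightarrow> (\<exists>u v. is_coequaliser C f u v)"

definition monic :: "('o, 'm) cat \<Rightarrow> 'm \<Rightarrow> bool" where
  "monic C m \<longleftrightarrow> m \<in> Ar C \<and>
     (\<forall>u v. parallel C u v \<longrightarrow> Cod C u = Dom C m \<longrightarrow> m \<cdot>\<^bsub>C\<^esub> u = m \<cdot>\<^bsub>C\<^esub> v \<longrightarrow> u = v)"

definition reflexive_graph :: "('o, 'm) cat \<Rightarrow> 'm \<Rightarrow> 'm \<Rightarrow> 'm \<Rightarrow> bool" where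
  "reflexive_graph C d c e \<longleftrightarrow>
     parallel C d c \<and> e \<in> hom C (Cod C d) (Dom C d) \<and>
     d \<cdot>\<^bsub>C\<^esub> e = Id C (Cod C d) \<and> c \<cdot>\<^bsub>C\<^esub> e = Id C (Cod C d)"

definition has_coequalisers_of_reflexive_graphs :: "('o, 'm) cat \<Rightarrow> bool" where
  "has_coequalisers_of_reflexive_graphs C \<longleftrightarrow>
     (\<forall>d c e. reflexive_graph C d c e \<longrightarrow> (\<exists>q. is_coequaliser C q d c))"

definition regular_category :: "('o, 'm) cat \<Rightarrow> bool" where
  "regular_category C \<longleftrightarrow>
     category C \<and> finitely_complete C \<and>
     (\<forall>p q f. is_kernel_pair C p q f \<longrightarrow> (\<exists>e. is_coequaliser C e p q)) \<and>
     (\<forall>p q f g. is_pullback C p q f g \<longrightarrow> regular_epi C g \<longrightarrow> regular_epi C p)"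

definition jointly_monic :: "('o, 'm) cat \<Rightarrow> 'm \<Rightarrow> 'm \<Rightarrow> bool" where
  "jointly_monic C r s \<longleftrightarrow>
     r \<in> Ar C \<and> s \<in> Ar C \<and> Dom C r = Dom C s \<and>
     (\<forall>u v. parallel C u v \<longrightarrow> Cod C u = Dom C r \<longrightarrow>
        r \<cdot>\<^bsub>C\<^esub> u = r \<cdot>\<^bsub>C\<^esub> v \<longrightarrow> s \<cdot>\<^bsub>C\<^esub> u = s \<cdot>\<^bsub>C\<^esub> v \<longrightarrow> u = v)"

text \<open>Internal equivalence relations; transitivity is expressed on the pullback of \<open>r2\<close>
  and \<open>r1\<close>, that is, on the object of composable pairs.\<close>

definition equivalence_relation :: "('o, 'm) cat \<Rightarrow> 'm \<Rightarrow> 'm \<Rightarrow> bool" where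
  "equivalence_relation C r1 r2 \<longleftrightarrow>
     parallel C r1 r2 \<and> jointly_monic C r1 r2 \<and>
     (\<exists>e. reflexive_graph C r1 r2 e) \<and>
     (\<exists>t. t \<in> hom C (Dom C r1) (Dom C r1) \<and> r1 \<cdot>\<^bsub>C\<^esub> t = r2 \<and> r2 \<cdot>\<^bsub>C\<^esub> t = r1) \<and>
     (\<forall>p q. is_pullback C p q r2 r1 \<longrightarrow>
        (\<exists>t. t \<in> hom C (Dom C p) (Dom C r1) \<and>
           r1 \<cdot>\<^bsub>C\<^esub> t = r1 \<cdot>\<^bsub>C\<^esub> p \<and> r2 \<cdot>\<^bsub>C\<^esub> t = r2 \<cdot>\<^bsub>C\<^esub> q))"

definition barr_exact :: "('o, 'm) cat \<Rightarrow> bool" where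
  "barr_exact C \<longleftrightarrow>
     regular_category C \<and>
     (\<forall>r1 r2. equivalence_relation C r1 r2 \<longrightarrow> (\<exists>f. is_kernel_pair C r1 r2 f))"

section \<open>Slices, arrows and points\<close>

text \<open>An arrow of each of the following categories carries its domain and codomain as its
  first two components.\<close>

definition slice :: "('o, 'm) cat \<Rightarrow> 'o \<Rightarrow> ('m, 'm \<times> 'm \<times> 'm) cat" where
  "slice C B =
    \<lparr>Ob = {f \<in> Ar C. Cod C f = B},
     Ar = {(f, g, h). f \<in> Ar C \<and> g \<in> Ar C \<and> Cod C f = B \<and> Cod C g = B \<and>
            h \<in> hom C (Dom C f) (Dom C g) \<and> g \<cdot>\<^bsub>C\<^esub> h = f},
     Dom = (\<lambda>(f, g, h). f),
     Cod = (\<lambda>(f, g, h). g),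
     Id = (\<lambda>f. (f, f, Id C (Dom C f))),
     Comp = (\<lambda>(g, g', k) (f, f', h). (f, g', k \<cdot>\<^bsub>C\<^esub> h))\<rparr>"

definition regular_epi_slice :: "('o, 'm) cat \<Rightarrow> 'o \<Rightarrow> ('m, 'm \<times> 'm \<times> 'm) cat" where
  "regular_epi_slice C B = full_subcat (slice C B) {f. regular_epi C f}"

definition arrow_cat :: "('o, 'm) cat \<Rightarrow> ('m, 'm \<times> 'm \<times> 'm \<times> 'm) cat" where
  "arrow_cat C =
    \<lparr>Ob = Ar C,
     Ar = {(f, g, h, k). f \<in> Ar C \<and> g \<in> Ar C \<and>
            h \<in> hom C (Dom C f) (Dom C g) \<and> k \<in> hom C (Cod C f) (Cod C g) \<and>
            g \<cdot>\<^bsub>C\<^esub> h = k \<cdot>\<^bsub>C\<^esub> f},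
     Dom = (\<lambda>(f, g, h, k). f),
     Cod = (\<lambda>(f, g, h, k). g),
     Id = (\<lambda>f. (f, f, Id C (Dom C f), Id C (Cod C f))),
     Comp = (\<lambda>(g, g', h', k') (f, f', h, k). (f, g', h' \<cdot>\<^bsub>C\<^esub> h, k' \<cdot>\<^bsub>C\<^esub> k))\<rparr>"

definition is_point :: "('o, 'm) cat \<Rightarrow> 'm \<Rightarrow> 'm \<Rightarrow> bool" where
  "is_point C f s \<longleftrightarrow>
     f \<in> Ar C \<and> s \<in> hom C (Cod C f) (Dom C f) \<and> f \<cdot>\<^bsub>C\<^esub> s = Id C (Cod C f)"

definition point_cat ::
    "('o, 'm) cat \<Rightarrow> ('m \<times> 'm, ('m \<times> 'm) \<times> ('m \<times> 'm) \<times> 'm \<times> 'm) cat" where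
  "point_cat C =
    \<lparr>Ob = {(f, s). is_point C f s},
     Ar = {((f, s), (f', s'), h, k). is_point C f s \<and> is_point C f' s' \<and>
            h \<in> hom C (Dom C f) (Dom C f') \<and> k \<in> hom C (Cod C f) (Cod C f') \<and>
            f' \<cdot>\<^bsub>C\<^esub> h = k \<cdot>\<^bsub>C\<^esub> f \<and> h \<cdot>\<^bsub>C\<^esub> s = s' \<cdot>\<^bsub>C\<^esub> k},
     Dom = (\<lambda>(x, y, h, k). x),
     Cod = (\<lambda>(x, y, h, k). y),
     Id = (\<lambda>(f, s). ((f, s), (f, s), Id C (Dom C f), Id C (Cod C f))),
     Comp = (\<lambda>(y, y', h', k') (x, x', h, k). (x, y', h' \<cdot>\<^bsub>C\<^esub> h, k' \<cdot>\<^bsub>C\<^esub> k))\<rparr>"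

section \<open>Reflective subcategories and admissibility\<close>

text \<open>\<open>reflector C S F \<eta>\<close>: the functor \<open>F\<close> is left adjoint to the inclusion of the full
  subcategory of \<open>C\<close> on the objects \<open>S\<close>, with unit \<open>\<eta>\<close>.\<close>

definition reflector ::
    "('o, 'm) cat \<Rightarrow> 'o set \<Rightarrow> ('o, 'm, 'o, 'm) ftor \<Rightarrow> ('o \<Rightarrow> 'm) \<Rightarrow> bool" where
  "reflector C S F \<eta> \<longleftrightarrow>
     S \<subseteq> Ob C \<and> is_functor C (full_subcat C S) F \<and>
     (\<forall>A\<in>Ob C. \<eta> A \<in> hom C A (FOb F A)) \<and>
     (\<forall>f\<in>Ar C. FAr F f \<cdot>\<^bsub>C\<^esub> \<eta> (Dom C f) = \<eta> (Cod C f) \<cdot>\<^bsub>C\<^esub> f) \<and>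
     (\<forall>A\<in>Ob C. \<forall>X\<in>S. \<forall>f\<in>hom C A X. \<exists>!g. g \<in> hom C (FOb F A) X \<and> g \<cdot>\<^bsub>C\<^esub> \<eta> A = f)"

definition reflective :: "('o, 'm) cat \<Rightarrow> 'o set \<Rightarrow> bool" where
  "reflective C S \<longleftrightarrow> (\<exists>F \<eta>. reflector C S F \<eta>)"

definition chosen_pullback :: "('o, 'm) cat \<Rightarrow> 'm \<Rightarrow> 'm \<Rightarrow> 'm \<times> 'm" where
  "chosen_pullback C f g = (SOME (p, q). is_pullback C p q f g)"

text \<open>The functor between slices that pulls back along \<open>b\<close>: an arrow \<open>\<phi>\<close> into the codomain of
  \<open>b\<close> is sent to the projection of the chosen pullback to the domain of \<open>b\<close>.\<close>

definition pullback_functor ::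
    "('o, 'm) cat \<Rightarrow> 'm \<Rightarrow> ('m, 'm \<times> 'm \<times> 'm, 'm, 'm \<times> 'm \<times> 'm) ftor" where
  "pullback_functor C b =
    \<lparr>FOb = (\<lambda>\<phi>. fst (chosen_pullback C b \<phi>)),
     FAr = (\<lambda>(\<phi>, \<psi>, u).
       (let (p, q) = chosen_pullback C b \<phi>; (p', q') = chosen_pullback C b \<psi>
        in (p, p', THE w. w \<in> hom C (Dom C p) (Dom C p') \<and>
                     p' \<cdot>\<^bsub>C\<^esub> w = p \<and> q' \<cdot>\<^bsub>C\<^esub> w = u \<cdot>\<^bsub>C\<^esub> q)))\<rparr>"

definition admissible ::
    "('o, 'm) cat \<Rightarrow> 'o set \<Rightarrow> ('o, 'm, 'o, 'm) ftor \<Rightarrow> ('o \<Rightarrow> 'm) \<Rightarrow> bool" where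
  "admissible C S F \<eta> \<longleftrightarrow>
     (\<forall>B\<in>Ob C.
        full (regular_epi_slice (full_subcat C S) (FOb F B)) (regular_epi_slice C B)
          (pullback_functor C (\<eta> B)) \<and>
        faithful (regular_epi_slice (full_subcat C S) (FOb F B)) (pullback_functor C (\<eta> B)))"

definition trivial_extension ::
    "('o, 'm) cat \<Rightarrow> ('o, 'm, 'o, 'm) ftor \<Rightarrow> ('o \<Rightarrow> 'm) \<Rightarrow> 'm \<Rightarrow> bool" where
  "trivial_extension C F \<eta> f \<longleftrightarrow>
     regular_epi C f \<and> is_pullback C f (\<eta> (Dom C f)) (\<eta> (Cod C f)) (FAr F f)"

definition trivial_points ::
    "('o, 'm) cat \<Rightarrow> ('o, 'm, 'o, 'm) ftor \<Rightarrow> ('o \<Rightarrow> 'm) \<Rightarrow> ('m \<times> 'm) set" where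
  "trivial_points C F \<eta> = {(f, s). is_point C f s \<and> trivial_extension C F \<eta> f}"

section \<open>Protomodularity relative to a class of points\<close>

text \<open>Jointly strongly epimorphic: jointly epimorphic, and with the diagonal fill-in property
  against every monomorphism.\<close>

definition jointly_strongly_epic :: "('o, 'm) cat \<Rightarrow> 'm \<Rightarrow> 'm \<Rightarrow> bool" where
  "jointly_strongly_epic C a b \<longleftrightarrow>
     a \<in> Ar C \<and> b \<in> Ar C \<and> Cod C a = Cod C b \<and>
     (\<forall>u v. parallel C u v \<longrightarrow> Dom C u = Cod C a \<longrightarrow>
        u \<cdot>\<^bsub>C\<^esub> a = v \<cdot>\<^bsub>C\<^esub> a \<longrightarrow> u \<cdot>\<^bsub>C\<^esub> b = v \<cdot>\<^bsub>C\<^esub> b \<longrightarrow> u = v) \<and>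
     (\<forall>m h u v. monic C m \<longrightarrow> h \<in> hom C (Cod C a) (Cod C m) \<longrightarrow>
        u \<in> hom C (Dom C a) (Dom C m) \<longrightarrow> v \<in> hom C (Dom C b) (Dom C m) \<longrightarrow>
        m \<cdot>\<^bsub>C\<^esub> u = h \<cdot>\<^bsub>C\<^esub> a \<longrightarrow> m \<cdot>\<^bsub>C\<^esub> v = h \<cdot>\<^bsub>C\<^esub> b \<longrightarrow>
        (\<exists>d. d \<in> hom C (Cod C a) (Dom C m) \<and>
           m \<cdot>\<^bsub>C\<^esub> d = h \<and> d \<cdot>\<^bsub>C\<^esub> a = u \<and> d \<cdot>\<^bsub>C\<^esub> b = v))"

definition protomodular_wrt :: "('o, 'm) cat \<Rightarrow> ('m \<times> 'm) set \<Rightarrow> bool" where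
  "protomodular_wrt C S \<longleftrightarrow>
     (\<forall>f s g p1 p2. (f, s) \<in> S \<longrightarrow> is_pullback C p1 p2 g f \<longrightarrow>
        jointly_strongly_epic C p2 s) \<and>
     closed_under_finite_limits (point_cat C) S"

text \<open>Kernel pairs are only determined up to isomorphism, so one asks for some kernel pair;
  \<open>d\<close> is the diagonal.\<close>

definition special :: "('o, 'm) cat \<Rightarrow> ('m \<times> 'm) set \<Rightarrow> 'm \<Rightarrow> bool" where
  "special C S f \<longleftrightarrow>
     (\<exists>p1 p2 d. is_kernel_pair C p1 p2 f \<and> d \<in> hom C (Dom C f) (Dom C p1) \<and>
        p1 \<cdot>\<^bsub>C\<^esub> d = Id C (Dom C f) \<and> p2 \<cdot>\<^bsub>C\<^esub> d = Id C (Dom C f) \<and> (p1, d) \<in> S)"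

end

theory Submission
  imports Defs
begin

text \<open>The kernel pair \<open>R\<close> of an extension \<open>f : A \<rightarrow> B\<close> is an internal groupoid. An extension
  \<open>g : A' \<rightarrow> B'\<close> with kernel pair \<open>R'\<close> is special when the square from \<open>R' \<rightarrow> A'\<close> to its reflection is
  a pullback. In that case admissibility makes the reflector preserve the pullback of composable
  pairs of \<open>R'\<close>, so the reflection of \<open>R'\<close> is a groupoid in the subcategory, and \<open>R'\<close> can be
  recovered from it. A morphism from \<open>f\<close> to \<open>g\<close> thus gives a functor from \<open>R\<close> to a groupoid
  in the subcategory. The reflection of \<open>f\<close> is built from the universal such functor
  \<open>\<omega> : R \<rightarrow> W\<close>, where \<open>W\<close> has the reflection of \<open>A\<close> as its object of objects.

  To obtain \<open>W\<close>, apply the reflector to \<open>R\<close>. This gives a reflexive graph with a multivalued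
  composition, because the pullback of composable pairs need not be preserved. Protomodularity
  relative to the trivial points makes the two injections into a product of points of the subcategory
  jointly strongly epimorphic (\<open>product_injections_jointly_epic\<close>), since all split epimorphisms
  of the subcategory are trivial. It follows that every composable pair has a composite on a cover, that
  forcing composites to be unique produces a well defined composition on the quotient \<open>W\<close>, and that
  this composition is associative: each assertion compares arrows on a product of points, and on
  the injections some factor is an identity. The result is \<open>generated_groupoid_exists\<close>.

  The functor \<open>\<omega>\<close> is a cocycle on \<open>f\<close> with values in \<open>W\<close>, and it classifies a principal bundle
  over \<open>B\<close>: the quotient of the object of pairs \<open>(x, v)\<close>, with \<open>x\<close> in \<open>A\<close> and \<open>v\<close> in \<open>W\<close> starting at
  the image of \<open>x\<close>, by the relation \<open>(x, \<omega> x y v) \<sim> (y, v)\<close>. This quotient exists and is effective by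
  exactness. Principality says that the kernel pair projection of the bundle is a pullback of the source
  arrow of \<open>W\<close> (\<open>kernel_pair_fbar\<close>), and admissibility turns such pullbacks into trivial extensions,
  so the bundle is special (\<open>fbar_special\<close>). A morphism from \<open>f\<close> to a special \<open>g\<close> induces a functor on \<open>W\<close>,
  hence an arrow on pairs \<open>(x, v)\<close> that respects the relation (\<open>factorisation_exists\<close>), and it is
  determined by its values on the pairs \<open>(x, 1)\<close> because the object of pairs has \<open>W\<close> as its reflection
  (\<open>factorisation_unique\<close>).

  The computations use generalised elements: an element of \<open>A\<close> is any arrow with codomain \<open>A\<close>, and
  statements that hold only on a cover, after composition with a regular epimorphism, are descended at
  the end.\<close>

section \<open>Categories\<close>

locale plain_category =
  fixes C :: "('o, 'm) cat" (structure)
  assumes category: "category C"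
begin

lemma in_hom [simp]: "f \<in> hom C A B \<longleftrightarrow> f \<in> Ar C \<and> Dom C f = A \<and> Cod C f = B"
  by (simp add: hom_def)

lemma Dom_Ob [simp]: "f \<in> Ar C \<Longrightarrow> Dom C f \<in> Ob C"
  and Cod_Ob [simp]: "f \<in> Ar C \<Longrightarrow> Cod C f \<in> Ob C"
  and Id_Ar [simp]: "A \<in> Ob C \<Longrightarrow> Id C A \<in> Ar C"
  and Dom_Id [simp]: "A \<in> Ob C \<Longrightarrow> Dom C (Id C A) = A"
  and Cod_Id [simp]: "A \<in> Ob C \<Longrightarrow> Cod C (Id C A) = A"
  using category by (auto simp: category_def hom_def)

lemma comp_Ar [simp]: "f \<in> Ar C \<Longrightarrow> g \<in> Ar C \<Longrightarrow> Cod C f = Dom C g \<Longrightarrow> g \<cdot> f \<in> Ar C"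
  and Dom_comp [simp]: "f \<in> Ar C \<Longrightarrow> g \<in> Ar C \<Longrightarrow> Cod C f = Dom C g \<Longrightarrow> Dom C (g \<cdot> f) = Dom C f"
  and Cod_comp [simp]: "f \<in> Ar C \<Longrightarrow> g \<in> Ar C \<Longrightarrow> Cod C f = Dom C g \<Longrightarrow> Cod C (g \<cdot> f) = Cod C g"
  using category by (auto simp: category_def hom_def)

lemma comp_Id [simp]: "f \<in> Ar C \<Longrightarrow> Dom C f = A \<Longrightarrow> f \<cdot> Id C A = f"
  and Id_comp [simp]: "f \<in> Ar C \<Longrightarrow> Cod C f = A \<Longrightarrow> Id C A \<cdot> f = f"
  using category by (auto simp: category_def)

lemma comp_assoc [simp]:
  "f \<in> Ar C \<Longrightarrow> g \<in> Ar C \<Longrightarrow> h \<in> Ar C \<Longrightarrow> Cod C f = Dom C g \<Longrightarrow> Cod C g = Dom C h \<Longrightarrow>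
   (h \<cdot> g) \<cdot> f = h \<cdot> (g \<cdot> f)"
  using category by (auto simp: category_def)

text \<open>With composites normalised to the right by the simplifier, an equation \<open>h \<cdot> g = k\<close> no longer
  matches inside \<open>h \<cdot> (g \<cdot> f)\<close>. This rule produces its version on a generalised element \<open>f\<close>, and
  most equations below are used in that form.\<close>

lemma comp_left_cong:
  "h \<cdot> g = k \<Longrightarrow> f \<in> Ar C \<Longrightarrow> g \<in> Ar C \<Longrightarrow> h \<in> Ar C \<Longrightarrow> Cod C f = Dom C g \<Longrightarrow> Cod C g = Dom C h \<Longrightarrow>
   h \<cdot> (g \<cdot> f) = k \<cdot> f"
  using comp_assoc by metis

lemma parallelI:
  "u \<in> Ar C \<Longrightarrow> v \<in> Ar C \<Longrightarrow> Dom C u = Dom C v \<Longrightarrow> Cod C u = Cod C v \<Longrightarrow> parallel C u v"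
  by (simp add: parallel_def)

lemma monicD:
  "monic C m \<Longrightarrow> m \<cdot> u = m \<cdot> v \<Longrightarrow> u \<in> Ar C \<Longrightarrow> v \<in> Ar C \<Longrightarrow> Dom C u = Dom C v \<Longrightarrow>
   Cod C u = Dom C m \<Longrightarrow> Cod C v = Dom C m \<Longrightarrow> u = v"
  by (simp add: monic_def parallel_def)

subsection \<open>Pullbacks\<close>

text \<open>Only the projections enter as arguments: they determine the mediating arrow once they belong
  to a pullback.\<close>

definition pair :: "'m \<Rightarrow> 'm \<Rightarrow> 'm \<Rightarrow> 'm \<Rightarrow> 'm" where
  "pair p q u v = (THE w. w \<in> hom C (Dom C u) (Dom C p) \<and> p \<cdot> w = u \<and> q \<cdot> w = v)"

lemma pullbackD:
  assumes "is_pullback C p q f g"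
  shows "f \<in> Ar C" "g \<in> Ar C" "p \<in> Ar C" "q \<in> Ar C" "Cod C f = Cod C g"
    "Dom C q = Dom C p" "Cod C p = Dom C f" "Cod C q = Dom C g" "f \<cdot> p = g \<cdot> q"
  using assms by (auto simp: is_pullback_def)

lemma pullback_unique:
  assumes "is_pullback C p q f g" "u \<in> Ar C" "v \<in> Ar C" "Dom C u = Dom C v"
    "Cod C u = Dom C f" "Cod C v = Dom C g" "f \<cdot> u = g \<cdot> v"
  shows "\<exists>!w. w \<in> hom C (Dom C u) (Dom C p) \<and> p \<cdot> w = u \<and> q \<cdot> w = v"
proof -
  have "\<forall>T u v. u \<in> hom C T (Dom C f) \<longrightarrow> v \<in> hom C T (Dom C g) \<longrightarrow> f \<cdot> u = g \<cdot> v \<longrightarrow>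
        (\<exists>!w. w \<in> hom C T (Dom C p) \<and> p \<cdot> w = u \<and> q \<cdot> w = v)"
    using assms(1) unfolding is_pullback_def by blast
  moreover have "u \<in> hom C (Dom C u) (Dom C f)" "v \<in> hom C (Dom C u) (Dom C g)"
    using assms by auto
  ultimately show ?thesis using assms(7) by blast
qed

lemma pair:
  assumes "is_pullback C p q f g" "u \<in> Ar C" "v \<in> Ar C" "Dom C u = Dom C v"
    "Cod C u = Dom C f" "Cod C v = Dom C g" "f \<cdot> u = g \<cdot> v"
  shows "pair p q u v \<in> Ar C" "Dom C (pair p q u v) = Dom C u" "Cod C (pair p q u v) = Dom C p"
    "p \<cdot> pair p q u v = u" "q \<cdot> pair p q u v = v"
  using theI'[OF pullback_unique[OF assms]] unfolding pair_def by auto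

lemma pullback_comm:
  assumes "is_pullback C p q f g" "x \<in> Ar C" "Cod C x = Dom C p"
  shows "f \<cdot> (p \<cdot> x) = g \<cdot> (q \<cdot> x)"
  using pullbackD[OF assms(1)] assms(2,3) by (metis comp_assoc)

lemma pullback_eqI:
  assumes "is_pullback C p q f g" "p \<cdot> u = p \<cdot> v" "q \<cdot> u = q \<cdot> v"
    "u \<in> Ar C" "v \<in> Ar C" "Dom C u = Dom C v" "Cod C u = Dom C p" "Cod C v = Dom C p"
  shows "u = v"
proof -
  note D = pullbackD[OF assms(1)]
  have "\<exists>!w. w \<in> hom C (Dom C (p \<cdot> u)) (Dom C p) \<and> p \<cdot> w = p \<cdot> u \<and> q \<cdot> w = q \<cdot> u"
    using D assms pullback_comm[OF assms(1)] by (intro pullback_unique[OF assms(1)]) auto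
  then show ?thesis using assms D by (metis Dom_comp in_hom)
qed

lemma pair_comp:
  assumes "is_pullback C p q f g" "u \<in> Ar C" "v \<in> Ar C" "Dom C u = Dom C v"
    "Cod C u = Dom C f" "Cod C v = Dom C g" "f \<cdot> u = g \<cdot> v" "k \<in> Ar C" "Cod C k = Dom C u"
  shows "pair p q u v \<cdot> k = pair p q (u \<cdot> k) (v \<cdot> k)"
proof -
  note D = pullbackD[OF assms(1)] and P = pair[OF assms(1-7)]
  have eq: "f \<cdot> (u \<cdot> k) = g \<cdot> (v \<cdot> k)"
    using assms D by (metis comp_assoc)
  have Q: "pair p q (u \<cdot> k) (v \<cdot> k) \<in> Ar C" "Dom C (pair p q (u \<cdot> k) (v \<cdot> k)) = Dom C k"
    "Cod C (pair p q (u \<cdot> k) (v \<cdot> k)) = Dom C p"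
    "p \<cdot> pair p q (u \<cdot> k) (v \<cdot> k) = u \<cdot> k" "q \<cdot> pair p q (u \<cdot> k) (v \<cdot> k) = v \<cdot> k"
    using pair[OF assms(1), of "u \<cdot> k" "v \<cdot> k"] assms D eq by simp_all
  have "p \<cdot> (pair p q u v \<cdot> k) = u \<cdot> k" "q \<cdot> (pair p q u v \<cdot> k) = v \<cdot> k"
    by (rule comp_left_cong[OF P(4)] comp_left_cong[OF P(5)]; simp add: P D assms(2-))+
  then show ?thesis
    by - (rule pullback_eqI[OF assms(1)]; simp add: Q P D assms(2-))
qed

lemma pair_eta:
  assumes "is_pullback C p q f g" "x \<in> Ar C" "Cod C x = Dom C p"
  shows "pair p q (p \<cdot> x) (q \<cdot> x) = x"
proof -
  note D = pullbackD[OF assms(1)]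
  have P: "pair p q (p \<cdot> x) (q \<cdot> x) \<in> Ar C" "Dom C (pair p q (p \<cdot> x) (q \<cdot> x)) = Dom C (p \<cdot> x)"
    "Cod C (pair p q (p \<cdot> x) (q \<cdot> x)) = Dom C p"
    "p \<cdot> pair p q (p \<cdot> x) (q \<cdot> x) = p \<cdot> x" "q \<cdot> pair p q (p \<cdot> x) (q \<cdot> x) = q \<cdot> x"
    by (rule pair[OF assms(1)]; simp add: D assms(2,3) pullback_comm[OF assms])+
  show ?thesis
    by (rule pullback_eqI[OF assms(1)]; simp add: P D assms(2,3))
qed

lemma pullbackI:
  assumes "f \<in> Ar C" "g \<in> Ar C" "p \<in> Ar C" "q \<in> Ar C" "Cod C f = Cod C g"
    "Dom C q = Dom C p" "Cod C p = Dom C f" "Cod C q = Dom C g" "f \<cdot> p = g \<cdot> q"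
    and ex: "\<And>u v. u \<in> Ar C \<Longrightarrow> v \<in> Ar C \<Longrightarrow> Dom C v = Dom C u \<Longrightarrow> Cod C u = Dom C f \<Longrightarrow>
      Cod C v = Dom C g \<Longrightarrow> f \<cdot> u = g \<cdot> v \<Longrightarrow>
      \<exists>w. w \<in> Ar C \<and> Dom C w = Dom C u \<and> Cod C w = Dom C p \<and> p \<cdot> w = u \<and> q \<cdot> w = v"
    and uniq: "\<And>u v. u \<in> Ar C \<Longrightarrow> v \<in> Ar C \<Longrightarrow> Dom C v = Dom C u \<Longrightarrow> Cod C u = Dom C p \<Longrightarrow>
      Cod C v = Dom C p \<Longrightarrow> p \<cdot> u = p \<cdot> v \<Longrightarrow> q \<cdot> u = q \<cdot> v \<Longrightarrow> u = v"
  shows "is_pullback C p q f g"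
  unfolding is_pullback_def
proof (intro conjI allI impI)
  fix T u v
  assume uv: "u \<in> hom C T (Dom C f)" "v \<in> hom C T (Dom C g)" "f \<cdot> u = g \<cdot> v"
  then obtain w where "w \<in> Ar C" "Dom C w = T" "Cod C w = Dom C p" "p \<cdot> w = u" "q \<cdot> w = v"
    using ex[of u v] by auto
  then show "\<exists>!w. w \<in> hom C T (Dom C p) \<and> p \<cdot> w = u \<and> q \<cdot> w = v"
    using uniq by (intro ex1I[of _ w]) auto
qed (use assms in auto)

end

text \<open>The shape of a pullback: the identities \<open>0\<close>, \<open>1\<close>, \<open>2\<close> and the arrows \<open>3 : 0 \<rightarrow> 2\<close> and \<open>4 : 1 \<rightarrow> 2\<close>.
  Since every composable pair contains an identity, the composite is always the other factor.\<close>

definition cospan :: "(nat, nat) cat" where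
  "cospan = \<lparr>Ob = {0, 1, 2}, Ar = {0, 1, 2, 3, 4},
     Dom = (\<lambda>a. if a = 3 then 0 else if a = 4 then 1 else a),
     Cod = (\<lambda>a. if a \<ge> 3 then 2 else a), Id = (\<lambda>a. a),
     Comp = (\<lambda>b a. if b < 3 then a else b)\<rparr>"

lemma finite_category_cospan: "finite_category cospan"
  by (auto simp: finite_category_def category_def cospan_def hom_def)

lemma (in plain_category) pullback_exists:
  assumes "finitely_complete C" "f \<in> Ar C" "g \<in> Ar C" "Cod C f = Cod C g"
  obtains p q where "is_pullback C p q f g"
proof -
  define F :: "(nat, nat, 'o, 'm) ftor" where
    "F = \<lparr>FOb = (\<lambda>j. if j = 0 then Dom C f else if j = 1 then Dom C g else Cod C f),
          FAr = (\<lambda>a. if a = 3 then f else if a = 4 then g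
                 else Id C (if a = 0 then Dom C f else if a = 1 then Dom C g else Cod C f))\<rparr>"
  have "is_functor cospan C F"
    using assms by (auto simp: is_functor_def F_def cospan_def)
  then obtain L \<pi> where lim: "is_limit cospan C F L \<pi>"
    using assms(1) finite_category_cospan unfolding finitely_complete_def by blast
  have cone: "\<pi> 0 \<in> hom C L (Dom C f)" "\<pi> 1 \<in> hom C L (Dom C g)" "\<pi> 2 \<in> hom C L (Cod C f)"
    "f \<cdot> \<pi> 0 = \<pi> 2" "g \<cdot> \<pi> 1 = \<pi> 2"
    using lim by (auto simp: is_limit_def is_cone_def cospan_def F_def)
  have univ: "\<exists>!w. w \<in> hom C T L \<and> \<pi> 0 \<cdot> w = u \<and> \<pi> 1 \<cdot> w = v"
    if uv: "u \<in> hom C T (Dom C f)" "v \<in> hom C T (Dom C g)" "f \<cdot> u = g \<cdot> v" for T u v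
  proof -
    define \<mu> :: "nat \<Rightarrow> 'm" where "\<mu> = (\<lambda>j. if j = 0 then u else if j = 1 then v else f \<cdot> u)"
    have "is_cone cospan C F T \<mu>"
      using uv assms by (auto simp: is_cone_def cospan_def F_def \<mu>_def)
    then have "\<exists>!w. w \<in> hom C T L \<and> (\<forall>j\<in>Ob cospan. \<pi> j \<cdot> w = \<mu> j)"
      using lim by (auto simp: is_limit_def)
    moreover have "(w \<in> hom C T L \<and> (\<forall>j\<in>Ob cospan. \<pi> j \<cdot> w = \<mu> j)) \<longleftrightarrow>
        (w \<in> hom C T L \<and> \<pi> 0 \<cdot> w = u \<and> \<pi> 1 \<cdot> w = v)" for w
    proof -
      have "\<pi> 2 \<cdot> w = f \<cdot> u" if "w \<in> hom C T L" "\<pi> 0 \<cdot> w = u"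
        using comp_left_cong[OF cone(4), of w] cone that assms by auto
      then show ?thesis by (auto simp: cospan_def \<mu>_def)
    qed
    ultimately show ?thesis by simp
  qed
  have "is_pullback C (\<pi> 0) (\<pi> 1) f g"
    unfolding is_pullback_def using cone univ assms by auto
  then show ?thesis by (rule that)
qed

section \<open>Regular epimorphisms\<close>

context plain_category
begin

lemma regular_epiE:
  assumes "regular_epi C f"
  obtains u v where "u \<in> Ar C" "v \<in> Ar C" "Dom C u = Dom C v" "Cod C u = Dom C f" "Cod C v = Dom C f"
    "f \<in> Ar C" "f \<cdot> u = f \<cdot> v"
    "\<And>h. h \<in> Ar C \<Longrightarrow> Dom C h = Dom C f \<Longrightarrow> h \<cdot> u = h \<cdot> v \<Longrightarrow>
      \<exists>!w. w \<in> hom C (Cod C f) (Cod C h) \<and> w \<cdot> f = h"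
proof -
  obtain u v where c: "is_coequaliser C f u v"
    using assms unfolding regular_epi_def by blast
  then have *: "parallel C u v" "f \<in> Ar C" "Dom C f = Cod C u" "f \<cdot> u = f \<cdot> v"
    and un: "\<forall>h\<in>Ar C. Dom C h = Cod C u \<longrightarrow> h \<cdot> u = h \<cdot> v \<longrightarrow>
      (\<exists>!w. w \<in> hom C (Cod C f) (Cod C h) \<and> w \<cdot> f = h)"
    unfolding is_coequaliser_def by blast+
  show ?thesis
    by (rule that[of u v]) (use * un in \<open>auto simp: parallel_def\<close>)
qed

lemma regular_epi_Ar [simp]: "regular_epi C f \<Longrightarrow> f \<in> Ar C"
  using regular_epiE by blast

lemma regular_epi_cancel:
  assumes "regular_epi C e" "u \<cdot> e = v \<cdot> e" "u \<in> Ar C" "v \<in> Ar C" "Dom C u = Cod C e"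
    "Dom C v = Cod C e" "Cod C u = Cod C v"
  shows "u = v"
proof -
  obtain a b where ab: "a \<in> Ar C" "b \<in> Ar C" "Dom C a = Dom C b" "Cod C a = Dom C e" "Cod C b = Dom C e"
    "e \<in> Ar C" "e \<cdot> a = e \<cdot> b"
    and un: "\<And>h. h \<in> Ar C \<Longrightarrow> Dom C h = Dom C e \<Longrightarrow> h \<cdot> a = h \<cdot> b \<Longrightarrow>
      \<exists>!w. w \<in> hom C (Cod C e) (Cod C h) \<and> w \<cdot> e = h"
    by (rule regular_epiE[OF assms(1)]) (rule that; assumption)
  have "\<exists>!w. w \<in> hom C (Cod C e) (Cod C (u \<cdot> e)) \<and> w \<cdot> e = u \<cdot> e"
    using assms ab by (intro un) auto
  then show ?thesis using assms ab by (metis Cod_comp in_hom)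
qed

text \<open>The kernel of \<open>e\<close> is expressed by all pairs of generalised elements, so that no kernel pair has to
  be chosen.\<close>

lemma regular_epi_descend:
  assumes "regular_epi C e" "h \<in> Ar C" "Dom C h = Dom C e"
    and "\<And>u v. u \<in> Ar C \<Longrightarrow> v \<in> Ar C \<Longrightarrow> Dom C v = Dom C u \<Longrightarrow> Cod C u = Dom C e \<Longrightarrow>
      Cod C v = Dom C e \<Longrightarrow> e \<cdot> u = e \<cdot> v \<Longrightarrow> h \<cdot> u = h \<cdot> v"
  obtains w where "w \<in> Ar C" "Dom C w = Cod C e" "Cod C w = Cod C h" "w \<cdot> e = h"
proof -
  obtain a b where ab: "a \<in> Ar C" "b \<in> Ar C" "Dom C a = Dom C b" "Cod C a = Dom C e" "Cod C b = Dom C e"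
    "e \<in> Ar C" "e \<cdot> a = e \<cdot> b"
    and un: "\<And>h. h \<in> Ar C \<Longrightarrow> Dom C h = Dom C e \<Longrightarrow> h \<cdot> a = h \<cdot> b \<Longrightarrow>
      \<exists>!w. w \<in> hom C (Cod C e) (Cod C h) \<and> w \<cdot> e = h"
    by (rule regular_epiE[OF assms(1)]) (rule that; assumption)
  have "\<exists>!w. w \<in> hom C (Cod C e) (Cod C h) \<and> w \<cdot> e = h"
    using assms ab by (intro un assms(4)) auto
  then show ?thesis using that by auto
qed

text \<open>Regular epimorphisms are strong: \<open>h\<close> is constant on the kernel of \<open>e\<close>, because \<open>m \<cdot> h\<close> is and
  \<open>m\<close> is monic.\<close>

lemma regular_epi_strong:
  assumes "regular_epi C e" "monic C m" "m \<cdot> h = k \<cdot> e" "h \<in> Ar C" "k \<in> Ar C"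
    "Dom C h = Dom C e" "Cod C h = Dom C m" "Dom C k = Cod C e" "Cod C k = Cod C m"
  obtains d where "d \<in> Ar C" "Dom C d = Cod C e" "Cod C d = Dom C m" "m \<cdot> d = k"
proof -
  have m: "m \<in> Ar C" and e: "e \<in> Ar C" using assms by (auto simp: monic_def)
  have "h \<cdot> u = h \<cdot> v" if "u \<in> Ar C" "v \<in> Ar C" "Dom C v = Dom C u" "Cod C u = Dom C e"
      "Cod C v = Dom C e" "e \<cdot> u = e \<cdot> v" for u v
  proof (rule monicD[OF assms(2)])
    show "m \<cdot> (h \<cdot> u) = m \<cdot> (h \<cdot> v)"
      using that assms m e comp_left_cong[OF assms(3)] by simp
  qed (use that assms m e in auto)
  then obtain d where d: "d \<in> Ar C" "Dom C d = Cod C e" "Cod C d = Cod C h" "d \<cdot> e = h"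
    using regular_epi_descend[OF assms(1,4,6)] by blast
  have "m \<cdot> d = k"
    using assms d m e by - (rule regular_epi_cancel[OF assms(1)]; auto)
  with d show ?thesis using that assms by auto
qed

lemma split_epi_regular:
  assumes "f \<in> Ar C" "s \<in> Ar C" "Dom C s = Cod C f" "Cod C s = Dom C f" "f \<cdot> s = Id C (Cod C f)"
  shows "regular_epi C f"
  unfolding regular_epi_def is_coequaliser_def
proof (intro exI conjI ballI impI)
  show "parallel C (Id C (Dom C f)) (s \<cdot> f)" using assms by (auto intro: parallelI)
  show "f \<cdot> Id C (Dom C f) = f \<cdot> (s \<cdot> f)" using assms comp_left_cong[OF assms(5), of f] by simp
  fix h
  assume h: "h \<in> Ar C" "Dom C h = Cod C (Id C (Dom C f))" "h \<cdot> Id C (Dom C f) = h \<cdot> (s \<cdot> f)"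
  show "\<exists>!w. w \<in> hom C (Cod C f) (Cod C h) \<and> w \<cdot> f = h"
  proof (rule ex1I[of _ "h \<cdot> s"])
    fix w assume w: "w \<in> hom C (Cod C f) (Cod C h) \<and> w \<cdot> f = h"
    then have "h \<cdot> s = w \<cdot> (f \<cdot> s)" using assms by auto
    then show "w = h \<cdot> s" using w assms by simp
  qed (use assms h in auto)
qed (use assms in auto)

end

locale regular_cat = plain_category +
  assumes regular: "regular_category C"
begin

lemma pullback:
  assumes "f \<in> Ar C" "g \<in> Ar C" "Cod C f = Cod C g"
  obtains p q where "is_pullback C p q f g"
  using pullback_exists[OF _ assms] regular unfolding regular_category_def by blast

lemma regular_epi_pullback:
  "is_pullback C p q f g \<Longrightarrow> regular_epi C g \<Longrightarrow> regular_epi C p"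
  using regular unfolding regular_category_def by blast

text \<open>The lift exists on the pullback of \<open>q\<close> along \<open>y\<close>, whose projection is again a regular epimorphism.
  Together with \<open>regular_epi_cancel\<close> this allows arguments with elements as in a category of sets.\<close>

lemma regular_epi_lift:
  assumes "regular_epi C q" "y \<in> Ar C" "Cod C y = Cod C q"
  obtains e t where "regular_epi C e" "e \<in> Ar C" "Cod C e = Dom C y" "t \<in> Ar C" "Dom C t = Dom C e"
    "Cod C t = Dom C q" "q \<cdot> t = y \<cdot> e"
proof -
  obtain e t where *: "is_pullback C e t y q"
    using pullback[of y q] assms regular_epi_Ar by metis
  show ?thesis
    using that[of e t] regular_epi_pullback[OF * assms(1)] pullbackD[OF *] by simp
qed

text \<open>The image factorisation of a regular category. The quotient \<open>e\<close> of the kernel pair of \<open>f\<close> leaves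
  a remaining factor \<open>m\<close>, which is monic since any two elements that it identifies lift to \<open>Dom f\<close>
  on a common cover; extremality of \<open>f\<close> then inverts \<open>m\<close>.\<close>

lemma regular_epi_if_extremal:
  assumes f: "f \<in> Ar C"
    and ext: "\<And>m h. monic C m \<Longrightarrow> h \<in> Ar C \<Longrightarrow> Dom C h = Dom C f \<Longrightarrow> Cod C h = Dom C m \<Longrightarrow>
      Cod C m = Cod C f \<Longrightarrow> m \<cdot> h = f \<Longrightarrow>
      \<exists>d. d \<in> Ar C \<and> Dom C d = Cod C f \<and> Cod C d = Dom C m \<and> m \<cdot> d = Id C (Cod C f)"
  shows "regular_epi C f"
proof -
  obtain k1 k2 where K: "is_pullback C k1 k2 f f" using pullback[OF f f] by auto
  note KD = pullbackD[OF K]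
  obtain e where e: "is_coequaliser C e k1 k2"
    using regular K unfolding regular_category_def is_kernel_pair_def by blast
  have eD: "e \<in> Ar C" "Dom C e = Dom C f" "e \<cdot> k1 = e \<cdot> k2"
    using e KD by (auto simp: is_coequaliser_def)
  have e_reg: "regular_epi C e" using e unfolding regular_epi_def by blast
  have e_un: "\<exists>!w. w \<in> hom C (Cod C e) (Cod C h) \<and> w \<cdot> e = h"
    if "h \<in> Ar C" "Dom C h = Dom C f" "h \<cdot> k1 = h \<cdot> k2" for h
    using e that KD by (auto simp: is_coequaliser_def)
  obtain m where m: "m \<in> Ar C" "Dom C m = Cod C e" "Cod C m = Cod C f" "m \<cdot> e = f"
    using e_un[OF f refl] KD by auto
  have "monic C m"
    unfolding monic_def
  proof (intro conjI allI impI)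
    fix u v assume "parallel C u v" "Cod C u = Dom C m" and muv: "m \<cdot> u = m \<cdot> v"
    then have uv: "u \<in> Ar C" "v \<in> Ar C" "Dom C u = Dom C v" "Cod C u = Cod C e" "Cod C v = Cod C e"
      using m by (auto simp: parallel_def)
    \<comment> \<open>Both elements lift along \<open>e\<close>, first \<open>u\<close> on a cover
      \<open>a\<close>, then \<open>v\<close> on a further cover \<open>b\<close>.\<close>
    obtain a x where a: "regular_epi C a" "a \<in> Ar C" "Cod C a = Dom C u" "x \<in> Ar C" "Dom C x = Dom C a"
      "Cod C x = Dom C e" "e \<cdot> x = u \<cdot> a"
      using regular_epi_lift[OF e_reg uv(1,4)] by blast
    obtain b y where b: "regular_epi C b" "b \<in> Ar C" "Cod C b = Dom C a" "y \<in> Ar C" "Dom C y = Dom C b"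
      "Cod C y = Dom C e" "e \<cdot> y = (v \<cdot> a) \<cdot> b"
      using regular_epi_lift[OF e_reg, of "v \<cdot> a"] uv a by auto
    have "f \<cdot> (x \<cdot> b) = m \<cdot> (u \<cdot> (a \<cdot> b))" "f \<cdot> y = m \<cdot> (v \<cdot> (a \<cdot> b))"
      using comp_left_cong[OF m(4), of "x \<cdot> b"] comp_left_cong[OF m(4), of y]
        comp_left_cong[OF a(7), of b] a b m(1-3) uv eD(1,2) by simp_all
    then have fxy: "f \<cdot> (x \<cdot> b) = f \<cdot> y"
      using comp_left_cong[OF muv, of "a \<cdot> b"] a b m uv by simp
    have "e \<cdot> (x \<cdot> b) = e \<cdot> y"
    proof -
      define z where "z = pair k1 k2 (x \<cdot> b) y"
      have z: "z \<in> Ar C" "Cod C z = Dom C k1" "k1 \<cdot> z = x \<cdot> b" "k2 \<cdot> z = y"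
        using pair[OF K, of "x \<cdot> b" y] a b eD fxy unfolding z_def by auto
      then show ?thesis using comp_left_cong[OF eD(3), of z] eD KD by simp
    qed
    then have "u \<cdot> (a \<cdot> b) = v \<cdot> (a \<cdot> b)"
      using comp_left_cong[OF a(7), of b] a b uv eD by simp
    then have "u \<cdot> a = v \<cdot> a"
      using a b uv by - (rule regular_epi_cancel[OF b(1)]; auto)
    then show "u = v" using a b uv by - (rule regular_epi_cancel[OF a(1)]; auto)
  qed (use m in auto)
  then obtain d where d: "d \<in> Ar C" "Dom C d = Cod C f" "Cod C d = Dom C m" "m \<cdot> d = Id C (Cod C f)"
    using ext[of m e] m eD by auto
  have dm: "d \<cdot> m = Id C (Dom C m)"
    by (rule monicD[OF \<open>monic C m\<close>]) (simp_all add: m(1-3) d eD(1) comp_left_cong[OF d(4)])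
  have "is_coequaliser C f k1 k2"
    unfolding is_coequaliser_def
  proof (intro conjI ballI impI)
    fix h assume h: "h \<in> Ar C" "Dom C h = Cod C k1" "h \<cdot> k1 = h \<cdot> k2"
    then obtain w where w: "w \<in> Ar C" "Dom C w = Cod C e" "Cod C w = Cod C h" "w \<cdot> e = h"
      using e_un[of h] KD by auto
    have df: "d \<cdot> f = e"
      using comp_left_cong[OF dm, of e] m d eD by simp
    show "\<exists>!w. w \<in> hom C (Cod C f) (Cod C h) \<and> w \<cdot> f = h"
    proof (rule ex1I[of _ "w \<cdot> d"])
      fix w' assume w': "w' \<in> hom C (Cod C f) (Cod C h) \<and> w' \<cdot> f = h"
      then have "(w' \<cdot> m) \<cdot> e = w \<cdot> e" using m w eD by simp
      then have "w' \<cdot> m = w"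
        using w' m w by - (rule regular_epi_cancel[OF e_reg]; auto)
      then show "w' = w \<cdot> d" using w' m d by auto
    qed (use w d f df m in auto)
  qed (use KD f in \<open>auto intro: parallelI\<close>)
  then show ?thesis unfolding regular_epi_def by blast
qed

lemma regular_epi_comp:
  assumes "regular_epi C f" "regular_epi C g" "Cod C f = Dom C g"
  shows "regular_epi C (g \<cdot> f)"
proof (rule regular_epi_if_extremal)
  have fg: "f \<in> Ar C" "g \<in> Ar C" using assms by auto
  then show "g \<cdot> f \<in> Ar C" using assms by auto
  fix m h assume mh: "monic C m" "h \<in> Ar C" "Dom C h = Dom C (g \<cdot> f)" "Cod C h = Dom C m"
      "Cod C m = Cod C (g \<cdot> f)" "m \<cdot> h = g \<cdot> f"
  have m: "m \<in> Ar C" using mh by (simp add: monic_def)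
  have "Dom C h = Dom C f" "Dom C g = Cod C f" "Cod C g = Cod C m"
    using mh(3,5) fg assms(3) by simp_all
  then obtain d where d: "d \<in> Ar C" "Dom C d = Cod C f" "Cod C d = Dom C m" "m \<cdot> d = g"
    using regular_epi_strong[OF assms(1) mh(1,6,2) fg(2) _ mh(4)] by metis
  have "m \<cdot> d = Id C (Cod C g) \<cdot> g" "Id C (Cod C g) \<in> Ar C" "Dom C d = Dom C g"
    "Dom C (Id C (Cod C g)) = Cod C g" "Cod C (Id C (Cod C g)) = Cod C m"
    using d fg assms(3) mh(5) by simp_all
  then obtain d' where "d' \<in> Ar C" "Dom C d' = Cod C g" "Cod C d' = Dom C m" "m \<cdot> d' = Id C (Cod C g)"
    using regular_epi_strong[OF assms(2) mh(1) _ d(1) _ _ d(3)] by metis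
  then show "\<exists>d. d \<in> Ar C \<and> Dom C d = Cod C (g \<cdot> f) \<and> Cod C d = Dom C m \<and> m \<cdot> d = Id C (Cod C (g \<cdot> f))"
    using fg assms by auto
qed

lemma regular_epi_right_factor:
  assumes "regular_epi C (g \<cdot> f)" "f \<in> Ar C" "g \<in> Ar C" "Cod C f = Dom C g"
  shows "regular_epi C g"
proof (rule regular_epi_if_extremal)
  fix m h assume mh: "monic C m" "h \<in> Ar C" "Dom C h = Dom C g" "Cod C h = Dom C m"
      "Cod C m = Cod C g" "m \<cdot> h = g"
  have m: "m \<in> Ar C" using mh by (simp add: monic_def)
  have "m \<cdot> (h \<cdot> f) = Id C (Cod C g) \<cdot> (g \<cdot> f)" "h \<cdot> f \<in> Ar C" "Id C (Cod C g) \<in> Ar C"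
    "Dom C (h \<cdot> f) = Dom C (g \<cdot> f)" "Cod C (h \<cdot> f) = Dom C m" "Cod C (g \<cdot> f) = Cod C g"
    "Dom C (Id C (Cod C g)) = Cod C g" "Cod C (Id C (Cod C g)) = Cod C m"
    using assms(2-) mh(2-5) m comp_left_cong[OF mh(6), of f] by simp_all
  then obtain d' where "d' \<in> Ar C" "Dom C d' = Cod C g" "Cod C d' = Dom C m" "m \<cdot> d' = Id C (Cod C g)"
    using regular_epi_strong[OF assms(1) mh(1)] by metis
  then show "\<exists>d. d \<in> Ar C \<and> Dom C d = Cod C g \<and> Cod C d = Dom C m \<and> m \<cdot> d = Id C (Cod C g)"
    using assms by auto
qed (use assms in auto)

end

section \<open>Admissible reflections\<close>

lemma hom_regular_epi_slice:
  "t \<in> hom (regular_epi_slice C B) f g \<longleftrightarrow>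
     (\<exists>h. t = (f, g, h) \<and> f \<in> Ar C \<and> g \<in> Ar C \<and> Cod C f = B \<and> Cod C g = B \<and>
       regular_epi C f \<and> regular_epi C g \<and> h \<in> hom C (Dom C f) (Dom C g) \<and> Comp C g h = f)"
  by (auto simp: regular_epi_slice_def full_subcat_def slice_def hom_def)

locale admissible_reflection = regular_cat C
  for C :: "('o, 'm) cat" (structure) +
  fixes X :: "'o set"
    and I :: "('o, 'm, 'o, 'm) ftor"
    and \<eta> :: "'o \<Rightarrow> 'm"
  assumes reflector: "reflector C X I \<eta>"
    and regular_sub: "regular_category (full_subcat C X)"
    and regular_epi_sub: "regular_epi (full_subcat C X) f \<Longrightarrow> regular_epi C f"
    and admissible: "admissible C X I \<eta>"
begin

abbreviation D :: "('o, 'm) cat" where "D \<equiv> full_subcat C X"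
abbreviation \<rho> :: "'o \<Rightarrow> 'o" where "\<rho> \<equiv> FOb I"
abbreviation \<Phi> :: "'m \<Rightarrow> 'm" where "\<Phi> \<equiv> FAr I"

lemma sub_simps [simp]:
  "Dom D = Dom C" "Cod D = Cod C" "Id D = Id C" "Comp D = Comp C" "Ob D = X"
  "f \<in> Ar D \<longleftrightarrow> f \<in> Ar C \<and> Dom C f \<in> X \<and> Cod C f \<in> X"
  "f \<in> hom D A B \<longleftrightarrow> f \<in> Ar C \<and> Dom C f = A \<and> Cod C f = B \<and> A \<in> X \<and> B \<in> X"
  using reflector by (auto simp: full_subcat_def reflector_def hom_def)

lemma sub_Ob [simp]: "A \<in> X \<Longrightarrow> A \<in> Ob C"
  using reflector by (auto simp: reflector_def)

lemma reflector_simps [simp]: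
  "A \<in> Ob C \<Longrightarrow> \<rho> A \<in> X"
  "f \<in> Ar C \<Longrightarrow> \<Phi> f \<in> Ar C" "f \<in> Ar C \<Longrightarrow> Dom C (\<Phi> f) = \<rho> (Dom C f)"
  "f \<in> Ar C \<Longrightarrow> Cod C (\<Phi> f) = \<rho> (Cod C f)"
  "A \<in> Ob C \<Longrightarrow> \<Phi> (Id C A) = Id C (\<rho> A)"
  "f \<in> Ar C \<Longrightarrow> g \<in> Ar C \<Longrightarrow> Cod C f = Dom C g \<Longrightarrow> \<Phi> (g \<cdot> f) = \<Phi> g \<cdot> \<Phi> f"
proof -
  have F: "is_functor C D I" using reflector by (simp add: reflector_def)
  show "A \<in> Ob C \<Longrightarrow> \<rho> A \<in> X" using F by (simp add: is_functor_def)
  show "f \<in> Ar C \<Longrightarrow> \<Phi> f \<in> Ar C" "f \<in> Ar C \<Longrightarrow> Dom C (\<Phi> f) = \<rho> (Dom C f)"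
    "f \<in> Ar C \<Longrightarrow> Cod C (\<Phi> f) = \<rho> (Cod C f)"
    "A \<in> Ob C \<Longrightarrow> \<Phi> (Id C A) = Id C (\<rho> A)"
    "f \<in> Ar C \<Longrightarrow> g \<in> Ar C \<Longrightarrow> Cod C f = Dom C g \<Longrightarrow> \<Phi> (g \<cdot> f) = \<Phi> g \<cdot> \<Phi> f"
    using F by (simp_all add: is_functor_def)
qed

lemma unit_simps [simp]:
  "A \<in> Ob C \<Longrightarrow> \<eta> A \<in> Ar C" "A \<in> Ob C \<Longrightarrow> Dom C (\<eta> A) = A" "A \<in> Ob C \<Longrightarrow> Cod C (\<eta> A) = \<rho> A"
  using reflector by (auto simp: reflector_def)

lemma unit_natural [simp]: "f \<in> Ar C \<Longrightarrow> Dom C f = A \<Longrightarrow> \<Phi> f \<cdot> \<eta> A = \<eta> (Cod C f) \<cdot> f"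
  using reflector by (auto simp: reflector_def)

lemma unit_natural_el [simp]:
  assumes "f \<in> Ar C" "Dom C f = A" "x \<in> Ar C" "Cod C x = A"
  shows "\<Phi> f \<cdot> (\<eta> A \<cdot> x) = \<eta> (Cod C f) \<cdot> (f \<cdot> x)"
proof -
  have "A \<in> Ob C" using assms by auto
  then show ?thesis
    using assms comp_left_cong[OF unit_natural[OF assms(1,2)] assms(3)] by simp
qed

lemma unit_universal:
  assumes "A \<in> Ob C" "h \<in> Ar C" "Dom C h = A" "Cod C h \<in> X"
  shows "\<exists>!g. g \<in> hom C (\<rho> A) (Cod C h) \<and> g \<cdot> \<eta> A = h"
  using reflector assms by (auto simp: reflector_def)

lemma unit_extend:
  assumes "h \<in> Ar C" "Dom C h = A" "Cod C h \<in> X"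
  obtains g where "g \<in> Ar C" "Dom C g = \<rho> A" "Cod C g = Cod C h" "g \<cdot> \<eta> A = h"
  using unit_universal[of A h] assms that Dom_Ob in_hom by metis

lemma unit_cancel:
  assumes "g \<cdot> \<eta> A = h \<cdot> \<eta> A" "A \<in> Ob C" "g \<in> Ar C" "h \<in> Ar C" "Dom C g = \<rho> A" "Dom C h = \<rho> A"
    "Cod C g \<in> X" "Cod C h = Cod C g"
  shows "g = h"
proof -
  have "\<exists>!k. k \<in> hom C (\<rho> A) (Cod C (g \<cdot> \<eta> A)) \<and> k \<cdot> \<eta> A = g \<cdot> \<eta> A"
    using assms by (intro unit_universal) simp_all
  then show ?thesis using assms by auto
qed

lemma unit_inverse:
  assumes "A \<in> X"
  obtains z where "z \<in> Ar C" "Dom C z = \<rho> A" "Cod C z = A" "z \<cdot> \<eta> A = Id C A" "\<eta> A \<cdot> z = Id C (\<rho> A)"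
proof -
  have A: "A \<in> Ob C" "\<rho> A \<in> X" using assms by simp_all
  obtain z where z: "z \<in> Ar C" "Dom C z = \<rho> A" "Cod C z = A" "z \<cdot> \<eta> A = Id C A"
    using unit_extend[of "Id C A" A] assms by auto
  have "\<eta> A \<cdot> z = Id C (\<rho> A)"
    by (rule unit_cancel[of _ A]) (simp_all add: z A)
  then show ?thesis using z that by blast
qed

lemma plain_category_sub: "plain_category D"
  using regular_sub by unfold_locales (simp add: regular_category_def)

text \<open>The inclusion of a reflective subcategory preserves pullbacks: a cone with vertex \<open>T\<close> extends
  along the unit to one with vertex \<open>\<rho> T\<close>.\<close>

lemma pullback_from_sub:
  assumes "is_pullback D p q f g"
  shows "is_pullback C p q f g"
proof -
  interpret sub: plain_category D by (rule plain_category_sub)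
  note S = sub.pullbackD[OF assms]
  show ?thesis
  proof (rule pullbackI)
    fix u v
    assume uv: "u \<in> Ar C" "v \<in> Ar C" "Dom C v = Dom C u" "Cod C u = Dom C f"
      "Cod C v = Dom C g" "f \<cdot> u = g \<cdot> v"
    define T where "T = Dom C u"
    have T: "T \<in> Ob C" "Dom C u = T" "Dom C v = T" using uv by (auto simp: T_def)
    obtain u' where u': "u' \<in> Ar C" "Dom C u' = \<rho> T" "Cod C u' = Cod C u" "u' \<cdot> \<eta> T = u"
      using unit_extend[of u T] uv T S by auto
    obtain v' where v': "v' \<in> Ar C" "Dom C v' = \<rho> T" "Cod C v' = Cod C v" "v' \<cdot> \<eta> T = v"
      using unit_extend[of v T] uv T S by auto
    have "f \<cdot> u' = g \<cdot> v'"
      by (rule unit_cancel[of _ T]) (use uv u' v' T S in simp_all)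
    then have "\<exists>!w. w \<in> hom D (Dom D u') (Dom D p) \<and> Comp D p w = u' \<and> Comp D q w = v'"
      using u' v' uv S T by (intro sub.pullback_unique[OF assms]) simp_all
    then obtain w where "w \<in> Ar C" "Dom C w = \<rho> T" "Cod C w = Dom C p" "p \<cdot> w = u'" "q \<cdot> w = v'"
      using u' by auto
    then show "\<exists>w. w \<in> Ar C \<and> Dom C w = Dom C u \<and> Cod C w = Dom C p \<and> p \<cdot> w = u \<and> q \<cdot> w = v"
      using u' v' T S comp_left_cong[of p w u' "\<eta> T"] comp_left_cong[of q w v' "\<eta> T"]
      by (intro exI[of _ "w \<cdot> \<eta> T"]) simp
  next
    fix u v
    assume uv: "u \<in> Ar C" "v \<in> Ar C" "Dom C v = Dom C u" "Cod C u = Dom C p"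
      "Cod C v = Dom C p" "p \<cdot> u = p \<cdot> v" "q \<cdot> u = q \<cdot> v"
    define T where "T = Dom C u"
    have T: "T \<in> Ob C" "Dom C u = T" "Dom C v = T" using uv by (auto simp: T_def)
    obtain u' where u': "u' \<in> Ar C" "Dom C u' = \<rho> T" "Cod C u' = Dom C p" "u' \<cdot> \<eta> T = u"
      using unit_extend[of u T] uv T S by auto
    obtain v' where v': "v' \<in> Ar C" "Dom C v' = \<rho> T" "Cod C v' = Dom C p" "v' \<cdot> \<eta> T = v"
      using unit_extend[of v T] uv T S by auto
    have "p \<cdot> u' = p \<cdot> v'"
      by (rule unit_cancel[of _ T]) (use uv u' v' T S in simp_all)
    moreover have "q \<cdot> u' = q \<cdot> v'"
      by (rule unit_cancel[of _ T]) (use uv u' v' T S in simp_all)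
    ultimately have "u' = v'"
      using u' v' S T by - (rule sub.pullback_eqI[OF assms]; simp)
    then show "u = v" using u' v' by simp
  qed (use S in simp_all)
qed

lemma sub_pullback:
  assumes "f \<in> Ar C" "g \<in> Ar C" "Cod C f = Cod C g" "Dom C f \<in> X" "Dom C g \<in> X" "Cod C g \<in> X"
  obtains p q where "is_pullback C p q f g" "Dom C p \<in> X"
proof -
  interpret sub: plain_category D by (rule plain_category_sub)
  obtain p q where *: "is_pullback D p q f g"
    using sub.pullback_exists[of f g] assms regular_sub
    by (auto simp: regular_category_def)
  have "Dom C p \<in> X" using sub.pullbackD(3)[OF *] by simp
  then show ?thesis by (rule that[OF pullback_from_sub[OF *]])
qed

text \<open>Coequalisers in the subcategory are reflections of coequalisers in the large category.\<close>

lemma sub_coequaliser: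
  assumes "has_coequalisers_of_reflexive_graphs C" "reflexive_graph C a b s"
    "Dom C a \<in> X" "Cod C a \<in> X"
  obtains w where "is_coequaliser D w a b"
proof -
  obtain q where q: "is_coequaliser C q a b"
    using assms unfolding has_coequalisers_of_reflexive_graphs_def by blast
  have ab: "a \<in> Ar C" "b \<in> Ar C" "Dom C b = Dom C a" "Cod C b = Cod C a"
    using assms(2) by (auto simp: reflexive_graph_def parallel_def)
  have qD: "q \<in> Ar C" "Dom C q = Cod C a" "q \<cdot> a = q \<cdot> b"
    using q by (simp_all add: is_coequaliser_def)
  have q_un: "\<exists>!w. w \<in> hom C (Cod C q) (Cod C h) \<and> w \<cdot> q = h"
    if "h \<in> Ar C" "Dom C h = Cod C a" "h \<cdot> a = h \<cdot> b" for h
    using q that by (simp add: is_coequaliser_def)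
  have "regular_epi C q" using q by (auto simp: regular_epi_def)
  define Q where "Q = Cod C q"
  have Q: "Q \<in> Ob C" "Cod C q = Q" using qD by (auto simp: Q_def)
  have "is_coequaliser D (\<eta> Q \<cdot> q) a b"
    unfolding is_coequaliser_def
  proof (intro conjI ballI impI)
    fix h assume "h \<in> Ar D" "Dom D h = Cod D a" "Comp D h a = Comp D h b"
    then have h: "h \<in> Ar C" "Dom C h = Cod C a" "h \<cdot> a = h \<cdot> b" "Cod C h \<in> X" by simp_all
    obtain k where k: "k \<in> Ar C" "Dom C k = Q" "Cod C k = Cod C h" "k \<cdot> q = h"
      using q_un[OF h(1-3)] Q by auto
    obtain l where l: "l \<in> Ar C" "Dom C l = \<rho> Q" "Cod C l = Cod C h" "l \<cdot> \<eta> Q = k"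
      using unit_extend[of k Q] k h Q by auto
    show "\<exists>!w. w \<in> hom D (Cod D (\<eta> Q \<cdot>\<^bsub>C\<^esub> q)) (Cod D h) \<and> Comp D w (\<eta> Q \<cdot> q) = h"
    proof (rule ex1I[of _ l])
      show "l \<in> hom D (Cod D (\<eta> Q \<cdot>\<^bsub>C\<^esub> q)) (Cod D h) \<and> Comp D l (\<eta> Q \<cdot> q) = h"
        using l k h Q qD comp_left_cong[OF l(4), of q] by simp
      fix w assume "w \<in> hom D (Cod D (\<eta> Q \<cdot>\<^bsub>C\<^esub> q)) (Cod D h) \<and> Comp D w (\<eta> Q \<cdot> q) = h"
      then have w: "w \<in> Ar C" "Dom C w = \<rho> Q" "Cod C w = Cod C h" "w \<cdot> (\<eta> Q \<cdot> q) = h"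
        using Q qD by auto
      have "(w \<cdot> \<eta> Q) \<cdot> q = k \<cdot> q" using w Q qD k by simp
      then have "w \<cdot> \<eta> Q = k"
        by (rule regular_epi_cancel[OF \<open>regular_epi C q\<close>]) (simp_all add: w Q k)
      then show "w = l"
        by - (rule unit_cancel[of _ Q]; simp add: w l Q h)
    qed
  qed (use ab Q qD assms in \<open>auto simp: parallel_def\<close>)
  then show ?thesis by (rule that)
qed

text \<open>A left adjoint preserves the coequaliser that exhibits \<open>f\<close> as a regular epimorphism.\<close>

lemma reflect_regular_epi:
  assumes "regular_epi C f"
  shows "regular_epi D (\<Phi> f)"
proof -
  obtain u v where uv: "is_coequaliser C f u v"
    using assms by (auto simp: regular_epi_def)
  then have A: "u \<in> Ar C" "v \<in> Ar C" "Dom C v = Dom C u" "Cod C u = Dom C f" "Cod C v = Dom C f"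
    "f \<in> Ar C" "f \<cdot> u = f \<cdot> v"
    by (auto simp: is_coequaliser_def parallel_def)
  have un: "\<exists>!w. w \<in> hom C (Cod C f) (Cod C h) \<and> w \<cdot> f = h"
    if "h \<in> Ar C" "Dom C h = Dom C f" "h \<cdot> u = h \<cdot> v" for h
    using uv that A by (simp add: is_coequaliser_def)
  define S A' B where "S = Dom C u" "A' = Dom C f" "B = Cod C f"
  have ob: "S \<in> Ob C" "A' \<in> Ob C" "B \<in> Ob C" "Dom C u = S" "Dom C v = S" "Dom C f = A'"
    "Cod C u = A'" "Cod C v = A'" "Cod C f = B"
    using A by (auto simp: S_A'_B_def)
  have "is_coequaliser D (\<Phi> f) (\<Phi> u) (\<Phi> v)"
    unfolding is_coequaliser_def
  proof (intro conjI ballI impI)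
    show "Comp D (\<Phi> f) (\<Phi> u) = Comp D (\<Phi> f) (\<Phi> v)"
      using A ob reflector_simps(6)[of u f] reflector_simps(6)[of v f] by simp
    fix h assume "h \<in> Ar D" "Dom D h = Cod D (\<Phi> u)" "Comp D h (\<Phi> u) = Comp D h (\<Phi> v)"
    then have h: "h \<in> Ar C" "Dom C h = \<rho> A'" "Cod C h \<in> X" "h \<cdot> \<Phi> u = h \<cdot> \<Phi> v"
      using A ob by simp_all
    have "(h \<cdot> \<eta> A') \<cdot> u = (h \<cdot> \<eta> A') \<cdot> v"
      using comp_left_cong[OF h(4), of "\<eta> S"] A ob h by simp
    then obtain k where k: "k \<in> Ar C" "Dom C k = B" "Cod C k = Cod C h" "k \<cdot> f = h \<cdot> \<eta> A'"
      using un[of "h \<cdot> \<eta> A'"] h ob by auto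
    obtain l where l: "l \<in> Ar C" "Dom C l = \<rho> B" "Cod C l = Cod C h" "l \<cdot> \<eta> B = k"
      using unit_extend[of k B] k h ob by auto
    show "\<exists>!w. w \<in> hom D (Cod D (\<Phi> f)) (Cod D h) \<and> Comp D w (\<Phi> f) = h"
    proof (rule ex1I[of _ l])
      have "l \<cdot> \<Phi> f = h"
        by (rule unit_cancel[of _ A'])
          (use l k h A ob comp_left_cong[OF l(4), of f] in simp_all)
      then show "l \<in> hom D (Cod D (\<Phi> f)) (Cod D h) \<and> Comp D l (\<Phi> f) = h"
        using l h A ob by simp
      fix w assume "w \<in> hom D (Cod D (\<Phi> f)) (Cod D h) \<and> Comp D w (\<Phi> f) = h"
      then have w: "w \<in> Ar C" "Dom C w = \<rho> B" "Cod C w = Cod C h" "w \<cdot> \<Phi> f = h"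
        using A ob by auto
      have "(w \<cdot> \<eta> B) \<cdot> f = k \<cdot> f"
        using comp_left_cong[OF w(4), of "\<eta> A'"] w k A ob by simp
      then have "w \<cdot> \<eta> B = k"
        by (rule regular_epi_cancel[OF assms]) (simp_all add: w ob k)
      then show "w = l"
        by - (rule unit_cancel[of _ B]; simp add: w l ob h)
    qed
  qed (use A ob in \<open>auto simp: parallel_def\<close>)
  then show ?thesis by (auto simp: regular_epi_def)
qed

definition universal :: "'m \<Rightarrow> bool" where
  "universal k \<longleftrightarrow> k \<in> Ar C \<and> Cod C k \<in> X \<and>
     (\<forall>h\<in>Ar C. Dom C h = Dom C k \<longrightarrow> Cod C h \<in> X \<longrightarrow>
        (\<exists>!g. g \<in> hom C (Cod C k) (Cod C h) \<and> g \<cdot> k = h))"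

lemma universal_extend:
  assumes "universal k" "h \<in> Ar C" "Dom C h = Dom C k" "Cod C h \<in> X"
  obtains g where "g \<in> Ar C" "Dom C g = Cod C k" "Cod C g = Cod C h" "g \<cdot> k = h"
  using assms that unfolding universal_def in_hom by metis

lemma universal_cancel:
  assumes "universal k" "g \<cdot> k = h \<cdot> k" "g \<in> Ar C" "h \<in> Ar C" "Dom C g = Cod C k" "Dom C h = Cod C k"
    "Cod C g \<in> X" "Cod C h = Cod C g"
  shows "g = h"
proof -
  have k: "k \<in> Ar C" using assms(1) by (simp add: universal_def)
  have "g \<cdot> k \<in> Ar C" "Dom C (g \<cdot> k) = Dom C k" "Cod C (g \<cdot> k) = Cod C g"
    using assms(3,5) k by simp_all
  then have "\<exists>!l. l \<in> hom C (Cod C k) (Cod C g) \<and> l \<cdot> k = g \<cdot> k"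
    using assms(1,7) unfolding universal_def by metis
  then show ?thesis using assms(2-) unfolding in_hom by metis
qed

lemma chosen_pullback:
  assumes "f \<in> Ar C" "g \<in> Ar C" "Cod C f = Cod C g"
  shows "is_pullback C (fst (chosen_pullback C f g)) (snd (chosen_pullback C f g)) f g"
proof -
  obtain p q where "is_pullback C p q f g" using pullback[OF assms] by blast
  then have "\<exists>pq. case pq of (p, q) \<Rightarrow> is_pullback C p q f g" by auto
  then have "case chosen_pullback C f g of (p, q) \<Rightarrow> is_pullback C p q f g"
    unfolding chosen_pullback_def by (rule someI_ex)
  then show ?thesis by (simp add: case_prod_beta)
qed

text \<open>Fullness lifts the comparison of \<open>p\<close> with the pullback of \<open>\<Phi> p\<close>, an arrow over \<open>B\<close>, to an arrow \<open>\<sigma>\<close>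
  from \<open>\<phi>\<close> to \<open>\<Phi> p\<close> over \<open>\<rho> B\<close>. Faithfulness shows \<open>\<kappa> \<cdot> \<sigma> = 1\<close>, where \<open>\<kappa>\<close> is induced by the projection
  \<open>k\<close>: both are sent to the identity of \<open>p\<close>.\<close>

lemma chosen_pullback_universal:
  assumes B: "B \<in> Ob C" and phi: "regular_epi D \<phi>" "Cod C \<phi> = \<rho> B"
    and pk: "chosen_pullback C (\<eta> B) \<phi> = (p, k)"
  obtains \<sigma> \<kappa> where "\<sigma> \<in> Ar C" "Dom C \<sigma> = Dom C \<phi>" "Cod C \<sigma> = \<rho> (Dom C p)" "\<sigma> \<cdot> k = \<eta> (Dom C p)"
    "\<kappa> \<in> Ar C" "Dom C \<kappa> = \<rho> (Dom C p)" "Cod C \<kappa> = Dom C \<phi>" "\<kappa> \<cdot> \<eta> (Dom C p) = k"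
    "\<kappa> \<cdot> \<sigma> = Id C (Dom C \<phi>)"
proof -
  interpret sub: plain_category D by (rule plain_category_sub)
  have phiA: "\<phi> \<in> Ar C" "Dom C \<phi> \<in> X" "regular_epi C \<phi>"
    using sub.regular_epi_Ar[OF phi(1)] regular_epi_sub[OF phi(1)] by auto
  have PB: "is_pullback C p k (\<eta> B) \<phi>"
    using chosen_pullback[of "\<eta> B" \<phi>] pk B phiA phi by simp
  note PD = pullbackD[OF PB]
  define P where "P = Dom C p"
  have P: "P \<in> Ob C" "Dom C p = P" "Dom C k = P" "Cod C p = B" "Cod C k = Dom C \<phi>"
    using PD B by (auto simp: P_def)
  have p_reg: "regular_epi C p" by (rule regular_epi_pullback[OF PB phiA(3)])
  define \<psi> where "\<psi> = \<Phi> p"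
  have psi: "regular_epi D \<psi>" "\<psi> \<in> Ar C" "Dom C \<psi> = \<rho> P" "Cod C \<psi> = \<rho> B" "regular_epi C \<psi>"
    using reflect_regular_epi[OF p_reg] PD P regular_epi_sub by (auto simp: \<psi>_def)
  obtain p' k' where pk': "chosen_pullback C (\<eta> B) \<psi> = (p', k')" by fastforce
  have PB': "is_pullback C p' k' (\<eta> B) \<psi>"
    using chosen_pullback[of "\<eta> B" \<psi>] pk' B psi by simp
  note PD' = pullbackD[OF PB']
  have p'_reg: "regular_epi C p'" by (rule regular_epi_pullback[OF PB' psi(5)])
  have eq: "\<eta> B \<cdot> p = \<psi> \<cdot> \<eta> P" using P PD by (simp add: \<psi>_def)
  define j where "j = pair p' k' p (\<eta> P)"
  have j: "j \<in> Ar C" "Dom C j = P" "Cod C j = Dom C p'" "p' \<cdot> j = p" "k' \<cdot> j = \<eta> P"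
    using pair[OF PB', of p "\<eta> P"] P PD psi B eq by (simp_all add: j_def)
  let ?K = "regular_epi_slice D (\<rho> B)" and ?L = "regular_epi_slice C B"
    and ?F = "pullback_functor C (\<eta> B)"
  have ful: "full ?K ?L ?F" and fai: "faithful ?K ?F"
    using admissible B by (auto simp: admissible_def)
  have obs: "\<phi> \<in> Ob ?K" "\<psi> \<in> Ob ?K"
    using phi phiA psi B P by (auto simp: regular_epi_slice_def full_subcat_def slice_def)
  have F_obs: "FOb ?F \<phi> = p" "FOb ?F \<psi> = p'"
    using pk pk' by (simp_all add: pullback_functor_def)
  have "(p, p', j) \<in> hom ?L p p'"
    using P PD PD' j p_reg p'_reg B
    unfolding hom_regular_epi_slice by simp
  then have "(p, p', j) \<in> FAr ?F ` hom ?K \<phi> \<psi>"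
    using ful obs F_obs by (auto simp: full_def)
  then obtain t where t: "t \<in> hom ?K \<phi> \<psi>" "(p, p', j) = FAr ?F t" by auto
  obtain \<sigma> where \<sigma>: "t = (\<phi>, \<psi>, \<sigma>)" "\<sigma> \<in> Ar C" "Dom C \<sigma> = Dom C \<phi>" "Cod C \<sigma> = \<rho> P" "\<psi> \<cdot> \<sigma> = \<phi>"
    using t(1) psi(3) unfolding hom_regular_epi_slice sub_simps by metis
  have eq2: "\<eta> B \<cdot> p = \<psi> \<cdot> (\<sigma> \<cdot> k)"
    using PD \<sigma> psi P comp_left_cong[OF \<sigma>(5), of k] by simp
  have "j = (THE w. w \<in> hom C P (Dom C p') \<and> p' \<cdot> w = p \<and> k' \<cdot> w = \<sigma> \<cdot> k)"
    using t(2) pk pk' P by (simp add: \<sigma>(1) pullback_functor_def)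
  then have "j = pair p' k' p (\<sigma> \<cdot> k)" using P by (simp add: pair_def)
  then have "k' \<cdot> j = \<sigma> \<cdot> k"
    using pair(5)[OF PB' _ _ _ _ _ eq2] P PD \<sigma> psi B by simp
  then have \<sigma>k: "\<sigma> \<cdot> k = \<eta> P" using j by simp
  obtain \<kappa> where \<kappa>: "\<kappa> \<in> Ar C" "Dom C \<kappa> = \<rho> P" "Cod C \<kappa> = Dom C \<phi>" "\<kappa> \<cdot> \<eta> P = k"
    using unit_extend[of k P] P PD phiA by auto
  \<comment> \<open>For faithfulness to apply, \<open>\<kappa> \<cdot> \<sigma>\<close> has to be an arrow
    over \<open>\<rho> B\<close>.\<close>
  have "\<phi> \<cdot> \<kappa> = \<psi>"
    by (rule unit_cancel[of _ P]) (use P PD \<kappa> phi phiA psi eq B in simp_all)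
  then have over: "\<phi> \<cdot> (\<kappa> \<cdot> \<sigma>) = \<phi>"
    using comp_left_cong[of \<phi> \<kappa> \<psi> \<sigma>] \<kappa> \<sigma> phiA by simp
  have fix_k: "(\<kappa> \<cdot> \<sigma>) \<cdot> k = Id C (Dom C \<phi>) \<cdot> k"
    using \<sigma>k \<kappa> \<sigma> PD P phiA by simp
  have "(\<phi>, \<phi>, \<kappa> \<cdot> \<sigma>) \<in> hom ?K \<phi> \<phi>" "(\<phi>, \<phi>, Id C (Dom C \<phi>)) \<in> hom ?K \<phi> \<phi>"
    using \<kappa> \<sigma> phi phiA over B unfolding hom_regular_epi_slice by simp_all
  moreover have "FAr ?F (\<phi>, \<phi>, \<kappa> \<cdot> \<sigma>) = FAr ?F (\<phi>, \<phi>, Id C (Dom C \<phi>))"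
    using pk fix_k by (simp add: pullback_functor_def)
  ultimately have "\<kappa> \<cdot> \<sigma> = Id C (Dom C \<phi>)"
    using fai obs by (auto simp: faithful_def dest: inj_onD)
  then show ?thesis using that[of \<sigma> \<kappa>] \<sigma> \<kappa> \<sigma>k P by simp
qed

text \<open>The form in which admissibility is used: pulling back a regular epimorphism of the subcategory
  along a unit gives an object whose reflection is the pulled back object. The arrows \<open>j\<close> and \<open>j'\<close>
  transport the result from the chosen pullback to an arbitrary one.\<close>

lemma pullback_universal:
  assumes B: "B \<in> Ob C" and phi: "regular_epi D \<phi>"
    and PB: "is_pullback C p k (\<eta> B) \<phi>"
  shows "universal k"
proof -
  interpret sub: plain_category D by (rule plain_category_sub)
  note PD = pullbackD[OF PB]
  have phi2: "\<phi> \<in> Ar C" "Dom C \<phi> \<in> X" "Cod C \<phi> = \<rho> B"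
    using sub.regular_epi_Ar[OF phi(1)] PD B by auto
  obtain p0 k0 where pk0: "chosen_pullback C (\<eta> B) \<phi> = (p0, k0)" by fastforce
  have PB0: "is_pullback C p0 k0 (\<eta> B) \<phi>"
    using chosen_pullback[of "\<eta> B" \<phi>] pk0 B phi2 by simp
  note PD0 = pullbackD[OF PB0]
  obtain \<sigma> \<kappa> where \<sigma>: "\<sigma> \<in> Ar C" "Dom C \<sigma> = Dom C \<phi>" "Cod C \<sigma> = \<rho> (Dom C p0)" "\<sigma> \<cdot> k0 = \<eta> (Dom C p0)"
    and \<kappa>: "\<kappa> \<in> Ar C" "Dom C \<kappa> = \<rho> (Dom C p0)" "Cod C \<kappa> = Dom C \<phi>" "\<kappa> \<cdot> \<eta> (Dom C p0) = k0"
    "\<kappa> \<cdot> \<sigma> = Id C (Dom C \<phi>)"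
    using chosen_pullback_universal[OF B phi phi2(3) pk0] by blast
  define P0 where "P0 = Dom C p0"
  have P0: "P0 \<in> Ob C" "Dom C p0 = P0" "Dom C k0 = P0" using PD0 by (auto simp: P0_def)
  define P where "P = Dom C p"
  have P: "P \<in> Ob C" "Dom C p = P" "Dom C k = P" using PD by (auto simp: P_def)
  define j where "j = pair p0 k0 p k"
  have j: "j \<in> Ar C" "Dom C j = P" "Cod C j = P0" "p0 \<cdot> j = p" "k0 \<cdot> j = k"
    using pair[OF PB0, of p k] P P0 PD PD0 by (simp_all add: j_def)
  define j' where "j' = pair p k p0 k0"
  have j': "j' \<in> Ar C" "Dom C j' = P0" "Cod C j' = P" "p \<cdot> j' = p0" "k \<cdot> j' = k0"
    using pair[OF PB, of p0 k0] P P0 PD PD0 by (simp_all add: j'_def)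
  have j'j: "j' \<cdot> j = Id C P"
    by (rule pullback_eqI[OF PB])
      (simp_all add: PD P j j' comp_left_cong[OF j'(4)] comp_left_cong[OF j'(5)])
  have \<Phi>j: "\<Phi> j \<cdot> \<Phi> j' = Id C (\<rho> P0)"
  proof -
    have "j \<cdot> j' = Id C P0"
      by (rule pullback_eqI[OF PB0])
        (simp_all add: PD0 P0 j j' comp_left_cong[OF j(4)] comp_left_cong[OF j(5)])
    then show ?thesis using reflector_simps(6)[of j' j] j j' P0 by simp
  qed
  show ?thesis
    unfolding universal_def
  proof (intro conjI ballI impI)
    fix h assume h: "h \<in> Ar C" "Dom C h = Dom C k" "Cod C h \<in> X"
    obtain g where g: "g \<in> Ar C" "Dom C g = \<rho> P" "Cod C g = Cod C h" "g \<cdot> \<eta> P = h"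
      using unit_extend[of h P] h P by auto
    have sk: "\<sigma> \<cdot> k = \<eta> P0 \<cdot> j"
      using \<sigma> j P0 PD0 comp_left_cong[OF \<sigma>(4), of j] by simp
    have ex: "(g \<cdot> (\<Phi> j' \<cdot> \<sigma>)) \<cdot> k = h"
      using g \<sigma> j j' P P0 PD phi2 sk j'j by simp
    show "\<exists>!g. g \<in> hom C (Cod C k) (Cod C h) \<and> g \<cdot> k = h"
    proof (rule ex1I[of _ "g \<cdot> (\<Phi> j' \<cdot> \<sigma>)"])
      show "g \<cdot> (\<Phi> j' \<cdot> \<sigma>) \<in> hom C (Cod C k) (Cod C h) \<and> (g \<cdot> (\<Phi> j' \<cdot> \<sigma>)) \<cdot> k = h"
        using ex g \<sigma> j' P P0 PD by simp
      fix g' assume "g' \<in> hom C (Cod C k) (Cod C h) \<and> g' \<cdot> k = h"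
      then have g': "g' \<in> Ar C" "Dom C g' = Dom C \<phi>" "Cod C g' = Cod C h" "g' \<cdot> k = h" using PD by auto
      have "g' \<cdot> (\<kappa> \<cdot> \<Phi> j) = g"
        by (rule unit_cancel[of _ P])
          (use P P0 PD PD0 g g' \<kappa> j h comp_left_cong[OF \<kappa>(4), of j] in simp_all)
      then have "g \<cdot> (\<Phi> j' \<cdot> \<sigma>) = g' \<cdot> (\<kappa> \<cdot> (\<Phi> j \<cdot> (\<Phi> j' \<cdot> \<sigma>)))"
        using P P0 g' \<kappa> j j' \<sigma> by auto
      also have "\<Phi> j \<cdot> (\<Phi> j' \<cdot> \<sigma>) = \<sigma>"
        using comp_left_cong[OF \<Phi>j, of \<sigma>] P0 \<sigma> j j' by simp
      finally show "g' = g \<cdot> (\<Phi> j' \<cdot> \<sigma>)" using \<kappa>(5) g' phi2 by simp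
    qed
  qed (use PD phi2 in simp_all)
qed

text \<open>By universality of \<open>k\<close> the given pullback square is isomorphic to the naturality square of the
  unit at \<open>p\<close>.\<close>

lemma trivial_if_pullback:
  assumes B: "B \<in> Ob C" and phi: "regular_epi D \<phi>"
    and PB: "is_pullback C p k (\<eta> B) \<phi>"
  shows "trivial_extension C I \<eta> p"
proof -
  have un: "universal k" by (rule pullback_universal[OF assms])
  note PD = pullbackD[OF PB]
  define P where "P = Dom C p"
  have P: "P \<in> Ob C" "Dom C p = P" "Dom C k = P" "Cod C p = B" using PD B by (auto simp: P_def)
  have k: "Cod C k \<in> X" using un by (simp add: universal_def)
  obtain \<sigma> where \<sigma>: "\<sigma> \<in> Ar C" "Dom C \<sigma> = Cod C k" "Cod C \<sigma> = \<rho> P" "\<sigma> \<cdot> k = \<eta> P"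
    using universal_extend[OF un, of "\<eta> P"] P by auto
  obtain \<kappa> where \<kappa>: "\<kappa> \<in> Ar C" "Dom C \<kappa> = \<rho> P" "Cod C \<kappa> = Cod C k" "\<kappa> \<cdot> \<eta> P = k"
    using unit_extend[of k P] P PD k by auto
  have \<sigma>\<kappa>: "\<sigma> \<cdot> \<kappa> = Id C (\<rho> P)"
    by (rule unit_cancel[of _ P]) (use P \<sigma> \<kappa> in simp_all)
  have \<phi>\<kappa>: "\<phi> \<cdot> \<kappa> = \<Phi> p"
    by (rule unit_cancel[of _ P]) (use P PD(1-4,6-) PD(5)[symmetric] \<kappa> B in simp_all)
  have "is_pullback C p (\<eta> P) (\<eta> B) (\<Phi> p)"
  proof (rule pullbackI)
    fix u v
    assume uv: "u \<in> Ar C" "v \<in> Ar C" "Dom C v = Dom C u" "Cod C u = Dom C (\<eta> B)"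
      "Cod C v = Dom C (\<Phi> p)" "\<eta> B \<cdot> u = \<Phi> p \<cdot> v"
    then have uv': "Cod C u = B" "Cod C v = \<rho> P" using P PD by simp_all
    have eq: "\<eta> B \<cdot> u = \<phi> \<cdot> (\<kappa> \<cdot> v)"
      using uv uv' comp_left_cong[OF \<phi>\<kappa>, of v] \<kappa> PD by simp
    define w where "w = pair p k u (\<kappa> \<cdot> v)"
    have w: "w \<in> Ar C" "Dom C w = Dom C u" "Cod C w = P" "p \<cdot> w = u" "k \<cdot> w = \<kappa> \<cdot> v"
      using pair[OF PB, of u "\<kappa> \<cdot> v"] uv uv' eq P PD \<kappa> by (simp_all add: w_def)
    have "\<eta> P \<cdot> w = v"
      using comp_left_cong[OF \<sigma>(4), of w] comp_left_cong[OF \<sigma>\<kappa>, of v] \<sigma> \<kappa> P PD w uv uv' by simp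
    then show "\<exists>w. w \<in> Ar C \<and> Dom C w = Dom C u \<and> Cod C w = Dom C p \<and> p \<cdot> w = u \<and> \<eta> P \<cdot> w = v"
      using w P by auto
  next
    fix u v
    assume uv: "u \<in> Ar C" "v \<in> Ar C" "Dom C v = Dom C u" "Cod C u = Dom C p"
      "Cod C v = Dom C p" "p \<cdot> u = p \<cdot> v" "\<eta> P \<cdot> u = \<eta> P \<cdot> v"
    have "k \<cdot> u = k \<cdot> v"
      using comp_left_cong[OF \<kappa>(4), of u] comp_left_cong[OF \<kappa>(4), of v] uv \<kappa> P by simp
    then show "u = v" by - (rule pullback_eqI[OF PB]; simp add: uv)
  qed (use P PD B in simp_all)
  moreover have "regular_epi C p"
    by (rule regular_epi_pullback[OF PB regular_epi_sub[OF phi]])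
  ultimately show ?thesis using P by (simp add: trivial_extension_def)
qed

text \<open>At objects of the subcategory the units are invertible, so the naturality square is a pullback.\<close>

lemma sub_point_trivial:
  assumes "f \<in> Ar C" "s \<in> Ar C" "Dom C s = Cod C f" "Cod C s = Dom C f" "f \<cdot> s = Id C (Cod C f)"
    "Dom C f \<in> X" "Cod C f \<in> X"
  shows "(f, s) \<in> trivial_points C I \<eta>"
proof -
  define A B where "A = Dom C f" "B = Cod C f"
  have ob: "A \<in> X" "B \<in> X" "Dom C f = A" "Cod C f = B" using assms by (simp_all add: A_B_def)
  obtain z where z: "z \<in> Ar C" "Dom C z = \<rho> A" "Cod C z = A" "z \<cdot> \<eta> A = Id C A" "\<eta> A \<cdot> z = Id C (\<rho> A)"
    using unit_inverse[OF ob(1)] by blast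
  obtain y where y: "y \<in> Ar C" "Dom C y = \<rho> B" "Cod C y = B" "y \<cdot> \<eta> B = Id C B" "\<eta> B \<cdot> y = Id C (\<rho> B)"
    using unit_inverse[OF ob(2)] by blast
  have fz: "f \<cdot> z = y \<cdot> \<Phi> f"
    by (rule unit_cancel[of _ A]) (use assms ob z y comp_left_cong[OF y(4), of f] in simp_all)
  have "is_pullback C f (\<eta> A) (\<eta> B) (\<Phi> f)"
  proof (rule pullbackI)
    fix u v
    assume "u \<in> Ar C" "v \<in> Ar C" "Dom C v = Dom C u" "Cod C u = Dom C (\<eta> B)"
      "Cod C v = Dom C (\<Phi> f)" and eq: "\<eta> B \<cdot> u = \<Phi> f \<cdot> v"
    then have uv: "u \<in> Ar C" "v \<in> Ar C" "Dom C v = Dom C u" "Cod C u = B" "Cod C v = \<rho> A"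
      using ob assms by simp_all
    have "f \<cdot> (z \<cdot> v) = u"
      using comp_left_cong[OF fz, of v] comp_left_cong[OF y(4), of u] eq uv y z ob assms by simp
    moreover have "\<eta> A \<cdot> (z \<cdot> v) = v"
      using comp_left_cong[OF z(5), of v] uv z ob by simp
    ultimately show "\<exists>w. w \<in> Ar C \<and> Dom C w = Dom C u \<and> Cod C w = Dom C f \<and> f \<cdot> w = u \<and> \<eta> A \<cdot> w = v"
      using uv z ob by (intro exI[of _ "z \<cdot> v"]) simp
  next
    fix u v
    assume uv: "u \<in> Ar C" "v \<in> Ar C" "Dom C v = Dom C u" "Cod C u = Dom C f"
      "Cod C v = Dom C f" "\<eta> A \<cdot> u = \<eta> A \<cdot> v"
    have "z \<cdot> (\<eta> A \<cdot> u) = u" "z \<cdot> (\<eta> A \<cdot> v) = v"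
      using comp_left_cong[OF z(4), of u] comp_left_cong[OF z(4), of v] z(1-3) ob uv(1-5) by simp_all
    then show "u = v" using uv(6) by metis
  qed (use ob assms in simp_all)
  moreover have "regular_epi C f" by (rule split_epi_regular[OF assms(1-5)])
  ultimately show ?thesis
    using assms ob by (simp add: trivial_points_def trivial_extension_def is_point_def)
qed

end

section \<open>Products of points\<close>

lemma (in plain_category) jointly_strongly_epic_diagonal:
  assumes "jointly_strongly_epic C a b" "monic C m" "h \<in> hom C (Cod C a) (Cod C m)"
    "u \<in> hom C (Dom C a) (Dom C m)" "v \<in> hom C (Dom C b) (Dom C m)" "m \<cdot> u = h \<cdot> a" "m \<cdot> v = h \<cdot> b"
  shows "\<exists>d. d \<in> hom C (Cod C a) (Dom C m) \<and> m \<cdot> d = h"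
  using assms unfolding jointly_strongly_epic_def by blast

locale protomodular_reflection = admissible_reflection C X I \<eta>
  for C :: "('o, 'm) cat" (structure) and X I \<eta> +
  assumes reflexive_coequalisers: "has_coequalisers_of_reflexive_graphs C"
    and protomodular: "protomodular_wrt C (trivial_points C I \<eta>)"
begin

text \<open>This is the Mal'tsev property of the subcategory. The second projection of a product of two
  points is again a point, with the second injection as its section, and its pullback along the
  section \<open>t\<close> is the first injection.\<close>

lemma product_injections_jointly_epic:
  assumes PB: "is_pullback C p q e f" and X: "Dom C p \<in> X" "Dom C f \<in> X"
    and s: "s \<in> Ar C" "Dom C s = Cod C e" "Cod C s = Dom C e" "e \<cdot> s = Id C (Cod C e)"
    and t: "t \<in> Ar C" "Dom C t = Cod C f" "Cod C t = Dom C f" "f \<cdot> t = Id C (Cod C f)"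
  shows "jointly_strongly_epic C (pair p q (Id C (Dom C e)) (t \<cdot> e)) (pair p q (s \<cdot> f) (Id C (Dom C f)))"
proof -
  note PD = pullbackD[OF PB]
  define E F B P where "E = Dom C e" "F = Dom C f" "B = Cod C e" "P = Dom C p"
  have ob: "Dom C e = E" "Cod C e = B" "Dom C f = F" "Cod C f = B" "Dom C p = P" "Dom C q = P"
    "Cod C p = E" "Cod C q = F" "Dom C s = B" "Cod C s = E" "Dom C t = B" "Cod C t = F"
    "E \<in> Ob C" "F \<in> Ob C" "B \<in> Ob C" "P \<in> Ob C"
    using PD s t by (auto simp: E_F_B_P_def)
  note ar = PD(1-4) s(1) t(1)
  have es: "e \<cdot> (s \<cdot> x) = x" if "x \<in> Ar C" "Cod C x = B" for x
    using comp_left_cong[OF s(4), of x] that ar ob by simp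
  have ft: "f \<cdot> (t \<cdot> x) = x" if "x \<in> Ar C" "Cod C x = B" for x
    using comp_left_cong[OF t(4), of x] that ar ob by simp
  define k1 k2 where "k1 = pair p q (Id C E) (t \<cdot> e)" "k2 = pair p q (s \<cdot> f) (Id C F)"
  have k1: "k1 \<in> Ar C" "Dom C k1 = E" "Cod C k1 = P" "p \<cdot> k1 = Id C E" "q \<cdot> k1 = t \<cdot> e"
    unfolding k1_k2_def by ((subst pair[OF PB]; simp add: ar ob es ft)+)
  have k2: "k2 \<in> Ar C" "Dom C k2 = F" "Cod C k2 = P" "p \<cdot> k2 = s \<cdot> f" "q \<cdot> k2 = Id C F"
    unfolding k1_k2_def by ((subst pair[OF PB]; simp add: ar ob es ft)+)
  \<comment> \<open>The projection \<open>q\<close> with section \<open>k2\<close> is a point of the subcategory, and its pullback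
    along \<open>t\<close> is \<open>k1\<close>.\<close>
  have "(q, k2) \<in> trivial_points C I \<eta>"
    using sub_point_trivial[of q k2] k2 ar ob X by simp
  moreover have "is_pullback C e k1 t q"
  proof (rule pullbackI)
    fix u v
    assume "u \<in> Ar C" "v \<in> Ar C" "Dom C v = Dom C u" "Cod C u = Dom C t"
      "Cod C v = Dom C q" and eq: "t \<cdot> u = q \<cdot> v"
    then have uv: "u \<in> Ar C" "v \<in> Ar C" "Dom C v = Dom C u" "Cod C u = B" "Cod C v = P"
      using ob by simp_all
    have e1: "e \<cdot> (p \<cdot> v) = u"
      using pullback_comm[OF PB, of v] uv ob eq[symmetric] ft by simp
    have "k1 \<cdot> (p \<cdot> v) = v"
      by (rule pullback_eqI[OF PB])
        (simp_all add: uv k1 ob ar comp_left_cong[OF k1(4)] comp_left_cong[OF k1(5)] e1 eq)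
    then show "\<exists>w. w \<in> Ar C \<and> Dom C w = Dom C u \<and> Cod C w = Dom C e \<and> e \<cdot> w = u \<and> k1 \<cdot> w = v"
      using e1 uv ob ar by (intro exI[of _ "p \<cdot> v"]) simp
  next
    fix u v
    assume uv: "u \<in> Ar C" "v \<in> Ar C" "Dom C v = Dom C u" "Cod C u = Dom C e"
      "Cod C v = Dom C e" "k1 \<cdot> u = k1 \<cdot> v"
    have "p \<cdot> (k1 \<cdot> u) = u" "p \<cdot> (k1 \<cdot> v) = v"
      using uv(1-5) comp_left_cong[OF k1(4), of u] comp_left_cong[OF k1(4), of v] k1 ob ar by simp_all
    then show "u = v" using uv(6) by metis
  qed (use k1 ob ar in simp_all)
  ultimately have "jointly_strongly_epic C k1 k2"
    using protomodular unfolding protomodular_wrt_def by blast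
  then show ?thesis by (simp add: k1_k2_def ob)
qed

lemma product_eqI:
  assumes "is_pullback C p q e f" "Dom C p \<in> X" "Dom C f \<in> X"
    and "s \<in> Ar C" "Dom C s = Cod C e" "Cod C s = Dom C e" "e \<cdot> s = Id C (Cod C e)"
    and "t \<in> Ar C" "Dom C t = Cod C f" "Cod C t = Dom C f" "f \<cdot> t = Id C (Cod C f)"
    and hk: "h \<in> Ar C" "k \<in> Ar C" "Dom C h = Dom C p" "Dom C k = Dom C p" "Cod C h = Cod C k"
    and "h \<cdot> pair p q (Id C (Dom C e)) (t \<cdot> e) = k \<cdot> pair p q (Id C (Dom C e)) (t \<cdot> e)"
    and "h \<cdot> pair p q (s \<cdot> f) (Id C (Dom C f)) = k \<cdot> pair p q (s \<cdot> f) (Id C (Dom C f))"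
  shows "h = k"
proof -
  have j: "jointly_strongly_epic C (pair p q (Id C (Dom C e)) (t \<cdot> e)) (pair p q (s \<cdot> f) (Id C (Dom C f)))"
    by (rule product_injections_jointly_epic) (fact assms)+
  have "Cod C (pair p q (Id C (Dom C e)) (t \<cdot> e)) = Dom C p"
  proof (rule pair(3)[OF assms(1)])
    show "e \<cdot> Id C (Dom C e) = f \<cdot> (t \<cdot> e)"
      using comp_left_cong[OF assms(11), of e] assms(4-) pullbackD[OF assms(1)] by simp
  qed (use assms(4-) pullbackD[OF assms(1)] in simp_all)
  then show ?thesis
    using j assms(12-) unfolding jointly_strongly_epic_def parallel_def by metis
qed

text \<open>Extremality is checked: a monomorphism through which \<open>r\<close> factors contains both injections, because
  regular epimorphisms are strong, and is therefore split.\<close>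

lemma product_regular_epi:
  assumes PB: "is_pullback C p q e f" and X: "Dom C p \<in> X" "Dom C f \<in> X"
    and s: "s \<in> Ar C" "Dom C s = Cod C e" "Cod C s = Dom C e" "e \<cdot> s = Id C (Cod C e)"
    and t: "t \<in> Ar C" "Dom C t = Cod C f" "Cod C t = Dom C f" "f \<cdot> t = Id C (Cod C f)"
    and r: "r \<in> Ar C" "Cod C r = Dom C p"
    and a: "regular_epi C a" "Cod C a = Dom C e" "a' \<in> Ar C" "Dom C a' = Dom C a" "Cod C a' = Dom C r"
      "r \<cdot> a' = pair p q a (t \<cdot> (e \<cdot> a))"
    and b: "regular_epi C b" "Cod C b = Dom C f" "b' \<in> Ar C" "Dom C b' = Dom C b" "Cod C b' = Dom C r"
      "r \<cdot> b' = pair p q (s \<cdot> (f \<cdot> b)) b"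
  shows "regular_epi C r"
proof (rule regular_epi_if_extremal)
  note PD = pullbackD[OF PB]
  have ab: "a \<in> Ar C" "b \<in> Ar C" using a(1) b(1) by simp_all
  define k1 k2 where "k1 = pair p q (Id C (Dom C e)) (t \<cdot> e)" "k2 = pair p q (s \<cdot> f) (Id C (Dom C f))"
  have j: "jointly_strongly_epic C k1 k2"
    unfolding k1_k2_def by (rule product_injections_jointly_epic) (fact assms)+
  have c1: "e \<cdot> Id C (Dom C e) = f \<cdot> (t \<cdot> e)"
    using comp_left_cong[OF t(4), of e] t PD by simp
  have c2: "e \<cdot> (s \<cdot> f) = f \<cdot> Id C (Dom C f)"
    using comp_left_cong[OF s(4), of f] s PD by simp
  have k1: "k1 \<in> Ar C" "Dom C k1 = Dom C e" "Cod C k1 = Dom C p" "k1 \<cdot> a = r \<cdot> a'"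
    unfolding k1_k2_def
    by ((subst pair[OF PB _ _ _ _ _ c1] pair_comp[OF PB _ _ _ _ _ c1 ab(1)]; simp add: t PD a ab)+)
  have k2: "k2 \<in> Ar C" "Dom C k2 = Dom C f" "Cod C k2 = Dom C p" "k2 \<cdot> b = r \<cdot> b'"
    unfolding k1_k2_def
    by ((subst pair[OF PB _ _ _ _ _ c2] pair_comp[OF PB _ _ _ _ _ c2 ab(2)]; simp add: s PD b ab)+)
  fix m h assume mh: "monic C m" "h \<in> Ar C" "Dom C h = Dom C r" "Cod C h = Dom C m"
      "Cod C m = Cod C r" "m \<cdot> h = r"
  have m: "m \<in> Ar C" using mh(1) by (simp add: monic_def)
  have "m \<cdot> (h \<cdot> a') = k1 \<cdot> a" "h \<cdot> a' \<in> Ar C" "Dom C (h \<cdot> a') = Dom C a" "Cod C (h \<cdot> a') = Dom C m"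
    "m \<cdot> (h \<cdot> b') = k2 \<cdot> b" "h \<cdot> b' \<in> Ar C" "Dom C (h \<cdot> b') = Dom C b" "Cod C (h \<cdot> b') = Dom C m"
    using comp_left_cong[OF mh(6), of a'] comp_left_cong[OF mh(6), of b'] m mh(2-5) a b k1 k2 by simp_all
  then obtain u v where u: "u \<in> Ar C" "Dom C u = Dom C e" "Cod C u = Dom C m" "m \<cdot> u = k1"
    and v: "v \<in> Ar C" "Dom C v = Dom C f" "Cod C v = Dom C m" "m \<cdot> v = k2"
    using regular_epi_strong[OF a(1) mh(1), of "h \<cdot> a'" k1] regular_epi_strong[OF b(1) mh(1), of "h \<cdot> b'" k2]
      k1 k2 mh(5) r a b by metis
  have P: "Dom C p \<in> Ob C" using PD by simp
  have "\<exists>d. d \<in> hom C (Cod C k1) (Dom C m) \<and> m \<cdot> d = Id C (Dom C p)"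
    by (rule jointly_strongly_epic_diagonal[OF j mh(1), of _ u v])
      (simp_all add: u v k1 k2 P mh(5) r)
  then show "\<exists>d. d \<in> Ar C \<and> Dom C d = Cod C r \<and> Cod C d = Dom C m \<and> m \<cdot> d = Id C (Cod C r)"
    using k1 r by auto
qed (fact r(1))

end

section \<open>Internal groupoids\<close>

text \<open>The composition is given on generalised elements: \<open>mul\<close> takes two arrows with the same domain and
  is natural in that domain. By the Yoneda lemma this is the same as an arrow from an object of
  composable pairs, but no such pullback has to be fixed. The order is diagrammatic: \<open>mul a b\<close> is
  first \<open>a\<close>, then \<open>b\<close>.\<close>

locale internal_groupoid = plain_category C for C :: "('o, 'm) cat" (structure) +
  fixes G0 G :: 'o and d c i inv :: 'm and mul :: "'m \<Rightarrow> 'm \<Rightarrow> 'm"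
  assumes ob: "G0 \<in> Ob C" "G \<in> Ob C"
    and ar: "d \<in> Ar C" "Dom C d = G" "Cod C d = G0" "c \<in> Ar C" "Dom C c = G" "Cod C c = G0"
      "i \<in> Ar C" "Dom C i = G0" "Cod C i = G" "inv \<in> Ar C" "Dom C inv = G" "Cod C inv = G"
    and graph: "d \<cdot> i = Id C G0" "c \<cdot> i = Id C G0" "d \<cdot> inv = c" "c \<cdot> inv = d"
    and mul_type: "\<lbrakk>a \<in> Ar C; b \<in> Ar C; Dom C a = Dom C b; Cod C a = G; Cod C b = G; c \<cdot> a = d \<cdot> b\<rbrakk> \<Longrightarrow>
      mul a b \<in> hom C (Dom C b) G \<and> d \<cdot> mul a b = d \<cdot> a \<and> c \<cdot> mul a b = c \<cdot> b"
    and mul_natural: "\<lbrakk>a \<in> Ar C; b \<in> Ar C; Dom C a = Dom C b; Cod C a = G; Cod C b = G; c \<cdot> a = d \<cdot> b;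
      k \<in> Ar C; Cod C k = Dom C b\<rbrakk> \<Longrightarrow> mul a b \<cdot> k = mul (a \<cdot> k) (b \<cdot> k)"
    and mul_unit: "\<lbrakk>a \<in> Ar C; Cod C a = G\<rbrakk> \<Longrightarrow> mul (i \<cdot> (d \<cdot> a)) a = a"
      "\<lbrakk>a \<in> Ar C; Cod C a = G\<rbrakk> \<Longrightarrow> mul a (i \<cdot> (c \<cdot> a)) = a"
    and mul_assoc: "\<lbrakk>a \<in> Ar C; b \<in> Ar C; e \<in> Ar C; Dom C a = Dom C b; Dom C b = Dom C e;
      Cod C a = G; Cod C b = G; Cod C e = G; c \<cdot> a = d \<cdot> b; c \<cdot> b = d \<cdot> e\<rbrakk> \<Longrightarrow>
      mul (mul a b) e = mul a (mul b e)"
    and mul_inv: "\<lbrakk>a \<in> Ar C; Cod C a = G\<rbrakk> \<Longrightarrow> mul a (inv \<cdot> a) = i \<cdot> (d \<cdot> a)"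
      "\<lbrakk>a \<in> Ar C; Cod C a = G\<rbrakk> \<Longrightarrow> mul (inv \<cdot> a) a = i \<cdot> (c \<cdot> a)"

section \<open>The groupoid generated by a multivalued composition\<close>

text \<open>The elements of \<open>H\<close> are witnesses of composability: \<open>h\<close> says that \<open>m \<cdot> h\<close> is a value of the
  composite of \<open>s1 \<cdot> h\<close> and \<open>s2 \<cdot> h\<close>. Several witnesses with different values may exist for one
  composable pair, and nothing is said about associativity. The arrows \<open>l\<close>, \<open>l'\<close>, \<open>n\<close> and \<open>n'\<close>
  provide witnesses for \<open>(x, 1)\<close>, \<open>(1, x)\<close>, \<open>(x, x\<inverse>)\<close> and \<open>(x\<inverse>, x)\<close>, where \<open>t\<close> is the inversion. The
  reflection of an equivalence relation with its triples is of this form.\<close>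

locale multivalued_groupoid = protomodular_reflection C X I \<eta>
  for C :: "('o, 'm) cat" (structure) and X I \<eta> +
  fixes G0 G H :: 'o and d c i t s1 s2 m l l' n n' :: 'm
  assumes ob: "G0 \<in> X" "G \<in> X" "H \<in> X"
    and ar: "d \<in> Ar C" "Dom C d = G" "Cod C d = G0" "c \<in> Ar C" "Dom C c = G" "Cod C c = G0"
      "i \<in> Ar C" "Dom C i = G0" "Cod C i = G" "t \<in> Ar C" "Dom C t = G" "Cod C t = G"
      "s1 \<in> Ar C" "Dom C s1 = H" "Cod C s1 = G" "s2 \<in> Ar C" "Dom C s2 = H" "Cod C s2 = G"
      "m \<in> Ar C" "Dom C m = H" "Cod C m = G"
      "l \<in> Ar C" "Dom C l = G" "Cod C l = H" "l' \<in> Ar C" "Dom C l' = G" "Cod C l' = H"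
      "n \<in> Ar C" "Dom C n = G" "Cod C n = H" "n' \<in> Ar C" "Dom C n' = G" "Cod C n' = H"
    and graph: "d \<cdot> i = Id C G0" "c \<cdot> i = Id C G0" "d \<cdot> t = c" "c \<cdot> t = d"
      "c \<cdot> s1 = d \<cdot> s2" "d \<cdot> m = d \<cdot> s1" "c \<cdot> m = c \<cdot> s2"
    and degenerate: "s1 \<cdot> l = Id C G" "s2 \<cdot> l = i \<cdot> c" "m \<cdot> l = Id C G"
      "s1 \<cdot> l' = i \<cdot> d" "s2 \<cdot> l' = Id C G" "m \<cdot> l' = Id C G"
      "s1 \<cdot> n = Id C G" "s2 \<cdot> n = t" "m \<cdot> n = i \<cdot> d"
      "s1 \<cdot> n' = t" "s2 \<cdot> n' = Id C G" "m \<cdot> n' = i \<cdot> c"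
begin

lemma obs: "G0 \<in> Ob C" "G \<in> Ob C" "H \<in> Ob C"
  using ob by simp_all

lemma graph_el:
  assumes "x \<in> Ar C"
  shows "Cod C x = G0 \<Longrightarrow> d \<cdot> (i \<cdot> x) = x" "Cod C x = G0 \<Longrightarrow> c \<cdot> (i \<cdot> x) = x"
    "Cod C x = G \<Longrightarrow> d \<cdot> (t \<cdot> x) = c \<cdot> x" "Cod C x = G \<Longrightarrow> c \<cdot> (t \<cdot> x) = d \<cdot> x"
    "Cod C x = H \<Longrightarrow> c \<cdot> (s1 \<cdot> x) = d \<cdot> (s2 \<cdot> x)" "Cod C x = H \<Longrightarrow> d \<cdot> (m \<cdot> x) = d \<cdot> (s1 \<cdot> x)"
    "Cod C x = H \<Longrightarrow> c \<cdot> (m \<cdot> x) = c \<cdot> (s2 \<cdot> x)"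
  using graph[THEN comp_left_cong, OF assms] assms obs by (simp_all add: ar)

lemma degenerate_el:
  assumes "x \<in> Ar C" "Cod C x = G"
  shows "s1 \<cdot> (l \<cdot> x) = x" "s2 \<cdot> (l \<cdot> x) = i \<cdot> (c \<cdot> x)" "m \<cdot> (l \<cdot> x) = x"
    "s1 \<cdot> (l' \<cdot> x) = i \<cdot> (d \<cdot> x)" "s2 \<cdot> (l' \<cdot> x) = x" "m \<cdot> (l' \<cdot> x) = x"
    "s1 \<cdot> (n \<cdot> x) = x" "s2 \<cdot> (n \<cdot> x) = t \<cdot> x" "m \<cdot> (n \<cdot> x) = i \<cdot> (d \<cdot> x)"
    "s1 \<cdot> (n' \<cdot> x) = t \<cdot> x" "s2 \<cdot> (n' \<cdot> x) = x" "m \<cdot> (n' \<cdot> x) = i \<cdot> (c \<cdot> x)"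
  using degenerate[THEN comp_left_cong, OF assms(1)] assms by (simp_all add: ar)

end

text \<open>Here \<open>Y\<close> is the object of composable pairs of \<open>G\<close>, and \<open>N\<close> consists of the pairs of witnesses
  for the same composable pair. The quotient \<open>w\<close> in the subcategory identifies their values, and
  \<open>V\<close> is the object of composable pairs of the quotient \<open>W\<close>.\<close>

locale generated_groupoid = multivalued_groupoid C X I \<eta>
  for C :: "('o, 'm) cat" (structure) and X I \<eta> +
  fixes y1 y2 e1 e2 w v1 v2 d' c' :: 'm and Y N W V :: 'o
  assumes Y: "is_pullback C y1 y2 c d" "Dom C y1 = Y" "Y \<in> X"
    and N: "is_pullback C e1 e2 (pair y1 y2 s1 s2) (pair y1 y2 s1 s2)" "Dom C e1 = N" "N \<in> X"
    and w: "is_coequaliser D w (m \<cdot> e1) (m \<cdot> e2)" "Cod C w = W"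
    and d': "d' \<in> Ar C" "Dom C d' = W" "Cod C d' = G0" "d' \<cdot> w = d"
    and c': "c' \<in> Ar C" "Dom C c' = W" "Cod C c' = G0" "c' \<cdot> w = c"
    and V: "is_pullback C v1 v2 c' d'" "Dom C v1 = V" "V \<in> X"
begin

definition \<pi> where "\<pi> = pair y1 y2 s1 s2"

lemma Y_pair:
  assumes "x \<in> Ar C" "y \<in> Ar C" "Dom C x = Dom C y" "Cod C x = G" "Cod C y = G" "c \<cdot> x = d \<cdot> y"
  shows "pair y1 y2 x y \<in> Ar C" "Dom C (pair y1 y2 x y) = Dom C y" "Cod C (pair y1 y2 x y) = Y"
    "y1 \<cdot> pair y1 y2 x y = x" "y2 \<cdot> pair y1 y2 x y = y"
    "k \<in> Ar C \<Longrightarrow> Cod C k = Dom C y \<Longrightarrow> pair y1 y2 x y \<cdot> k = pair y1 y2 (x \<cdot> k) (y \<cdot> k)"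
  by (subst pair[OF Y(1)] pair_comp[OF Y(1)]; simp add: ar assms Y)+

lemma pi: "\<pi> \<in> Ar C" "Dom C \<pi> = H" "Cod C \<pi> = Y"
  "h \<in> Ar C \<Longrightarrow> Cod C h = H \<Longrightarrow> \<pi> \<cdot> h = pair y1 y2 (s1 \<cdot> h) (s2 \<cdot> h)"
  unfolding \<pi>_def by (subst Y_pair; simp add: ar graph)+

text \<open>Every composable pair has a composite on some cover, since both injections into \<open>Y\<close> lift through
  \<open>\<pi>\<close> along \<open>l\<close> and \<open>l'\<close>.\<close>

lemma pi_regular_epi: "regular_epi C \<pi>"
proof (rule product_regular_epi[OF Y(1), of i i \<pi> "Id C G" l "Id C G" l'])
  show "regular_epi C (Id C G)"
    by (rule split_epi_regular[of _ "Id C G"]) (simp_all add: obs)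
  then show "regular_epi C (Id C G)" .
  show "\<pi> \<cdot> l = pair y1 y2 (Id C G) (i \<cdot> (c \<cdot> Id C G))" "\<pi> \<cdot> l' = pair y1 y2 (i \<cdot> (d \<cdot> Id C G)) (Id C G)"
    by (simp_all add: pi ar degenerate obs)
qed (simp_all add: Y ar ob obs graph pi)

lemma w_simps: "w \<in> Ar C" "Dom C w = G" "Cod C w = W" "W \<in> X" "W \<in> Ob C" "regular_epi C w"
proof -
  have e: "e1 \<in> Ar C" "Dom C e1 = N" "Cod C e1 = H"
    using pullbackD[OF N(1)] N(2) pi by (auto simp: \<pi>_def)
  show "w \<in> Ar C" "Dom C w = G" "Cod C w = W" "W \<in> X" "W \<in> Ob C"
    using w e by (auto simp: is_coequaliser_def ar)
  show "regular_epi C w"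
    using w(1) by (intro regular_epi_sub) (auto simp: regular_epi_def)
qed

lemma N_pair:
  assumes "h \<in> Ar C" "h' \<in> Ar C" "Dom C h = Dom C h'" "Cod C h = H" "Cod C h' = H"
    "s1 \<cdot> h = s1 \<cdot> h'" "s2 \<cdot> h = s2 \<cdot> h'"
  obtains k where "k \<in> Ar C" "Dom C k = Dom C h'" "Cod C k = N" "e1 \<cdot> k = h" "e2 \<cdot> k = h'"
proof -
  have "\<pi> \<cdot> h = \<pi> \<cdot> h'" using assms by (simp add: pi)
  then show ?thesis
    using pair[OF N(1), of h h'] assms(1-5) pi that[of "pair e1 e2 h h'"] N(2)
    by (simp add: \<pi>_def)
qed

lemma N_simps: "e1 \<in> Ar C" "e2 \<in> Ar C" "Dom C e1 = N" "Dom C e2 = N" "Cod C e1 = H" "Cod C e2 = H"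
  "N \<in> Ob C"
  using pullbackD[OF N(1)] N(2,3) pi by (auto simp: \<pi>_def)

lemma w_multiplicative:
  assumes "h \<in> Ar C" "h' \<in> Ar C" "Dom C h = Dom C h'" "Cod C h = H" "Cod C h' = H"
    "s1 \<cdot> h = s1 \<cdot> h'" "s2 \<cdot> h = s2 \<cdot> h'"
  shows "w \<cdot> (m \<cdot> h) = w \<cdot> (m \<cdot> h')"
proof -
  obtain k where k: "k \<in> Ar C" "Dom C k = Dom C h'" "Cod C k = N" "e1 \<cdot> k = h" "e2 \<cdot> k = h'"
    using N_pair[OF assms] by blast
  have "w \<cdot> (m \<cdot> e1) = w \<cdot> (m \<cdot> e2)"
    using w(1) by (simp add: is_coequaliser_def)
  from comp_left_cong[OF this, of k] k show ?thesis
    by (simp add: w_simps ar N_simps)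
qed

lemma w_universal:
  assumes g: "g \<in> Ar C" "Dom C g = G" "Cod C g \<in> X"
    and "\<And>h h'. \<lbrakk>h \<in> Ar C; h' \<in> Ar C; Dom C h = Dom C h'; Cod C h = H; Cod C h' = H;
      s1 \<cdot> h = s1 \<cdot> h'; s2 \<cdot> h = s2 \<cdot> h'\<rbrakk> \<Longrightarrow> g \<cdot> (m \<cdot> h) = g \<cdot> (m \<cdot> h')"
  obtains g' where "g' \<in> Ar C" "Dom C g' = W" "Cod C g' = Cod C g" "g' \<cdot> w = g"
proof -
  have "\<pi> \<cdot> e1 = \<pi> \<cdot> e2" using pullbackD(9)[OF N(1)] by (simp add: \<pi>_def)
  then have eq: "pair y1 y2 (s1 \<cdot> e1) (s2 \<cdot> e1) = pair y1 y2 (s1 \<cdot> e2) (s2 \<cdot> e2)"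
    by (simp add: pi N_simps)
  have "s1 \<cdot> e1 = s1 \<cdot> e2"
    using Y_pair(4)[of "s1 \<cdot> e1" "s2 \<cdot> e1"] Y_pair(4)[of "s1 \<cdot> e2" "s2 \<cdot> e2"] eq
    by (simp add: ar N_simps graph_el)
  moreover have "s2 \<cdot> e1 = s2 \<cdot> e2"
    using Y_pair(5)[of "s1 \<cdot> e1" "s2 \<cdot> e1"] Y_pair(5)[of "s1 \<cdot> e2" "s2 \<cdot> e2"] eq
    by (simp add: ar N_simps graph_el)
  ultimately have "g \<cdot> (m \<cdot> e1) = g \<cdot> (m \<cdot> e2)" using assms(4)[of e1 e2] by (simp add: N_simps)
  then have "g \<in> Ar D" "Dom D g = Cod D (m \<cdot>\<^bsub>C\<^esub> e1)" "Comp D g (m \<cdot> e1) = Comp D g (m \<cdot> e2)"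
    using g by (simp_all add: ar N_simps ob)
  then have "\<exists>!g'. g' \<in> hom D (Cod D w) (Cod D g) \<and> Comp D g' w = g"
    using w(1) unfolding is_coequaliser_def by blast
  then show ?thesis using that w(2) by auto
qed

definition i' where "i' = w \<cdot> i"

lemma i': "i' \<in> Ar C" "Dom C i' = G0" "Cod C i' = W"
  by (simp_all add: i'_def w_simps ar)

lemma graph'_el:
  assumes "x \<in> Ar C"
  shows "Cod C x = G \<Longrightarrow> d' \<cdot> (w \<cdot> x) = d \<cdot> x" "Cod C x = G \<Longrightarrow> c' \<cdot> (w \<cdot> x) = c \<cdot> x"
    "Cod C x = G0 \<Longrightarrow> d' \<cdot> (i' \<cdot> x) = x" "Cod C x = G0 \<Longrightarrow> c' \<cdot> (i' \<cdot> x) = x"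
    "Cod C x = G0 \<Longrightarrow> w \<cdot> (i \<cdot> x) = i' \<cdot> x"
proof -
  have *: "d' \<cdot> (w \<cdot> x) = d \<cdot> x" "c' \<cdot> (w \<cdot> x) = c \<cdot> x" if "x \<in> Ar C" "Cod C x = G" for x
    using comp_left_cong[OF d'(4) that(1)] comp_left_cong[OF c'(4) that(1)] that d'(1-3) c'(1-3)
    by (simp_all add: w_simps)
  show "Cod C x = G \<Longrightarrow> d' \<cdot> (w \<cdot> x) = d \<cdot> x" "Cod C x = G \<Longrightarrow> c' \<cdot> (w \<cdot> x) = c \<cdot> x"
    using * assms by simp_all
  show "Cod C x = G0 \<Longrightarrow> d' \<cdot> (i' \<cdot> x) = x" "Cod C x = G0 \<Longrightarrow> c' \<cdot> (i' \<cdot> x) = x"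
    "Cod C x = G0 \<Longrightarrow> w \<cdot> (i \<cdot> x) = i' \<cdot> x"
    using *[of "i \<cdot> x"] assms by (simp_all add: i'_def ar w_simps graph_el)
qed

lemma graph': "d' \<cdot> i' = Id C G0" "c' \<cdot> i' = Id C G0"
  using graph'_el(3,4)[of "Id C G0"] by (simp_all add: obs i' )

text \<open>After the quotient by \<open>w\<close> the values of the composite of a pair in \<open>G\<close> agree, so they descend along
  the regular epimorphism \<open>\<pi>\<close>.\<close>

lemma middle_map:
  obtains \<mu> where "\<mu> \<in> Ar C" "Dom C \<mu> = Y" "Cod C \<mu> = W"
    "\<And>h. h \<in> Ar C \<Longrightarrow> Cod C h = H \<Longrightarrow> \<mu> \<cdot> pair y1 y2 (s1 \<cdot> h) (s2 \<cdot> h) = w \<cdot> (m \<cdot> h)"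
proof -
  obtain \<mu> where mu: "\<mu> \<in> Ar C" "Dom C \<mu> = Y" "Cod C \<mu> = W" "\<mu> \<cdot> \<pi> = w \<cdot> m"
  proof (rule regular_epi_descend[OF pi_regular_epi, of "w \<cdot> m"])
    fix h h'
    assume "h \<in> Ar C" "h' \<in> Ar C" "Dom C h' = Dom C h" "Cod C h = Dom C \<pi>"
      "Cod C h' = Dom C \<pi>" and eq: "\<pi> \<cdot> h = \<pi> \<cdot> h'"
    then have h: "h \<in> Ar C" "h' \<in> Ar C" "Dom C h = Dom C h'" "Cod C h = H" "Cod C h' = H"
      using pi by simp_all
    have "y1 \<cdot> (\<pi> \<cdot> x) = s1 \<cdot> x" "y2 \<cdot> (\<pi> \<cdot> x) = s2 \<cdot> x" if "x \<in> Ar C" "Cod C x = H" for x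
      using that by (simp_all add: pi Y_pair ar graph_el)
    then have "s1 \<cdot> h = s1 \<cdot> h'" "s2 \<cdot> h = s2 \<cdot> h'"
      using h eq by metis+
    then show "(w \<cdot> m) \<cdot> h = (w \<cdot> m) \<cdot> h'"
      using w_multiplicative[OF h] h by (simp add: w_simps ar)
  qed (simp_all add: pi w_simps ar)
  have "\<mu> \<cdot> pair y1 y2 (s1 \<cdot> h) (s2 \<cdot> h) = w \<cdot> (m \<cdot> h)" if "h \<in> Ar C" "Cod C h = H" for h
    using comp_left_cong[OF mu(4), of h] that mu(1-3) by (simp add: pi w_simps ar)
  with mu(1-3) show ?thesis by (rule that)
qed

text \<open>The single-valued composite \<open>\<mu>\<close> depends only on the classes of the two factors. The two arrows to
  be compared live on a product of points, namely the pairs of kernel elements of \<open>w\<close> that are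
  composable, and on each injection one of the factors is an identity.\<close>

lemma w_comp_cong:
  assumes x: "x \<in> Ar C" "x' \<in> Ar C" "Dom C x' = Dom C x" "Cod C x = G" "Cod C x' = G" "w \<cdot> x = w \<cdot> x'"
    and y: "y \<in> Ar C" "y' \<in> Ar C" "Dom C y = Dom C x" "Dom C y' = Dom C x" "Cod C y = G" "Cod C y' = G"
      "w \<cdot> y = w \<cdot> y'"
    and xy: "c \<cdot> x = d \<cdot> y"
    and mu: "\<mu> \<in> Ar C" "Dom C \<mu> = Y" "Cod C \<mu> = W"
    "\<And>h. h \<in> Ar C \<Longrightarrow> Cod C h = H \<Longrightarrow> \<mu> \<cdot> pair y1 y2 (s1 \<cdot> h) (s2 \<cdot> h) = w \<cdot> (m \<cdot> h)"
  shows "\<mu> \<cdot> pair y1 y2 x y = \<mu> \<cdot> pair y1 y2 x' y'"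
proof -
  have munit: "\<mu> \<cdot> pair y1 y2 z (i \<cdot> (c \<cdot> z)) = w \<cdot> z" "\<mu> \<cdot> pair y1 y2 (i \<cdot> (d \<cdot> z)) z = w \<cdot> z"
    if "z \<in> Ar C" "Cod C z = G" for z
    using that mu(4)[of "l \<cdot> z"] mu(4)[of "l' \<cdot> z"] by (simp_all add: ar degenerate_el)
  \<comment> \<open>Elements of \<open>K0\<close> are pairs identified by \<open>w\<close>; they form a
    reflexive graph on \<open>G0\<close> with identities \<open>s\<close>, and \<open>Q0\<close> consists of
    its composable pairs.\<close>
  obtain k1 k2 where K: "is_pullback C k1 k2 w w" "Dom C k1 \<in> X"
    using sub_pullback[of w w] w_simps ob by metis
  define K0 where "K0 = Dom C k1"
  have K0: "k1 \<in> Ar C" "k2 \<in> Ar C" "Dom C k1 = K0" "Dom C k2 = K0" "Cod C k1 = G" "Cod C k2 = G"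
    "K0 \<in> X" "K0 \<in> Ob C" "w \<cdot> k1 = w \<cdot> k2"
    using pullbackD[OF K(1)] K(2) w_simps by (auto simp: K0_def)
  have ck: "c \<cdot> (k2 \<cdot> z) = c \<cdot> (k1 \<cdot> z)" "d \<cdot> (k2 \<cdot> z) = d \<cdot> (k1 \<cdot> z)" "w \<cdot> (k2 \<cdot> z) = w \<cdot> (k1 \<cdot> z)"
    if "z \<in> Ar C" "Cod C z = K0" for z
  proof -
    show *: "w \<cdot> (k2 \<cdot> z) = w \<cdot> (k1 \<cdot> z)"
      using comp_left_cong[OF K0(9), of z] that by (simp add: K0 w_simps)
    show "c \<cdot> (k2 \<cdot> z) = c \<cdot> (k1 \<cdot> z)" "d \<cdot> (k2 \<cdot> z) = d \<cdot> (k1 \<cdot> z)"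
      using arg_cong[OF *, of "\<lambda>a. c' \<cdot> a"] arg_cong[OF *, of "\<lambda>a. d' \<cdot> a"] that
      by (simp_all add: K0 graph'_el)
  qed
  define e f where "e = c \<cdot> k1" "f = d \<cdot> k1"
  have ef: "e \<in> Ar C" "f \<in> Ar C" "Dom C e = K0" "Dom C f = K0" "Cod C e = G0" "Cod C f = G0"
    by (simp_all add: e_f_def ar K0)
  obtain q1 q2 where Q: "is_pullback C q1 q2 e f" "Dom C q1 \<in> X"
    using sub_pullback[of e f] ef K0 ob by metis
  define Q0 where "Q0 = Dom C q1"
  have Q0: "q1 \<in> Ar C" "q2 \<in> Ar C" "Dom C q1 = Q0" "Dom C q2 = Q0" "Cod C q1 = K0" "Cod C q2 = K0"
    "Q0 \<in> X" "Q0 \<in> Ob C"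
    using pullbackD[OF Q(1)] Q(2) ef by (auto simp: Q0_def)
  have qc: "c \<cdot> (k1 \<cdot> (q1 \<cdot> z)) = d \<cdot> (k1 \<cdot> (q2 \<cdot> z))" if "z \<in> Ar C" "Cod C z = Q0" for z
    using pullback_comm[OF Q(1), of z] that by (simp add: e_f_def ar K0 Q0)
  have qc1: "c \<cdot> (k1 \<cdot> q1) = d \<cdot> (k1 \<cdot> q2)"
    using pullbackD(9)[OF Q(1)] by (simp add: e_f_def ar K0 Q0)
  note K_pair = pair[OF K(1), unfolded w_simps K0] pair_comp[OF K(1), unfolded w_simps K0]
  note Q_pair = pair[OF Q(1), unfolded ef Q0] pair_comp[OF Q(1), unfolded ef Q0]
  define s where "s = pair k1 k2 i i"
  have s: "s \<in> Ar C" "Dom C s = G0" "Cod C s = K0" "k1 \<cdot> s = i" "k2 \<cdot> s = i"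
    unfolding s_def by (subst K_pair; simp add: ar obs)+
  have es: "e \<cdot> s = Id C G0" "f \<cdot> s = Id C G0"
    using s by (simp_all add: e_f_def ar K0 graph)
  have sz: "k1 \<cdot> (s \<cdot> z) = i \<cdot> z" "k2 \<cdot> (s \<cdot> z) = i \<cdot> z" "e \<cdot> (s \<cdot> z) = z" "f \<cdot> (s \<cdot> z) = z"
    if "z \<in> Ar C" "Cod C z = G0" for z
    using that s(4,5)[THEN comp_left_cong, of z] es[THEN comp_left_cong, of z]
    by (simp_all add: s(1-3) K0 ef)
  define j1 j2 where "j1 = pair q1 q2 (Id C K0) (s \<cdot> e)" "j2 = pair q1 q2 (s \<cdot> f) (Id C K0)"
  have j1: "j1 \<in> Ar C" "Dom C j1 = K0" "Cod C j1 = Q0" "q1 \<cdot> j1 = Id C K0" "q2 \<cdot> j1 = s \<cdot> e"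
    unfolding j1_j2_def by (subst Q_pair; simp add: ef K0 s sz)+
  have j2: "j2 \<in> Ar C" "Dom C j2 = K0" "Cod C j2 = Q0" "q1 \<cdot> j2 = s \<cdot> f" "q2 \<cdot> j2 = Id C K0"
    unfolding j1_j2_def by (subst Q_pair; simp add: ef K0 s sz)+
  have "\<mu> \<cdot> pair y1 y2 (k1 \<cdot> q1) (k1 \<cdot> q2) = \<mu> \<cdot> pair y1 y2 (k2 \<cdot> q1) (k2 \<cdot> q2)" (is "?h = ?k")
  proof (rule product_eqI[OF Q(1), of s s])
    show "?h \<cdot> pair q1 q2 (Id C (Dom C e)) (s \<cdot> e) = ?k \<cdot> pair q1 q2 (Id C (Dom C e)) (s \<cdot> e)"
      using munit[of k1] munit[of k2] ck[of "Id C K0"]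
      by (simp add: ef j1_j2_def[symmetric] j1 j2 mu(1-3) Y_pair Q0 K0 ar qc qc1 ck sz s)
         (simp add: e_f_def K0 ar)
    show "?h \<cdot> pair q1 q2 (s \<cdot> f) (Id C (Dom C f)) = ?k \<cdot> pair q1 q2 (s \<cdot> f) (Id C (Dom C f))"
      using munit[of k1] munit[of k2] ck[of "Id C K0"]
      by (simp add: ef j1_j2_def[symmetric] j1 j2 mu(1-3) Y_pair Q0 K0 ar qc qc1 ck sz s)
         (simp add: e_f_def K0 ar)
  qed (simp_all add: Q0 K0 ef s es mu(1-3) Y_pair ar ck qc1)
  note eq = comp_left_cong[OF this]
  define a where "a = pair k1 k2 x x'"
  have a: "a \<in> Ar C" "Dom C a = Dom C x" "Cod C a = K0" "k1 \<cdot> a = x" "k2 \<cdot> a = x'"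
    unfolding a_def by (subst K_pair; simp add: x)+
  define b where "b = pair k1 k2 y y'"
  have b: "b \<in> Ar C" "Dom C b = Dom C x" "Cod C b = K0" "k1 \<cdot> b = y" "k2 \<cdot> b = y'"
    unfolding b_def by (subst K_pair; simp add: y)+
  define r where "r = pair q1 q2 a b"
  have eab: "e \<cdot> a = f \<cdot> b" using a b xy by (simp add: e_f_def ar K0)
  have r: "r \<in> Ar C" "Dom C r = Dom C x" "Cod C r = Q0" "q1 \<cdot> r = a" "q2 \<cdot> r = b"
    unfolding r_def by (subst Q_pair; simp add: a b eab)+
  show ?thesis
    using eq[of r] a b r
    by (simp add: mu(1-3) Y_pair Q0 K0 ar qc qc1 ck )
qed

end

context generated_groupoid
begin

lemma V_simps: "v1 \<in> Ar C" "v2 \<in> Ar C" "Dom C v1 = V" "Dom C v2 = V" "Cod C v1 = W" "Cod C v2 = W"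
  "V \<in> Ob C" "c' \<cdot> v1 = d' \<cdot> v2"
  using pullbackD[OF V(1)] V(2,3) d' c' by auto

lemma V_comm: "x \<in> Ar C \<Longrightarrow> Cod C x = V \<Longrightarrow> c' \<cdot> (v1 \<cdot> x) = d' \<cdot> (v2 \<cdot> x)"
  using pullback_comm[OF V(1)] V(2) by simp

lemma V_pair:
  assumes "x \<in> Ar C" "y \<in> Ar C" "Dom C x = Dom C y" "Cod C x = W" "Cod C y = W" "c' \<cdot> x = d' \<cdot> y"
  shows "pair v1 v2 x y \<in> Ar C" "Dom C (pair v1 v2 x y) = Dom C y" "Cod C (pair v1 v2 x y) = V"
    "v1 \<cdot> pair v1 v2 x y = x" "v2 \<cdot> pair v1 v2 x y = y"
    "k \<in> Ar C \<Longrightarrow> Cod C k = Dom C y \<Longrightarrow> pair v1 v2 x y \<cdot> k = pair v1 v2 (x \<cdot> k) (y \<cdot> k)"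
  by (subst pair[OF V(1)] pair_comp[OF V(1)]; simp add: d' c' assms V)+

definition comparison where "comparison = pair v1 v2 (w \<cdot> s1) (w \<cdot> s2)"

lemma comparison: "comparison \<in> Ar C" "Dom C comparison = H" "Cod C comparison = V"
  "h \<in> Ar C \<Longrightarrow> Cod C h = H \<Longrightarrow> comparison \<cdot> h = pair v1 v2 (w \<cdot> (s1 \<cdot> h)) (w \<cdot> (s2 \<cdot> h))"
  unfolding comparison_def by (subst V_pair; simp add: ar graph w_simps graph'_el)+

lemma comparison_proj: "v1 \<cdot> comparison = w \<cdot> s1" "v2 \<cdot> comparison = w \<cdot> s2"
  unfolding comparison_def by (subst V_pair; simp add: ar graph w_simps graph'_el)+

text \<open>The same argument as for \<open>\<pi>\<close>, with the injections lifted only after composition with \<open>w\<close>.\<close>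

lemma comparison_regular_epi: "regular_epi C comparison"
proof (rule product_regular_epi[OF V(1), of i' i' comparison w l w l'])
  show "comparison \<cdot> l = pair v1 v2 w (i' \<cdot> (c' \<cdot> w))" "comparison \<cdot> l' = pair v1 v2 (i' \<cdot> (d' \<cdot> w)) w"
    using degenerate(2,4)
    by (simp_all add: comparison ar degenerate w_simps c' d' graph'_el)
qed (simp_all add: V d' c' ob ar comparison i' graph' w_simps)

lemma comparison_lift:
  assumes "x \<in> Ar C" "y \<in> Ar C" "Dom C x = Dom C y" "Cod C x = W" "Cod C y = W" "c' \<cdot> x = d' \<cdot> y"
  obtains e h where "regular_epi C e" "Cod C e = Dom C y" "h \<in> Ar C" "Dom C h = Dom C e" "Cod C h = H"
    "w \<cdot> (s1 \<cdot> h) = x \<cdot> e" "w \<cdot> (s2 \<cdot> h) = y \<cdot> e"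
proof -
  note P = V_pair[OF assms]
  obtain e h where e: "regular_epi C e" "e \<in> Ar C" "Cod C e = Dom C y" "h \<in> Ar C" "Dom C h = Dom C e" "Cod C h = H"
    "comparison \<cdot> h = pair v1 v2 x y \<cdot> e"
    using regular_epi_lift[OF comparison_regular_epi P(1)] P(2,3) comparison(2,3) by metis
  have "v1 \<cdot> (comparison \<cdot> h) = x \<cdot> e" "v2 \<cdot> (comparison \<cdot> h) = y \<cdot> e"
    unfolding e(7)
    using e(1-6) P(1-3) comp_left_cong[OF P(4), of e] comp_left_cong[OF P(5), of e]
    by (simp_all add: V_simps)
  moreover have "v1 \<cdot> (comparison \<cdot> h) = w \<cdot> (s1 \<cdot> h)" "v2 \<cdot> (comparison \<cdot> h) = w \<cdot> (s2 \<cdot> h)"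
    using e(4,6) by (simp_all add: comparison(4) V_pair w_simps ar graph'_el graph_el)
  ultimately show ?thesis using that e by metis
qed

definition multiplication where
  "multiplication = (SOME M. M \<in> Ar C \<and> Dom C M = V \<and> Cod C M = W \<and> M \<cdot> comparison = w \<cdot> m)"

lemma multiplication:
  "multiplication \<in> Ar C" "Dom C multiplication = V" "Cod C multiplication = W"
  "multiplication \<cdot> comparison = w \<cdot> m"
proof -
  obtain \<mu> where mu: "\<mu> \<in> Ar C" "Dom C \<mu> = Y" "Cod C \<mu> = W"
    "\<And>h. h \<in> Ar C \<Longrightarrow> Cod C h = H \<Longrightarrow> \<mu> \<cdot> pair y1 y2 (s1 \<cdot> h) (s2 \<cdot> h) = w \<cdot> (m \<cdot> h)"
    using middle_map by blast
  have "\<exists>M. M \<in> Ar C \<and> Dom C M = V \<and> Cod C M = W \<and> M \<cdot> comparison = w \<cdot> m"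
  proof (rule regular_epi_descend[OF comparison_regular_epi, of "w \<cdot> m"])
    fix h h'
    assume "h \<in> Ar C" "h' \<in> Ar C" "Dom C h' = Dom C h" "Cod C h = Dom C comparison"
      "Cod C h' = Dom C comparison" and eq: "comparison \<cdot> h = comparison \<cdot> h'"
    then have h: "h \<in> Ar C" "h' \<in> Ar C" "Dom C h' = Dom C h" "Cod C h = H" "Cod C h' = H"
      using comparison by simp_all
    have "v1 \<cdot> (comparison \<cdot> x) = w \<cdot> (s1 \<cdot> x)" "v2 \<cdot> (comparison \<cdot> x) = w \<cdot> (s2 \<cdot> x)"
      if "x \<in> Ar C" "Cod C x = H" for x
      using that by (simp_all add: comparison V_pair ar graph_el w_simps graph'_el)
    then have "w \<cdot> (s1 \<cdot> h) = w \<cdot> (s1 \<cdot> h')" "w \<cdot> (s2 \<cdot> h) = w \<cdot> (s2 \<cdot> h')"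
      using h eq by metis+
    then have "\<mu> \<cdot> pair y1 y2 (s1 \<cdot> h) (s2 \<cdot> h) = \<mu> \<cdot> pair y1 y2 (s1 \<cdot> h') (s2 \<cdot> h')"
      by (intro w_comp_cong mu) (simp_all add: h ar graph_el)
    then show "(w \<cdot> m) \<cdot> h = (w \<cdot> m) \<cdot> h'"
      using mu(4)[of h] mu(4)[of h'] h by (simp add: w_simps ar)
  qed (auto simp: comparison w_simps ar)
  then have "multiplication \<in> Ar C \<and> Dom C multiplication = V \<and> Cod C multiplication = W \<and>
      multiplication \<cdot> comparison = w \<cdot> m"
    unfolding multiplication_def by (rule someI_ex)
  then show "multiplication \<in> Ar C" "Dom C multiplication = V" "Cod C multiplication = W"
    "multiplication \<cdot> comparison = w \<cdot> m" by simp_all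
qed

definition mul where "mul a b = multiplication \<cdot> pair v1 v2 a b"

lemma mul_w:
  assumes "h \<in> Ar C" "Cod C h = H"
  shows "mul (w \<cdot> (s1 \<cdot> h)) (w \<cdot> (s2 \<cdot> h)) = w \<cdot> (m \<cdot> h)"
  using comp_left_cong[OF multiplication(4), of h] assms multiplication(1-3)
  by (simp add: mul_def comparison w_simps ar)

lemma mul_type:
  assumes "a \<in> Ar C" "b \<in> Ar C" "Dom C a = Dom C b" "Cod C a = W" "Cod C b = W" "c' \<cdot> a = d' \<cdot> b"
  shows "mul a b \<in> Ar C" "Dom C (mul a b) = Dom C b" "Cod C (mul a b) = W"
    "d' \<cdot> mul a b = d' \<cdot> a" "c' \<cdot> mul a b = c' \<cdot> b"
    "k \<in> Ar C \<Longrightarrow> Cod C k = Dom C b \<Longrightarrow> mul a b \<cdot> k = mul (a \<cdot> k) (b \<cdot> k)"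
proof -
  show t: "mul a b \<in> Ar C" "Dom C (mul a b) = Dom C b" "Cod C (mul a b) = W"
    "k \<in> Ar C \<Longrightarrow> Cod C k = Dom C b \<Longrightarrow> mul a b \<cdot> k = mul (a \<cdot> k) (b \<cdot> k)"
    using assms multiplication(1-3) by (simp_all add: mul_def V_pair)
  have "d' \<cdot> multiplication = d' \<cdot> v1"
  proof (rule regular_epi_cancel[OF comparison_regular_epi])
    show "(d' \<cdot> multiplication) \<cdot> comparison = (d' \<cdot> v1) \<cdot> comparison"
      by (simp add: multiplication comparison(1-3) comparison_proj d' V_simps V_pair w_simps ar graph'_el graph graph_el)
  qed (simp_all add: multiplication comparison d' V_simps)
  from comp_left_cong[OF this, of "pair v1 v2 a b"] show "d' \<cdot> mul a b = d' \<cdot> a"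
    using assms by (simp add: mul_def V_pair multiplication d' V_simps)
  have "c' \<cdot> multiplication = c' \<cdot> v2"
  proof (rule regular_epi_cancel[OF comparison_regular_epi])
    show "(c' \<cdot> multiplication) \<cdot> comparison = (c' \<cdot> v2) \<cdot> comparison"
      by (simp add: multiplication comparison(1-3) comparison_proj c' V_simps V_pair w_simps ar graph'_el graph graph_el)
  qed (simp_all add: multiplication comparison c' V_simps)
  from comp_left_cong[OF this, of "pair v1 v2 a b"] show "c' \<cdot> mul a b = c' \<cdot> b"
    using assms by (simp add: mul_def V_pair multiplication c' V_simps)
qed

lemma mul_unit:
  assumes "a \<in> Ar C" "Cod C a = W"
  shows "mul (i' \<cdot> (d' \<cdot> a)) a = a" "mul a (i' \<cdot> (c' \<cdot> a)) = a"
proof -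
  have "mul (i' \<cdot> d') (Id C W) = Id C W"
  proof (rule regular_epi_cancel[OF w_simps(6)])
    show "mul (i' \<cdot> d') (Id C W) \<cdot> w = Id C W \<cdot> w"
      using mul_w[of l'] by (simp add: w_simps d' i' graph'_el mul_type degenerate ar)
  qed (simp_all add: w_simps d' i' graph'_el mul_type)
  from arg_cong[OF this, of "\<lambda>z. z \<cdot> a"] show "mul (i' \<cdot> (d' \<cdot> a)) a = a"
    using assms by (simp add: mul_type w_simps d' i' graph'_el)
  have "mul (Id C W) (i' \<cdot> c') = Id C W"
  proof (rule regular_epi_cancel[OF w_simps(6)])
    show "mul (Id C W) (i' \<cdot> c') \<cdot> w = Id C W \<cdot> w"
      using mul_w[of l] by (simp add: w_simps c' i' graph'_el mul_type degenerate ar)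
  qed (simp_all add: w_simps c' i' graph'_el mul_type)
  from arg_cong[OF this, of "\<lambda>z. z \<cdot> a"] show "mul a (i' \<cdot> (c' \<cdot> a)) = a"
    using assms by (simp add: mul_type w_simps c' i' graph'_el)
qed

text \<open>The composable triples form the product of the point \<open>V\<close>, seen over \<open>G0\<close> through the codomain of
  the second factor, with the point \<open>W\<close>. On the first injection the third factor is an identity, on
  the second injection the first two factors are.\<close>

lemma mul_assoc:
  assumes a: "a \<in> Ar C" "Cod C a = W" and b: "b \<in> Ar C" "Dom C b = Dom C a" "Cod C b = W"
    and x: "x \<in> Ar C" "Dom C x = Dom C a" "Cod C x = W"
    and comm: "c' \<cdot> a = d' \<cdot> b" "c' \<cdot> b = d' \<cdot> x"
  shows "mul (mul a b) x = mul a (mul b x)"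
proof -
  define e where "e = c' \<cdot> v2"
  have e: "e \<in> Ar C" "Dom C e = V" "Cod C e = G0"
    by (simp_all add: e_def c' V_simps)
  obtain q1 q2 where Q: "is_pullback C q1 q2 e d'" "Dom C q1 \<in> X"
    using sub_pullback[of e d'] e d' V w_simps ob by metis
  define Q0 where "Q0 = Dom C q1"
  have Q0: "q1 \<in> Ar C" "q2 \<in> Ar C" "Dom C q1 = Q0" "Dom C q2 = Q0" "Cod C q1 = V" "Cod C q2 = W"
    "Q0 \<in> X" "Q0 \<in> Ob C"
    using pullbackD[OF Q(1)] Q(2) e d' by (auto simp: Q0_def)
  have qc: "d' \<cdot> (q2 \<cdot> z) = c' \<cdot> (v2 \<cdot> (q1 \<cdot> z))" if "z \<in> Ar C" "Cod C z = Q0" for z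
    using pullback_comm[OF Q(1), of z] that by (simp add: e_def V_simps Q0 c')
  have qc1: "d' \<cdot> q2 = c' \<cdot> (v2 \<cdot> q1)"
    using pullbackD(9)[OF Q(1)] by (simp add: e_def V_simps Q0 c')
  have vc: "d' \<cdot> (v2 \<cdot> z) = c' \<cdot> (v1 \<cdot> z)" if "z \<in> Ar C" "Cod C z = V" for z
    using V_comm[OF that] by simp
  note Q_pair = pair[OF Q(1), unfolded e d' Q0] pair_comp[OF Q(1), unfolded e d' Q0]
  define s where "s = pair v1 v2 i' i'"
  have s: "s \<in> Ar C" "Dom C s = G0" "Cod C s = V" "v1 \<cdot> s = i'" "v2 \<cdot> s = i'"
    unfolding s_def by (subst V_pair; simp add: i' graph')+
  have es: "e \<cdot> s = Id C G0"
    using s by (simp add: e_def V_simps c' graph')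
  have sz: "v1 \<cdot> (s \<cdot> z) = i' \<cdot> z" "v2 \<cdot> (s \<cdot> z) = i' \<cdot> z" "e \<cdot> (s \<cdot> z) = z"
    if "z \<in> Ar C" "Cod C z = G0" for z
    using that s(4,5)[THEN comp_left_cong, of z] es[THEN comp_left_cong, of z]
    by (simp_all add: s(1-3) V_simps e)
  define j1 j2 where "j1 = pair q1 q2 (Id C V) (i' \<cdot> e)" "j2 = pair q1 q2 (s \<cdot> d') (Id C W)"
  have j1: "j1 \<in> Ar C" "Dom C j1 = V" "Cod C j1 = Q0" "q1 \<cdot> j1 = Id C V" "q2 \<cdot> j1 = i' \<cdot> e"
    unfolding j1_j2_def by (subst Q_pair; simp add: e V_simps d' i' graph'_el)+
  have j2: "j2 \<in> Ar C" "Dom C j2 = W" "Cod C j2 = Q0" "q1 \<cdot> j2 = s \<cdot> d'" "q2 \<cdot> j2 = Id C W"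
    unfolding j1_j2_def by (subst Q_pair; simp add: e s w_simps d' sz)+
  have "mul (mul (v1 \<cdot> q1) (v2 \<cdot> q1)) q2 = mul (v1 \<cdot> q1) (mul (v2 \<cdot> q1) q2)" (is "?h = ?k")
  proof (rule product_eqI[OF Q(1), of s i'])
    have "mul (mul v1 v2) (i' \<cdot> (c' \<cdot> v2)) = mul v1 v2"
      using mul_unit(2)[of "mul v1 v2"] by (simp add: mul_type V_simps)
    moreover have "mul v2 (i' \<cdot> (c' \<cdot> v2)) = v2"
      using mul_unit(2)[of v2] by (simp add: V_simps)
    ultimately show "?h \<cdot> pair q1 q2 (Id C (Dom C e)) (i' \<cdot> e) = ?k \<cdot> pair q1 q2 (Id C (Dom C e)) (i' \<cdot> e)"
      by (simp add: e j1_j2_def[symmetric] j1 mul_type Q0 V_simps c' vc qc qc1)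
        (simp add: e_def mul_type V_simps c' i' graph'_el)
    have "mul (i' \<cdot> d') (Id C W) = Id C W"
      using mul_unit(1)[of "Id C W"] by (simp add: w_simps d')
    moreover have "mul (i' \<cdot> d') (i' \<cdot> d') = i' \<cdot> d'"
      using mul_unit(2)[of "i' \<cdot> d'"] by (simp add: w_simps d' i' graph'_el)
    ultimately show "?h \<cdot> pair q1 q2 (s \<cdot> d') (Id C (Dom C d')) = ?k \<cdot> pair q1 q2 (s \<cdot> d') (Id C (Dom C d'))"
      by (simp add: d' j1_j2_def[symmetric] j2 mul_type Q0 V_simps vc qc qc1 s sz)
  qed (simp_all add: Q0 w_simps e d' V_simps s es i' graph' mul_type vc qc1)
  note eq = arg_cong[OF this, of "\<lambda>z. z \<cdot> r" for r]
  define u where "u = pair v1 v2 a b"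
  have u: "u \<in> Ar C" "Dom C u = Dom C a" "Cod C u = V" "v1 \<cdot> u = a" "v2 \<cdot> u = b"
    unfolding u_def by (subst V_pair; simp add: a b comm)+
  have eu: "e \<cdot> u = d' \<cdot> x" using u comm by (simp add: e_def V_simps c')
  define r where "r = pair q1 q2 u x"
  have r: "r \<in> Ar C" "Dom C r = Dom C x" "Cod C r = Q0" "q1 \<cdot> r = u" "q2 \<cdot> r = x"
    unfolding r_def by (subst Q_pair; simp add: u x eu)+
  show ?thesis
    using eq[of r] u r by (simp add: mul_type Q0 V_simps vc qc qc1)
qed

lemma inverse_of_w:
  assumes "x \<in> Ar C" "Cod C x = G"
  shows "mul (w \<cdot> x) (w \<cdot> (t \<cdot> x)) = i' \<cdot> (d \<cdot> x)" "mul (w \<cdot> (t \<cdot> x)) (w \<cdot> x) = i' \<cdot> (c \<cdot> x)"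
  using mul_w[of "n \<cdot> x"] mul_w[of "n' \<cdot> x"] assms by (simp_all add: ar degenerate_el graph'_el)

definition inv where "inv = (SOME j. j \<in> Ar C \<and> Dom C j = W \<and> Cod C j = W \<and> j \<cdot> w = w \<cdot> t)"

text \<open>Elements with the same class have inverses with the same class, because inverses in a category
  are unique; hence \<open>w \<cdot> t\<close> descends along \<open>w\<close>.\<close>

lemma inv: "inv \<in> Ar C" "Dom C inv = W" "Cod C inv = W" "inv \<cdot> w = w \<cdot> t"
proof -
  have "\<exists>j. j \<in> Ar C \<and> Dom C j = W \<and> Cod C j = W \<and> j \<cdot> w = w \<cdot> t"
  proof (rule regular_epi_descend[OF w_simps(6), of "w \<cdot> t"])
    fix x y
    assume "x \<in> Ar C" "y \<in> Ar C" "Dom C y = Dom C x" "Cod C x = Dom C w"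
      "Cod C y = Dom C w" and eq: "w \<cdot> x = w \<cdot> y"
    then have h: "x \<in> Ar C" "y \<in> Ar C" "Dom C y = Dom C x" "Cod C x = G" "Cod C y = G"
      using w_simps by simp_all
    have dxy: "d \<cdot> x = d \<cdot> y" "c \<cdot> x = c \<cdot> y"
      using arg_cong[OF eq, of "\<lambda>a. d' \<cdot> a"] arg_cong[OF eq, of "\<lambda>a. c' \<cdot> a"] h
      by (simp_all add: graph'_el)
    let ?a = "w \<cdot> (t \<cdot> x)" and ?b = "w \<cdot> (t \<cdot> y)"
    \<comment> \<open>The usual computation that a left inverse equals a right inverse.\<close>
    have "?a = mul ?a (i' \<cdot> (c' \<cdot> ?a))"
      using h by (simp add: mul_unit w_simps ar)
    also have "\<dots> = mul ?a (mul (w \<cdot> y) ?b)"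
      using h dxy by (simp add: inverse_of_w graph'_el graph_el ar)
    also have "\<dots> = mul (mul ?a (w \<cdot> y)) ?b"
      using h dxy by (intro mul_assoc[symmetric]) (simp_all add: w_simps ar graph'_el graph_el)
    also have "\<dots> = mul (i' \<cdot> (d' \<cdot> ?b)) ?b"
      using h dxy inverse_of_w(2)[of x] eq by (simp add: graph'_el graph_el ar)
    also have "\<dots> = ?b"
      using h by (simp add: mul_unit w_simps ar)
    finally show "(w \<cdot> t) \<cdot> x = (w \<cdot> t) \<cdot> y" using h by (simp add: w_simps ar)
  qed (auto simp: w_simps ar)
  then have "inv \<in> Ar C \<and> Dom C inv = W \<and> Cod C inv = W \<and> inv \<cdot> w = w \<cdot> t"
    unfolding inv_def by (rule someI_ex)
  then show "inv \<in> Ar C" "Dom C inv = W" "Cod C inv = W" "inv \<cdot> w = w \<cdot> t" by simp_all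
qed

lemma inv_graph: "d' \<cdot> inv = c'" "c' \<cdot> inv = d'"
  by (rule regular_epi_cancel[OF w_simps(6)]; simp add: inv d' c' w_simps graph'_el ar graph)+

lemma mul_inv:
  assumes "a \<in> Ar C" "Cod C a = W"
  shows "mul a (inv \<cdot> a) = i' \<cdot> (d' \<cdot> a)" "mul (inv \<cdot> a) a = i' \<cdot> (c' \<cdot> a)"
proof -
  have "mul (Id C W) inv = i' \<cdot> d'"
    by (rule regular_epi_cancel[OF w_simps(6)])
      (use inverse_of_w(1)[of "Id C G"] in
        \<open>simp_all add: inv inv_graph d' c' i' w_simps ar obs mul_type\<close>)
  from arg_cong[OF this, of "\<lambda>z. z \<cdot> a"] show "mul a (inv \<cdot> a) = i' \<cdot> (d' \<cdot> a)"
    using assms by (simp add: mul_type inv inv_graph w_simps d' c' i')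
  have "mul inv (Id C W) = i' \<cdot> c'"
    by (rule regular_epi_cancel[OF w_simps(6)])
      (use inverse_of_w(2)[of "Id C G"] in
        \<open>simp_all add: inv inv_graph d' c' i' w_simps ar obs mul_type\<close>)
  from arg_cong[OF this, of "\<lambda>z. z \<cdot> a"] show "mul (inv \<cdot> a) a = i' \<cdot> (c' \<cdot> a)"
    using assms by (simp add: mul_type inv inv_graph w_simps d' c' i')
qed

theorem generated_internal_groupoid: "internal_groupoid C G0 W d' c' i' inv mul"
  by unfold_locales
    (simp_all add: obs w_simps d' c' i' inv inv_graph graph' mul_type mul_unit mul_assoc mul_inv)

end

text \<open>The generated groupoid, with what is needed later: its composites are the classes of the values
  of \<open>m\<close>, composable pairs are represented by witnesses on a cover, and \<open>w\<close> is universal among the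
  arrows of the subcategory that give the same image to all values of a composite.\<close>

theorem (in multivalued_groupoid) generated_groupoid_exists:
  obtains W w d' c' inv mul where "internal_groupoid C G0 W d' c' (w \<cdot> i) inv mul"
    "W \<in> X" "regular_epi C w" "Dom C w = G" "Cod C w = W" "d' \<cdot> w = d" "c' \<cdot> w = c"
    "\<And>h. h \<in> Ar C \<Longrightarrow> Cod C h = H \<Longrightarrow> mul (w \<cdot> (s1 \<cdot> h)) (w \<cdot> (s2 \<cdot> h)) = w \<cdot> (m \<cdot> h)"
    "\<And>x y. \<lbrakk>x \<in> Ar C; y \<in> Ar C; Dom C x = Dom C y; Cod C x = W; Cod C y = W; c' \<cdot> x = d' \<cdot> y\<rbrakk> \<Longrightarrow>
      \<exists>e h. regular_epi C e \<and> Cod C e = Dom C y \<and> h \<in> Ar C \<and> Dom C h = Dom C e \<and> Cod C h = H \<and>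
        w \<cdot> (s1 \<cdot> h) = x \<cdot> e \<and> w \<cdot> (s2 \<cdot> h) = y \<cdot> e"
    "\<And>g. \<lbrakk>g \<in> Ar C; Dom C g = G; Cod C g \<in> X;
      \<forall>h h'. h \<in> Ar C \<and> h' \<in> Ar C \<and> Dom C h = Dom C h' \<and> Cod C h = H \<and> Cod C h' = H \<and>
        s1 \<cdot> h = s1 \<cdot> h' \<and> s2 \<cdot> h = s2 \<cdot> h' \<longrightarrow> g \<cdot> (m \<cdot> h) = g \<cdot> (m \<cdot> h')\<rbrakk> \<Longrightarrow>
      \<exists>g'. g' \<in> Ar C \<and> Dom C g' = W \<and> Cod C g' = Cod C g \<and> g' \<cdot> w = g"
proof -
  obtain y1 y2 where Y: "is_pullback C y1 y2 c d" "Dom C y1 \<in> X"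
    using sub_pullback[of c d] ar ob by metis
  note YD = pullbackD[OF Y(1)]
  define \<pi> where "\<pi> = pair y1 y2 s1 s2"
  have pi: "\<pi> \<in> Ar C" "Dom C \<pi> = H" "Cod C \<pi> = Dom C y1" "y1 \<cdot> \<pi> = s1" "y2 \<cdot> \<pi> = s2"
    unfolding \<pi>_def by (subst pair[OF Y(1)]; simp add: ar graph)+
  obtain e1 e2 where N: "is_pullback C e1 e2 \<pi> \<pi>" "Dom C e1 \<in> X"
    using sub_pullback[of \<pi> \<pi>] pi Y ob by metis
  note ND = pullbackD[OF N(1)]
  have e: "Cod C e1 = H" "Cod C e2 = H" using ND pi by simp_all
  have "reflexive_graph C (m \<cdot> e1) (m \<cdot> e2) (pair e1 e2 l l)"
  proof -
    have p: "pair e1 e2 l l \<in> Ar C" "Dom C (pair e1 e2 l l) = G" "Cod C (pair e1 e2 l l) = Dom C e1"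
      "e1 \<cdot> pair e1 e2 l l = l" "e2 \<cdot> pair e1 e2 l l = l"
      by (subst pair[OF N(1)]; simp add: pi ar)+
    show ?thesis
      using p ND e degenerate(3) by (simp add: reflexive_graph_def parallel_def ar)
  qed
  then obtain w where w: "is_coequaliser D w (m \<cdot> e1) (m \<cdot> e2)"
    using sub_coequaliser[OF reflexive_coequalisers, of "m \<cdot> e1" "m \<cdot> e2"] N(2) ND e ob ar by auto
  define W where "W = Cod C w"
  have wD: "w \<in> Ar C" "Dom C w = G" "Cod C w = W" "W \<in> X"
    using w ND(1-4) e unfolding is_coequaliser_def by (simp_all add: ar W_def)
  have desc: "\<exists>g. g \<in> Ar C \<and> Dom C g = W \<and> Cod C g = Cod C h \<and> g \<cdot> w = h"
    if h: "h \<in> Ar C" "Dom C h = G" "Cod C h \<in> X" "h \<cdot> (m \<cdot> e1) = h \<cdot> (m \<cdot> e2)" for h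
  proof -
    have "h \<in> Ar D" "Dom D h = Cod D (m \<cdot>\<^bsub>C\<^esub> e1)" "Comp D h (m \<cdot> e1) = Comp D h (m \<cdot> e2)"
      using h ND(1-4) e by (simp_all add: ar ob)
    then have "\<exists>!g. g \<in> hom D (Cod D w) (Cod D h) \<and> Comp D g w = h"
      using w unfolding is_coequaliser_def by blast
    then show ?thesis using wD by auto
  qed
  have s_e: "s1 \<cdot> e1 = s1 \<cdot> e2" "s2 \<cdot> e1 = s2 \<cdot> e2"
    using comp_left_cong[OF pi(4), of e1] comp_left_cong[OF pi(4), of e2]
      comp_left_cong[OF pi(5), of e1] comp_left_cong[OF pi(5), of e2] ND e pi(1-3) YD by simp_all
  obtain d' where d': "d' \<in> Ar C" "Dom C d' = W" "Cod C d' = G0" "d' \<cdot> w = d"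
    using desc[of d] ND e ob s_e by (auto simp: ar graph_el)
  obtain c' where c': "c' \<in> Ar C" "Dom C c' = W" "Cod C c' = G0" "c' \<cdot> w = c"
    using desc[of c] ND e ob s_e by (auto simp: ar graph_el)
  obtain v1 v2 where V: "is_pullback C v1 v2 c' d'" "Dom C v1 \<in> X"
    using sub_pullback[of c' d'] c' d' wD ob by metis
  interpret gg: generated_groupoid G0 G H d c i t s1 s2 m l l' n n' C X I \<eta> y1 y2 e1 e2 w v1 v2 d' c'
      "Dom C y1" "Dom C e1" W "Dom C v1"
    by unfold_locales (use Y N w W_def d' c' V in \<open>simp_all add: \<pi>_def\<close>)
  show ?thesis
  proof (rule that)
    show "internal_groupoid C G0 W d' c' (w \<cdot> i) gg.inv gg.mul"
      using gg.generated_internal_groupoid by (simp add: gg.i'_def)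
    show "W \<in> X" "regular_epi C w" "Dom C w = G" "Cod C w = W" "d' \<cdot> w = d" "c' \<cdot> w = c"
      using gg.w_simps d' c' by simp_all
  qed (use gg.mul_w in simp, metis gg.comparison_lift, metis gg.w_universal)
qed

section \<open>Quotients by equivalence relations\<close>

text \<open>Reflexivity, symmetry and transitivity may be checked on generalised elements; applying them to
  identities and projections gives the arrows in the definition.\<close>

lemma (in plain_category) equivalence_relationI:
  assumes r: "r1 \<in> Ar C" "r2 \<in> Ar C" "Dom C r2 = Dom C r1" "Cod C r2 = Cod C r1"
    and mono: "\<And>u v. \<lbrakk>u \<in> Ar C; v \<in> Ar C; Dom C u = Dom C v; Cod C u = Dom C r1; Cod C v = Dom C r1;
      r1 \<cdot> u = r1 \<cdot> v; r2 \<cdot> u = r2 \<cdot> v\<rbrakk> \<Longrightarrow> u = v"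
    and refl: "\<And>a. \<lbrakk>a \<in> Ar C; Cod C a = Cod C r1\<rbrakk> \<Longrightarrow>
      \<exists>u. u \<in> Ar C \<and> Dom C u = Dom C a \<and> Cod C u = Dom C r1 \<and> r1 \<cdot> u = a \<and> r2 \<cdot> u = a"
    and sym: "\<And>u. \<lbrakk>u \<in> Ar C; Cod C u = Dom C r1\<rbrakk> \<Longrightarrow>
      \<exists>v. v \<in> Ar C \<and> Dom C v = Dom C u \<and> Cod C v = Dom C r1 \<and> r1 \<cdot> v = r2 \<cdot> u \<and> r2 \<cdot> v = r1 \<cdot> u"
    and trans: "\<And>u v. \<lbrakk>u \<in> Ar C; v \<in> Ar C; Dom C u = Dom C v; Cod C u = Dom C r1; Cod C v = Dom C r1;
      r2 \<cdot> u = r1 \<cdot> v\<rbrakk> \<Longrightarrow>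
      \<exists>t. t \<in> Ar C \<and> Dom C t = Dom C u \<and> Cod C t = Dom C r1 \<and> r1 \<cdot> t = r1 \<cdot> u \<and> r2 \<cdot> t = r2 \<cdot> v"
  shows "equivalence_relation C r1 r2"
  unfolding equivalence_relation_def
proof (intro conjI allI impI)
  show "parallel C r1 r2" using r by (simp add: parallel_def)
  show "jointly_monic C r1 r2"
    using r mono by (auto simp: jointly_monic_def parallel_def)
  have "Cod C r1 \<in> Ob C" "Dom C r1 \<in> Ob C" using r by simp_all
  then show "\<exists>e. reflexive_graph C r1 r2 e"
    using refl[of "Id C (Cod C r1)"] r by (auto simp: reflexive_graph_def parallel_def)
  show "\<exists>t. t \<in> hom C (Dom C r1) (Dom C r1) \<and> r1 \<cdot> t = r2 \<and> r2 \<cdot> t = r1"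
    using sym[of "Id C (Dom C r1)"] r \<open>Dom C r1 \<in> Ob C\<close> by auto
  fix p q assume pq: "is_pullback C p q r2 r1"
  note P = pullbackD[OF pq]
  show "\<exists>t. t \<in> hom C (Dom C p) (Dom C r1) \<and> r1 \<cdot> t = r1 \<cdot> p \<and> r2 \<cdot> t = r2 \<cdot> q"
    using trans[of p q] P(1-8) P(9) r(1-3) unfolding in_hom by metis
qed

text \<open>An effective equivalence relation is the kernel pair of its own quotient, since the arrow \<open>g\<close> of
  which it is a kernel pair factors through the quotient.\<close>

lemma (in regular_cat) exact_quotient:
  assumes "barr_exact C" "equivalence_relation C r1 r2"
  obtains q where "regular_epi C q" "Dom C q = Cod C r1" "q \<cdot> r1 = q \<cdot> r2"
    "\<And>a b. \<lbrakk>a \<in> Ar C; b \<in> Ar C; Dom C a = Dom C b; Cod C a = Cod C r1; Cod C b = Cod C r1; q \<cdot> a = q \<cdot> b\<rbrakk> \<Longrightarrow>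
      \<exists>u. u \<in> Ar C \<and> Dom C u = Dom C b \<and> Cod C u = Dom C r1 \<and> r1 \<cdot> u = a \<and> r2 \<cdot> u = b"
proof -
  obtain g where g: "is_pullback C r1 r2 g g"
    using assms unfolding barr_exact_def is_kernel_pair_def by blast
  note gD = pullbackD[OF g]
  obtain q where q: "is_coequaliser C q r1 r2"
    using regular g unfolding regular_category_def is_kernel_pair_def by blast
  then have qD: "q \<in> Ar C" "Dom C q = Cod C r1" "q \<cdot> r1 = q \<cdot> r2" "regular_epi C q"
    unfolding is_coequaliser_def regular_epi_def by blast+
  have "\<exists>!w. w \<in> hom C (Cod C q) (Cod C g) \<and> w \<cdot> q = g"
    using q gD unfolding is_coequaliser_def by metis
  then obtain k where k: "k \<in> Ar C" "Dom C k = Cod C q" "Cod C k = Cod C g" "k \<cdot> q = g" by auto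
  have "\<exists>u. u \<in> Ar C \<and> Dom C u = Dom C b \<and> Cod C u = Dom C r1 \<and> r1 \<cdot> u = a \<and> r2 \<cdot> u = b"
    if ab: "a \<in> Ar C" "b \<in> Ar C" "Dom C a = Dom C b" "Cod C a = Cod C r1" "Cod C b = Cod C r1" "q \<cdot> a = q \<cdot> b"
    for a b
  proof -
    have "g \<cdot> a = k \<cdot> (q \<cdot> a)" "g \<cdot> b = k \<cdot> (q \<cdot> b)"
      using comp_left_cong[OF k(4), of a] comp_left_cong[OF k(4), of b] ab k(1-3) qD(1,2) by simp_all
    then have eq: "g \<cdot> a = g \<cdot> b" using ab(6) by simp
    have c: "Cod C a = Dom C g" "Cod C b = Dom C g" using ab gD by simp_all
    show ?thesis
      using pair(1-5)[OF g ab(1,2,3) c eq] ab(3) by auto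
  qed
  with qD show ?thesis by (intro that)
qed

section \<open>The quotient of a cocycle\<close>

context internal_groupoid
begin

lemma mul_simps:
  assumes "a \<in> Ar C" "b \<in> Ar C" "Dom C a = Dom C b" "Cod C a = G" "Cod C b = G" "c \<cdot> a = d \<cdot> b"
  shows "mul a b \<in> Ar C" "Dom C (mul a b) = Dom C b" "Cod C (mul a b) = G"
    "d \<cdot> mul a b = d \<cdot> a" "c \<cdot> mul a b = c \<cdot> b"
    "k \<in> Ar C \<Longrightarrow> Cod C k = Dom C b \<Longrightarrow> mul a b \<cdot> k = mul (a \<cdot> k) (b \<cdot> k)"
  using mul_type[OF assms] mul_natural[OF assms] by simp_all

lemma graph_el:
  assumes "x \<in> Ar C"
  shows "Cod C x = G0 \<Longrightarrow> d \<cdot> (i \<cdot> x) = x" "Cod C x = G0 \<Longrightarrow> c \<cdot> (i \<cdot> x) = x"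
    "Cod C x = G \<Longrightarrow> d \<cdot> (inv \<cdot> x) = c \<cdot> x" "Cod C x = G \<Longrightarrow> c \<cdot> (inv \<cdot> x) = d \<cdot> x"
  using graph[THEN comp_left_cong, OF assms] assms ob by (simp_all add: ar)

lemma mul_left_cancel:
  assumes a: "a \<in> Ar C" "Cod C a = G" and b: "b \<in> Ar C" "Dom C b = Dom C a" "Cod C b = G" "c \<cdot> a = d \<cdot> b"
    and e: "e \<in> Ar C" "Dom C e = Dom C a" "Cod C e = G" "c \<cdot> a = d \<cdot> e"
    and eq: "mul a b = mul a e"
  shows "b = e"
proof -
  have "mul (inv \<cdot> a) (mul a x) = x"
    if x: "x \<in> Ar C" "Dom C x = Dom C a" "Cod C x = G" "c \<cdot> a = d \<cdot> x" for x
  proof -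
    have "mul (inv \<cdot> a) (mul a x) = mul (mul (inv \<cdot> a) a) x"
      by (rule mul_assoc[symmetric]) (simp_all add: ar graph_el a x(1-3) x(4)[symmetric])
    also have "\<dots> = mul (i \<cdot> (d \<cdot> x)) x" by (simp add: mul_inv a x(4)[symmetric])
    also have "\<dots> = x" by (rule mul_unit(1)[OF x(1,3)])
    finally show ?thesis .
  qed
  from this[OF b] this[OF e] eq show ?thesis by metis
qed

end

text \<open>The family \<open>\<omega>\<close> is a functor to an internal groupoid from the equivalence relation that identifies
  \<open>x\<close> and \<open>y\<close> when \<open>f \<cdot> x = f \<cdot> y\<close>, written on generalised elements; \<open>b\<close> is its effect on objects.\<close>

locale cocycle = regular_cat C + internal_groupoid C G0 G d c i inv mul
  for C :: "('o, 'm) cat" (structure) and G0 G d c i inv mul +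
  fixes f b p1 p2 :: 'm and A B :: 'o and \<omega> :: "'m \<Rightarrow> 'm \<Rightarrow> 'm"
  assumes exact: "barr_exact C"
    and f: "regular_epi C f" "Dom C f = A" "Cod C f = B"
    and b: "b \<in> Ar C" "Dom C b = A" "Cod C b = G0"
    and kernel: "is_pullback C p1 p2 f f"
    and omega_type: "\<lbrakk>x \<in> Ar C; y \<in> Ar C; Dom C x = Dom C y; Cod C x = A; Cod C y = A; f \<cdot> x = f \<cdot> y\<rbrakk> \<Longrightarrow>
      \<omega> x y \<in> hom C (Dom C y) G \<and> d \<cdot> \<omega> x y = b \<cdot> x \<and> c \<cdot> \<omega> x y = b \<cdot> y"
    and omega_natural: "\<lbrakk>x \<in> Ar C; y \<in> Ar C; Dom C x = Dom C y; Cod C x = A; Cod C y = A; f \<cdot> x = f \<cdot> y;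
      k \<in> Ar C; Cod C k = Dom C y\<rbrakk> \<Longrightarrow> \<omega> x y \<cdot> k = \<omega> (x \<cdot> k) (y \<cdot> k)"
    and omega_mul: "\<lbrakk>x \<in> Ar C; y \<in> Ar C; z \<in> Ar C; Dom C x = Dom C y; Dom C y = Dom C z;
      Cod C x = A; Cod C y = A; Cod C z = A; f \<cdot> x = f \<cdot> y; f \<cdot> y = f \<cdot> z\<rbrakk> \<Longrightarrow>
      mul (\<omega> x y) (\<omega> y z) = \<omega> x z"
begin

lemma omega_simps:
  assumes "x \<in> Ar C" "y \<in> Ar C" "Dom C x = Dom C y" "Cod C x = A" "Cod C y = A" "f \<cdot> x = f \<cdot> y"
  shows "\<omega> x y \<in> Ar C" "Dom C (\<omega> x y) = Dom C y" "Cod C (\<omega> x y) = G"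
    "d \<cdot> \<omega> x y = b \<cdot> x" "c \<cdot> \<omega> x y = b \<cdot> y"
    "k \<in> Ar C \<Longrightarrow> Cod C k = Dom C y \<Longrightarrow> \<omega> x y \<cdot> k = \<omega> (x \<cdot> k) (y \<cdot> k)"
  using omega_type[OF assms] omega_natural[OF assms] by simp_all

lemma f_simps: "f \<in> Ar C" "A \<in> Ob C" "B \<in> Ob C"
  using f by auto

lemma omega_mul_assoc:
  assumes "x \<in> Ar C" "y \<in> Ar C" "z \<in> Ar C" "Dom C x = Dom C y" "Dom C y = Dom C z"
    "Cod C x = A" "Cod C y = A" "Cod C z = A" "f \<cdot> x = f \<cdot> y" "f \<cdot> y = f \<cdot> z"
    "v \<in> Ar C" "Dom C v = Dom C z" "Cod C v = G" "b \<cdot> z = d \<cdot> v"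
  shows "mul (\<omega> x y) (mul (\<omega> y z) v) = mul (\<omega> x z) v"
  using assms mul_assoc[of "\<omega> x y" "\<omega> y z" v] omega_mul[of x y z] by (simp add: omega_simps)

lemma omega_refl_mul:
  assumes x: "x \<in> Ar C" "Cod C x = A" and v: "v \<in> Ar C" "Dom C v = Dom C x" "Cod C v = G" "b \<cdot> x = d \<cdot> v"
  shows "mul (\<omega> x x) v = v"
proof (rule mul_left_cancel[of "\<omega> x x"])
  show "mul (\<omega> x x) (mul (\<omega> x x) v) = mul (\<omega> x x) v"
    using assms by (intro omega_mul_assoc) simp_all
qed (use assms in \<open>simp_all add: omega_simps mul_simps\<close>)

end

text \<open>The elements of \<open>T\<close> are the pairs \<open>(x, v)\<close> of an element of \<open>A\<close> and an arrow \<open>v\<close> of the groupoid with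
  source \<open>b x\<close>. The quotient of \<open>T\<close> by the relation \<open>(x, \<omega> x y v) \<sim> (y, v)\<close> is the principal bundle
  over \<open>B\<close> classified by the cocycle.\<close>

locale cocycle_pairs = cocycle C G0 G d c i inv mul f b p1 p2 A B \<omega>
  for C :: "('o, 'm) cat" (structure) and G0 G d c i inv mul f b p1 p2 A B \<omega> +
  fixes t1 t2 :: 'm and T :: 'o
  assumes T: "is_pullback C t1 t2 b d" "Dom C t1 = T"
begin

lemma T_simps: "t1 \<in> Ar C" "t2 \<in> Ar C" "Dom C t1 = T" "Dom C t2 = T" "Cod C t1 = A" "Cod C t2 = G"
  "T \<in> Ob C"
  using pullbackD[OF T(1)] T(2) by (auto simp: ar b)

lemma T_comm: "x \<in> Ar C \<Longrightarrow> Cod C x = T \<Longrightarrow> d \<cdot> (t2 \<cdot> x) = b \<cdot> (t1 \<cdot> x)" "d \<cdot> t2 = b \<cdot> t1"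
  using pullback_comm[OF T(1)] T(2) pullbackD(9)[OF T(1)] by simp_all

lemma T_pair:
  assumes "x \<in> Ar C" "v \<in> Ar C" "Dom C x = Dom C v" "Cod C x = A" "Cod C v = G" "b \<cdot> x = d \<cdot> v"
  shows "pair t1 t2 x v \<in> Ar C" "Dom C (pair t1 t2 x v) = Dom C v" "Cod C (pair t1 t2 x v) = T"
    "t1 \<cdot> pair t1 t2 x v = x" "t2 \<cdot> pair t1 t2 x v = v"
    "k \<in> Ar C \<Longrightarrow> Cod C k = Dom C v \<Longrightarrow> pair t1 t2 x v \<cdot> k = pair t1 t2 (x \<cdot> k) (v \<cdot> k)"
  by (subst pair[OF T(1)] pair_comp[OF T(1)]; simp add: ar b assms T)+

lemma T_eqI:
  assumes "t1 \<cdot> u = t1 \<cdot> v" "t2 \<cdot> u = t2 \<cdot> v" "u \<in> Ar C" "v \<in> Ar C" "Dom C u = Dom C v"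
    "Cod C u = T" "Cod C v = T"
  shows "u = v"
  by (rule pullback_eqI[OF T(1) assms(1-5)]) (simp_all add: assms T)

definition related where
  "related x y \<longleftrightarrow> f \<cdot> (t1 \<cdot> x) = f \<cdot> (t1 \<cdot> y) \<and> t2 \<cdot> x = mul (\<omega> (t1 \<cdot> x) (t1 \<cdot> y)) (t2 \<cdot> y)"

text \<open>The relation is represented by the triples \<open>(x, y, v)\<close> with \<open>f x = f y\<close> and \<open>(y, v)\<close> in \<open>T\<close>, where \<open>x\<close>
  and \<open>y\<close> come from the kernel pair of \<open>f\<close>. Symmetry and transitivity are the cocycle identities.\<close>

lemma relation:
  obtains r1 r2 where "equivalence_relation C r1 r2" "r1 \<in> Ar C" "r2 \<in> Ar C" "Dom C r2 = Dom C r1"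
    "Cod C r1 = T" "Cod C r2 = T"
    "\<And>u. \<lbrakk>u \<in> Ar C; Cod C u = Dom C r1\<rbrakk> \<Longrightarrow> related (r1 \<cdot> u) (r2 \<cdot> u)"
    "\<And>x y. \<lbrakk>x \<in> Ar C; y \<in> Ar C; Dom C x = Dom C y; Cod C x = T; Cod C y = T; related x y\<rbrakk> \<Longrightarrow>
      \<exists>u. u \<in> Ar C \<and> Dom C u = Dom C y \<and> Cod C u = Dom C r1 \<and> r1 \<cdot> u = x \<and> r2 \<cdot> u = y"
proof -
  define R where "R = Dom C p1"
  have R: "p1 \<in> Ar C" "p2 \<in> Ar C" "Dom C p1 = R" "Dom C p2 = R" "Cod C p1 = A" "Cod C p2 = A"
    "R \<in> Ob C" "f \<cdot> p1 = f \<cdot> p2"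
    using pullbackD[OF kernel] f by (auto simp: R_def)
  have R_comm: "f \<cdot> (p1 \<cdot> x) = f \<cdot> (p2 \<cdot> x)" if "x \<in> Ar C" "Cod C x = R" for x
    using pullback_comm[OF kernel] that R by simp
  note R_pair = pair[OF kernel, unfolded R(3) f(2)] pair_comp[OF kernel, unfolded R(3) f(2)]
  obtain a1 a2 where E: "is_pullback C a1 a2 (b \<cdot> p2) d"
    using pullback[of "b \<cdot> p2" d] R ar b by auto
  define E0 where "E0 = Dom C a1"
  have E0: "a1 \<in> Ar C" "a2 \<in> Ar C" "Dom C a1 = E0" "Dom C a2 = E0" "Cod C a1 = R" "Cod C a2 = G" "E0 \<in> Ob C"
    using pullbackD[OF E] R ar b by (auto simp: E0_def)
  have E_comm: "d \<cdot> (a2 \<cdot> x) = b \<cdot> (p2 \<cdot> (a1 \<cdot> x))" if "x \<in> Ar C" "Cod C x = E0" for x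
    using pullback_comm[OF E, of x] that R E0 b by simp
  have E_comm1: "d \<cdot> a2 = b \<cdot> (p2 \<cdot> a1)"
    using pullbackD(9)[OF E] R E0 b by simp
  have dbp: "Dom C (b \<cdot> p2) = R" using R b by simp
  note E_pair = pair[OF E, unfolded E0(3) dbp ar] pair_comp[OF E, unfolded E0(3) dbp ar]
  define r1 r2 where "r1 = pair t1 t2 (p1 \<cdot> a1) (mul (\<omega> (p1 \<cdot> a1) (p2 \<cdot> a1)) a2)"
    and "r2 = pair t1 t2 (p2 \<cdot> a1) a2"
  have r1: "r1 \<in> Ar C" "Dom C r1 = E0" "Cod C r1 = T" "t1 \<cdot> r1 = p1 \<cdot> a1"
    "t2 \<cdot> r1 = mul (\<omega> (p1 \<cdot> a1) (p2 \<cdot> a1)) a2"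
    unfolding r1_def r2_def
    by (subst T_pair; simp add: E0 R mul_simps omega_simps R_comm E_comm1)+
  have r2: "r2 \<in> Ar C" "Dom C r2 = E0" "Cod C r2 = T" "t1 \<cdot> r2 = p2 \<cdot> a1" "t2 \<cdot> r2 = a2"
    unfolding r1_def r2_def by (subst T_pair; simp add: E0 R E_comm1)+
  have r1_el: "t1 \<cdot> (r1 \<cdot> x) = p1 \<cdot> (a1 \<cdot> x)"
      "t2 \<cdot> (r1 \<cdot> x) = mul (\<omega> (p1 \<cdot> (a1 \<cdot> x)) (p2 \<cdot> (a1 \<cdot> x))) (a2 \<cdot> x)"
    and r2_el: "t1 \<cdot> (r2 \<cdot> x) = p2 \<cdot> (a1 \<cdot> x)" "t2 \<cdot> (r2 \<cdot> x) = a2 \<cdot> x"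
    if "x \<in> Ar C" "Cod C x = E0" for x
    using that r1(4,5)[THEN comp_left_cong, of x] r2(4,5)[THEN comp_left_cong, of x]
    by (simp_all add: r1(1-3) r2(1-3) T_simps E0 R mul_simps omega_simps R_comm E_comm1)
  have rel: "related (r1 \<cdot> u) (r2 \<cdot> u)" if "u \<in> Ar C" "Cod C u = E0" for u
    using that by (simp add: related_def r1_el r2_el R_comm E0)
  have ex: "\<exists>u. u \<in> Ar C \<and> Dom C u = Dom C y \<and> Cod C u = E0 \<and> r1 \<cdot> u = x \<and> r2 \<cdot> u = y"
    if xy: "x \<in> Ar C" "y \<in> Ar C" "Dom C x = Dom C y" "Cod C x = T" "Cod C y = T" "related x y" for x y
  proof -
    have fxy: "f \<cdot> (t1 \<cdot> x) = f \<cdot> (t1 \<cdot> y)" "t2 \<cdot> x = mul (\<omega> (t1 \<cdot> x) (t1 \<cdot> y)) (t2 \<cdot> y)"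
      using xy(6) by (simp_all add: related_def)
    define k where "k = pair p1 p2 (t1 \<cdot> x) (t1 \<cdot> y)"
    have k: "k \<in> Ar C" "Dom C k = Dom C y" "Cod C k = R" "p1 \<cdot> k = t1 \<cdot> x" "p2 \<cdot> k = t1 \<cdot> y"
      unfolding k_def by (subst R_pair; simp add: xy T_simps fxy)+
    define u where "u = pair a1 a2 k (t2 \<cdot> y)"
    have u: "u \<in> Ar C" "Dom C u = Dom C y" "Cod C u = E0" "a1 \<cdot> u = k" "a2 \<cdot> u = t2 \<cdot> y"
      unfolding u_def by (subst E_pair; simp add: xy T_simps k R b T_comm)+
    have "r1 \<cdot> u = x"
      by (rule T_eqI) (simp_all add: r1_el u k xy r1 fxy(2)[symmetric])
    moreover have "r2 \<cdot> u = y"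
      by (rule T_eqI) (simp_all add: r2_el u k xy r2)
    ultimately show ?thesis using u by auto
  qed
  have "equivalence_relation C r1 r2"
  proof (rule equivalence_relationI)
    fix u v
    assume "u \<in> Ar C" "v \<in> Ar C" "Dom C u = Dom C v" "Cod C u = Dom C r1" "Cod C v = Dom C r1"
      and eq: "r1 \<cdot> u = r1 \<cdot> v" "r2 \<cdot> u = r2 \<cdot> v"
    then have uv: "u \<in> Ar C" "v \<in> Ar C" "Dom C u = Dom C v" "Cod C u = E0" "Cod C v = E0"
      using r1 by simp_all
    have "p1 \<cdot> (a1 \<cdot> u) = p1 \<cdot> (a1 \<cdot> v)" "p2 \<cdot> (a1 \<cdot> u) = p2 \<cdot> (a1 \<cdot> v)" "a2 \<cdot> u = a2 \<cdot> v"
      using r1_el(1) r2_el eq uv by metis+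
    moreover from this have "a1 \<cdot> u = a1 \<cdot> v"
      using uv by - (rule pullback_eqI[OF kernel]; simp add: E0 R)
    ultimately show "u = v"
      using uv by - (rule pullback_eqI[OF E]; simp add: E0)
  next
    fix a assume a: "a \<in> Ar C" "Cod C a = Cod C r1"
    have "related a a"
      using a r1 omega_refl_mul[of "t1 \<cdot> a" "t2 \<cdot> a"] by (simp add: related_def T_simps T_comm)
    then show "\<exists>u. u \<in> Ar C \<and> Dom C u = Dom C a \<and> Cod C u = Dom C r1 \<and> r1 \<cdot> u = a \<and> r2 \<cdot> u = a"
      using ex[of a a] a r1 by simp
  next
    fix u assume u: "u \<in> Ar C" "Cod C u = Dom C r1"
    have "mul (\<omega> (p2 \<cdot> (a1 \<cdot> u)) (p1 \<cdot> (a1 \<cdot> u)))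
        (mul (\<omega> (p1 \<cdot> (a1 \<cdot> u)) (p2 \<cdot> (a1 \<cdot> u))) (a2 \<cdot> u)) = a2 \<cdot> u"
      using u r1 omega_refl_mul[of "p2 \<cdot> (a1 \<cdot> u)" "a2 \<cdot> u"]
      by (subst omega_mul_assoc) (simp_all add: E0 R R_comm E_comm)
    then have "related (r2 \<cdot> u) (r1 \<cdot> u)"
      using u r1 by (simp add: related_def r1_el r2_el R_comm E0)
    then show "\<exists>v. v \<in> Ar C \<and> Dom C v = Dom C u \<and> Cod C v = Dom C r1 \<and> r1 \<cdot> v = r2 \<cdot> u \<and> r2 \<cdot> v = r1 \<cdot> u"
      using ex[of "r2 \<cdot> u" "r1 \<cdot> u"] u r1 r2 by simp
  next
    fix u v
    assume "u \<in> Ar C" "v \<in> Ar C" "Dom C u = Dom C v" "Cod C u = Dom C r1" "Cod C v = Dom C r1"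
      and eq: "r2 \<cdot> u = r1 \<cdot> v"
    then have uv: "u \<in> Ar C" "v \<in> Ar C" "Dom C u = Dom C v" "Cod C u = E0" "Cod C v = E0"
      using r1 by simp_all
    have *: "p2 \<cdot> (a1 \<cdot> u) = p1 \<cdot> (a1 \<cdot> v)"
      "a2 \<cdot> u = mul (\<omega> (p1 \<cdot> (a1 \<cdot> v)) (p2 \<cdot> (a1 \<cdot> v))) (a2 \<cdot> v)"
      using arg_cong[OF eq, of "\<lambda>z. t1 \<cdot> z"] arg_cong[OF eq, of "\<lambda>z. t2 \<cdot> z"] uv
      by (simp_all add: r1_el r2_el)
    have f1: "f \<cdot> (p1 \<cdot> (a1 \<cdot> u)) = f \<cdot> (p1 \<cdot> (a1 \<cdot> v))"
      using R_comm[of "a1 \<cdot> u"] uv * by (simp add: E0)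
    have "mul (\<omega> (p1 \<cdot> (a1 \<cdot> u)) (p1 \<cdot> (a1 \<cdot> v)))
        (mul (\<omega> (p1 \<cdot> (a1 \<cdot> v)) (p2 \<cdot> (a1 \<cdot> v))) (a2 \<cdot> v)) =
      mul (\<omega> (p1 \<cdot> (a1 \<cdot> u)) (p2 \<cdot> (a1 \<cdot> v))) (a2 \<cdot> v)"
      using uv f1 by (intro omega_mul_assoc) (simp_all add: E0 R R_comm E_comm)
    then have "related (r1 \<cdot> u) (r2 \<cdot> v)"
      using uv f1 * by (simp add: related_def r1_el r2_el R_comm E0)
    then show "\<exists>t. t \<in> Ar C \<and> Dom C t = Dom C u \<and> Cod C t = Dom C r1 \<and> r1 \<cdot> t = r1 \<cdot> u \<and> r2 \<cdot> t = r2 \<cdot> v"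
      using ex[of "r1 \<cdot> u" "r2 \<cdot> v"] uv r1 r2 by simp
  qed (simp_all add: r1 r2)
  then show ?thesis
    using that[of r1 r2] r1 r2 rel ex by simp
qed

lemma quotient:
  obtains q where "regular_epi C q" "Dom C q = T"
    "\<And>x y. \<lbrakk>x \<in> Ar C; y \<in> Ar C; Dom C x = Dom C y; Cod C x = T; Cod C y = T\<rbrakk> \<Longrightarrow>
      q \<cdot> x = q \<cdot> y \<longleftrightarrow> related x y"
proof -
  obtain r1 r2 where r: "equivalence_relation C r1 r2" "r1 \<in> Ar C" "r2 \<in> Ar C" "Dom C r2 = Dom C r1"
    "Cod C r1 = T" "Cod C r2 = T"
    and rel: "\<And>u. \<lbrakk>u \<in> Ar C; Cod C u = Dom C r1\<rbrakk> \<Longrightarrow> related (r1 \<cdot> u) (r2 \<cdot> u)"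
    and ex: "\<And>x y. \<lbrakk>x \<in> Ar C; y \<in> Ar C; Dom C x = Dom C y; Cod C x = T; Cod C y = T; related x y\<rbrakk> \<Longrightarrow>
      \<exists>u. u \<in> Ar C \<and> Dom C u = Dom C y \<and> Cod C u = Dom C r1 \<and> r1 \<cdot> u = x \<and> r2 \<cdot> u = y"
    by (rule relation; rule that; assumption)
  obtain q where q: "regular_epi C q" "Dom C q = Cod C r1" "q \<cdot> r1 = q \<cdot> r2"
    and qk: "\<And>a b. \<lbrakk>a \<in> Ar C; b \<in> Ar C; Dom C a = Dom C b; Cod C a = Cod C r1; Cod C b = Cod C r1; q \<cdot> a = q \<cdot> b\<rbrakk> \<Longrightarrow>
      \<exists>u. u \<in> Ar C \<and> Dom C u = Dom C b \<and> Cod C u = Dom C r1 \<and> r1 \<cdot> u = a \<and> r2 \<cdot> u = b"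
    by (rule exact_quotient[OF exact r(1)]; rule that; assumption)
  have qA: "q \<in> Ar C" using q by simp
  show ?thesis
  proof (rule that[of q])
    fix x y assume xy: "x \<in> Ar C" "y \<in> Ar C" "Dom C x = Dom C y" "Cod C x = T" "Cod C y = T"
    show "q \<cdot> x = q \<cdot> y \<longleftrightarrow> related x y"
    proof
      assume "q \<cdot> x = q \<cdot> y"
      then show "related x y" using qk[of x y] xy r rel by metis
    next
      assume "related x y"
      then obtain u where u: "u \<in> Ar C" "Dom C u = Dom C y" "Cod C u = Dom C r1" "r1 \<cdot> u = x" "r2 \<cdot> u = y"
        using ex[OF xy] by blast
      have "q \<cdot> (r1 \<cdot> u) = q \<cdot> (r2 \<cdot> u)"
        using comp_left_cong[OF q(3), of u] u(1-3) r(2-6) q(2) qA by simp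
      then show "q \<cdot> x = q \<cdot> y" by (simp add: u(4,5))
    qed
  qed (use q r in simp_all)
qed

end

text \<open>The arrow \<open>fbar\<close> below is the projection of the bundle to \<open>B\<close>, and \<open>cbar\<close> sends the class of
  \<open>(x, v)\<close> to the target of \<open>v\<close>.\<close>

locale cocycle_quotient = cocycle_pairs C G0 G d c i inv mul f b p1 p2 A B \<omega> t1 t2 T
  for C :: "('o, 'm) cat" (structure) and G0 G d c i inv mul f b p1 p2 A B \<omega> t1 t2 T +
  fixes q :: 'm and Q :: 'o
  assumes q: "regular_epi C q" "Dom C q = T" "Cod C q = Q"
    and q_kernel: "\<And>x y. \<lbrakk>x \<in> Ar C; y \<in> Ar C; Dom C x = Dom C y; Cod C x = T; Cod C y = T\<rbrakk> \<Longrightarrow>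
      q \<cdot> x = q \<cdot> y \<longleftrightarrow> related x y"
begin

lemma q_simps: "q \<in> Ar C" "Q \<in> Ob C"
  using q by auto

lemma q_eqD:
  assumes "q \<cdot> x = q \<cdot> y" "x \<in> Ar C" "y \<in> Ar C" "Dom C x = Dom C y" "Cod C x = T" "Cod C y = T"
  shows "f \<cdot> (t1 \<cdot> x) = f \<cdot> (t1 \<cdot> y)" "t2 \<cdot> x = mul (\<omega> (t1 \<cdot> x) (t1 \<cdot> y)) (t2 \<cdot> y)"
  using assms q_kernel[of x y] by (simp_all add: related_def)

definition descended where
  "descended h = (SOME w. w \<in> Ar C \<and> Dom C w = Q \<and> Cod C w = Cod C h \<and> w \<cdot> q = h)"

lemma descended:
  assumes "h \<in> Ar C" "Dom C h = T"
    and "\<And>x y. \<lbrakk>x \<in> Ar C; y \<in> Ar C; Dom C x = Dom C y; Cod C x = T; Cod C y = T;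
      f \<cdot> (t1 \<cdot> x) = f \<cdot> (t1 \<cdot> y); t2 \<cdot> x = mul (\<omega> (t1 \<cdot> x) (t1 \<cdot> y)) (t2 \<cdot> y)\<rbrakk> \<Longrightarrow> h \<cdot> x = h \<cdot> y"
  shows "descended h \<in> Ar C" "Dom C (descended h) = Q" "Cod C (descended h) = Cod C h" "descended h \<cdot> q = h"
proof -
  obtain w where "w \<in> Ar C" "Dom C w = Q" "Cod C w = Cod C h" "w \<cdot> q = h"
    using regular_epi_descend[OF q(1) assms(1)] assms(2,3) q(2,3) q_eqD by metis
  then have "\<exists>w. w \<in> Ar C \<and> Dom C w = Q \<and> Cod C w = Cod C h \<and> w \<cdot> q = h" by blast
  then have "descended h \<in> Ar C \<and> Dom C (descended h) = Q \<and> Cod C (descended h) = Cod C h \<and> descended h \<cdot> q = h"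
    unfolding descended_def by (rule someI_ex)
  then show "descended h \<in> Ar C" "Dom C (descended h) = Q" "Cod C (descended h) = Cod C h"
    "descended h \<cdot> q = h" by simp_all
qed

definition fbar where "fbar = descended (f \<cdot> t1)"
definition cbar where "cbar = descended (c \<cdot> t2)"

lemma fbar: "fbar \<in> Ar C" "Dom C fbar = Q" "Cod C fbar = B" "fbar \<cdot> q = f \<cdot> t1"
  using descended[of "f \<cdot> t1"] unfolding fbar_def by (simp_all add: f_simps f T_simps)

lemma cbar: "cbar \<in> Ar C" "Dom C cbar = Q" "Cod C cbar = G0" "cbar \<cdot> q = c \<cdot> t2"
proof -
  have "(c \<cdot> t2) \<cdot> x = (c \<cdot> t2) \<cdot> y"
    if "x \<in> Ar C" "y \<in> Ar C" "Dom C x = Dom C y" "Cod C x = T" "Cod C y = T"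
      "f \<cdot> (t1 \<cdot> x) = f \<cdot> (t1 \<cdot> y)" "t2 \<cdot> x = mul (\<omega> (t1 \<cdot> x) (t1 \<cdot> y)) (t2 \<cdot> y)" for x y
    using that by (simp add: ar T_simps mul_simps omega_simps T_comm)
  then show "cbar \<in> Ar C" "Dom C cbar = Q" "Cod C cbar = G0" "cbar \<cdot> q = c \<cdot> t2"
    using descended[of "c \<cdot> t2"] unfolding cbar_def by (simp_all add: ar T_simps)
qed

lemma bar_el:
  assumes "x \<in> Ar C" "Cod C x = T"
  shows "fbar \<cdot> (q \<cdot> x) = f \<cdot> (t1 \<cdot> x)" "cbar \<cdot> (q \<cdot> x) = c \<cdot> (t2 \<cdot> x)"
  using fbar(4)[THEN comp_left_cong, of x] cbar(4)[THEN comp_left_cong, of x] assms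
  by (simp_all add: fbar(1-3) cbar(1-3) q q_simps f_simps f T_simps ar)

lemma fbar_regular_epi: "regular_epi C fbar"
proof (rule regular_epi_right_factor[of fbar q])
  have "regular_epi C t1"
  proof (rule split_epi_regular)
    show "t1 \<cdot> pair t1 t2 (Id C A) (i \<cdot> b) = Id C (Cod C t1)"
      by (simp add: T_pair T_simps f_simps b ar graph_el)
  qed (simp_all add: T_pair T_simps f_simps b ar graph_el)
  then show "regular_epi C (fbar \<cdot> q)"
    unfolding fbar(4) by (rule regular_epi_comp[OF _ f(1)]) (simp add: T_simps f)
qed (simp_all add: fbar q q_simps)

end

text \<open>The groupoid acts on the bundle from the right, with anchor \<open>cbar\<close>; \<open>Z\<close> consists of the pairs
  on which the action is defined.\<close>

locale cocycle_action = cocycle_quotient C G0 G d c i inv mul f b p1 p2 A B \<omega> t1 t2 T q Q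
  for C :: "('o, 'm) cat" (structure) and G0 G d c i inv mul f b p1 p2 A B \<omega> t1 t2 T q Q +
  fixes z1 z2 :: 'm and Z :: 'o
  assumes Z: "is_pullback C z1 z2 cbar d" "Dom C z1 = Z"
begin

lemma Z_simps: "z1 \<in> Ar C" "z2 \<in> Ar C" "Dom C z1 = Z" "Dom C z2 = Z" "Cod C z1 = Q" "Cod C z2 = G"
  "Z \<in> Ob C"
  using pullbackD[OF Z(1)] Z(2) by (auto simp: ar cbar)

lemma Z_comm: "x \<in> Ar C \<Longrightarrow> Cod C x = Z \<Longrightarrow> d \<cdot> (z2 \<cdot> x) = cbar \<cdot> (z1 \<cdot> x)"
  using pullback_comm[OF Z(1)] Z(2) by simp_all

lemma Z_pair:
  assumes "x \<in> Ar C" "v \<in> Ar C" "Dom C x = Dom C v" "Cod C x = Q" "Cod C v = G" "cbar \<cdot> x = d \<cdot> v"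
  shows "pair z1 z2 x v \<in> Ar C" "Dom C (pair z1 z2 x v) = Dom C v" "Cod C (pair z1 z2 x v) = Z"
    "z1 \<cdot> pair z1 z2 x v = x" "z2 \<cdot> pair z1 z2 x v = v"
    "k \<in> Ar C \<Longrightarrow> Cod C k = Dom C v \<Longrightarrow> pair z1 z2 x v \<cdot> k = pair z1 z2 (x \<cdot> k) (v \<cdot> k)"
  by (subst pair[OF Z(1)] pair_comp[OF Z(1)]; simp add: ar cbar assms Z)+

text \<open>Multiplication from the right in the second component, \<open>(x, v) v' = (x, v v')\<close>, respects the relation
  on \<open>T\<close> by associativity, so it descends from the pullback of \<open>Z\<close> along \<open>q\<close>.\<close>

lemma action:
  obtains \<alpha> where "\<alpha> \<in> Ar C" "Dom C \<alpha> = Z" "Cod C \<alpha> = Q"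
    "\<And>s x. \<lbrakk>s \<in> Ar C; x \<in> Ar C; Dom C s = Dom C x; Cod C s = Z; Cod C x = T; z1 \<cdot> s = q \<cdot> x\<rbrakk> \<Longrightarrow>
      \<alpha> \<cdot> s = q \<cdot> pair t1 t2 (t1 \<cdot> x) (mul (t2 \<cdot> x) (z2 \<cdot> s))"
proof -
  obtain e t where et: "is_pullback C e t z1 q"
    using pullback[of z1 q] Z_simps q q_simps by auto
  have e_reg: "regular_epi C e" by (rule regular_epi_pullback[OF et q(1)])
  define S where "S = Dom C e"
  have S: "e \<in> Ar C" "t \<in> Ar C" "Dom C e = S" "Dom C t = S" "Cod C e = Z" "Cod C t = T" "S \<in> Ob C"
    using pullbackD[OF et] Z_simps q by (auto simp: S_def)
  have comm: "z1 \<cdot> (e \<cdot> x) = q \<cdot> (t \<cdot> x)" if "x \<in> Ar C" "Cod C x = S" for x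
    using pullback_comm[OF et, of x] that S by simp
  have dz: "d \<cdot> (z2 \<cdot> (e \<cdot> x)) = c \<cdot> (t2 \<cdot> (t \<cdot> x))" if "x \<in> Ar C" "Cod C x = S" for x
    using that by (simp add: Z_comm S comm bar_el)
  have dz1: "d \<cdot> (z2 \<cdot> e) = c \<cdot> (t2 \<cdot> t)"
    using dz[of "Id C S"] S by simp
  define h where "h = q \<cdot> pair t1 t2 (t1 \<cdot> t) (mul (t2 \<cdot> t) (z2 \<cdot> e))"
  have h: "h \<in> Ar C" "Dom C h = S" "Cod C h = Q"
    unfolding h_def
    by (simp_all add: q q_simps T_pair T_simps S Z_simps mul_simps dz1 T_comm)
  have h_el: "h \<cdot> x = q \<cdot> pair t1 t2 (t1 \<cdot> (t \<cdot> x)) (mul (t2 \<cdot> (t \<cdot> x)) (z2 \<cdot> (e \<cdot> x)))"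
    if "x \<in> Ar C" "Cod C x = S" for x
    unfolding h_def using that
    by (simp add: q q_simps T_pair T_simps S Z_simps mul_simps dz dz1 T_comm)
  obtain \<alpha> where a: "\<alpha> \<in> Ar C" "Dom C \<alpha> = Z" "Cod C \<alpha> = Q" "\<alpha> \<cdot> e = h"
  proof (rule regular_epi_descend[OF e_reg h(1)])
    fix u v
    assume "u \<in> Ar C" "v \<in> Ar C" "Dom C v = Dom C u" "Cod C u = Dom C e" "Cod C v = Dom C e"
      and eq: "e \<cdot> u = e \<cdot> v"
    then have uv: "u \<in> Ar C" "v \<in> Ar C" "Dom C v = Dom C u" "Cod C u = S" "Cod C v = S"
      using S by simp_all
    have pr: "t1 \<cdot> pair t1 t2 (t1 \<cdot> (t \<cdot> z)) (mul (t2 \<cdot> (t \<cdot> z)) (z2 \<cdot> (e \<cdot> z))) = t1 \<cdot> (t \<cdot> z)"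
      "t2 \<cdot> pair t1 t2 (t1 \<cdot> (t \<cdot> z)) (mul (t2 \<cdot> (t \<cdot> z)) (z2 \<cdot> (e \<cdot> z))) = mul (t2 \<cdot> (t \<cdot> z)) (z2 \<cdot> (e \<cdot> z))"
      if "z \<in> Ar C" "Cod C z = S" for z
      using that by (simp_all add: T_pair T_simps S Z_simps mul_simps dz T_comm)
    have "q \<cdot> (t \<cdot> u) = q \<cdot> (t \<cdot> v)"
      using comm[of u] comm[of v] uv eq by simp
    from q_eqD[OF this] uv
    have k: "f \<cdot> (t1 \<cdot> (t \<cdot> u)) = f \<cdot> (t1 \<cdot> (t \<cdot> v))"
      "t2 \<cdot> (t \<cdot> u) = mul (\<omega> (t1 \<cdot> (t \<cdot> u)) (t1 \<cdot> (t \<cdot> v))) (t2 \<cdot> (t \<cdot> v))"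
      by (simp_all add: S)
    have "mul (t2 \<cdot> (t \<cdot> u)) (z2 \<cdot> (e \<cdot> u)) =
        mul (\<omega> (t1 \<cdot> (t \<cdot> u)) (t1 \<cdot> (t \<cdot> v))) (mul (t2 \<cdot> (t \<cdot> v)) (z2 \<cdot> (e \<cdot> v)))"
      unfolding k(2) eq using uv k(1)
      by (intro mul_assoc) (simp_all add: omega_simps T_simps S Z_simps dz T_comm)
    then have "related (pair t1 t2 (t1 \<cdot> (t \<cdot> u)) (mul (t2 \<cdot> (t \<cdot> u)) (z2 \<cdot> (e \<cdot> u))))
        (pair t1 t2 (t1 \<cdot> (t \<cdot> v)) (mul (t2 \<cdot> (t \<cdot> v)) (z2 \<cdot> (e \<cdot> v))))"
      using k(1) unfolding related_def pr[OF uv(1,4)] pr[OF uv(2,5)] by blast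
    then show "h \<cdot> u = h \<cdot> v"
      using uv by (simp add: h_el q_kernel T_pair T_simps S Z_simps mul_simps dz T_comm)
  qed (simp_all add: h S)
  have "\<alpha> \<cdot> s = q \<cdot> pair t1 t2 (t1 \<cdot> x) (mul (t2 \<cdot> x) (z2 \<cdot> s))"
    if sx: "s \<in> Ar C" "x \<in> Ar C" "Dom C s = Dom C x" "Cod C s = Z" "Cod C x = T" "z1 \<cdot> s = q \<cdot> x" for s x
  proof -
    define u where "u = pair e t s x"
    have u: "u \<in> Ar C" "Dom C u = Dom C x" "Cod C u = S" "e \<cdot> u = s" "t \<cdot> u = x"
      unfolding u_def by (subst pair[OF et]; simp add: sx Z_simps q S)+
    have "\<alpha> \<cdot> (e \<cdot> u) = h \<cdot> u"
      by (rule comp_left_cong[OF a(4)]) (simp_all add: a S u)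
    then show ?thesis using h_el[of u] u by simp
  qed
  with a(1-3) show ?thesis by (intro that)
qed

text \<open>The bundle is principal: two of its elements over the same element of \<open>B\<close> differ by a unique
  arrow of the groupoid. Existence is shown on a cover \<open>e\<close> on which both elements have
  representatives \<open>x\<close> and \<open>y\<close>; the arrow \<open>k\<close> found there solves \<open>t2 x \<cdot> k = \<omega> (t1 x) (t1 y) \<cdot> t2 y\<close> in the
  groupoid, and it descends along \<open>e\<close> because the solution does not depend on the representatives.\<close>

lemma kernel_pair_fbar:
  assumes \<alpha>: "\<alpha> \<in> Ar C" "Dom C \<alpha> = Z" "Cod C \<alpha> = Q"
    and act: "\<And>s x. \<lbrakk>s \<in> Ar C; x \<in> Ar C; Dom C s = Dom C x; Cod C s = Z; Cod C x = T; z1 \<cdot> s = q \<cdot> x\<rbrakk> \<Longrightarrow>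
      \<alpha> \<cdot> s = q \<cdot> pair t1 t2 (t1 \<cdot> x) (mul (t2 \<cdot> x) (z2 \<cdot> s))"
  shows "is_pullback C z1 \<alpha> fbar fbar"
proof (rule pullbackI)
  have dz: "d \<cdot> (z2 \<cdot> s) = c \<cdot> (t2 \<cdot> x)"
    if "s \<in> Ar C" "x \<in> Ar C" "Cod C s = Z" "Cod C x = T" "z1 \<cdot> s = q \<cdot> x" for s x
    using that by (simp add: Z_comm bar_el)
  obtain e x where ex: "regular_epi C e" "e \<in> Ar C" "Cod C e = Z" "x \<in> Ar C" "Dom C x = Dom C e"
    "Cod C x = T" "q \<cdot> x = z1 \<cdot> e"
    using regular_epi_lift[OF q(1), of z1] Z_simps q by metis
  show "fbar \<cdot> z1 = fbar \<cdot> \<alpha>"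
  proof (rule regular_epi_cancel[OF ex(1)])
    have "fbar \<cdot> (\<alpha> \<cdot> e) = f \<cdot> (t1 \<cdot> x)"
      using act[of e x] ex dz[of e x]
      by (simp add: bar_el T_pair mul_simps T_simps Z_simps T_comm)
    moreover have "fbar \<cdot> (z1 \<cdot> e) = f \<cdot> (t1 \<cdot> x)"
      using ex(7)[symmetric] ex(1-6) by (simp add: bar_el)
    ultimately show "(fbar \<cdot> z1) \<cdot> e = (fbar \<cdot> \<alpha>) \<cdot> e"
      using ex \<alpha> by (simp add: fbar Z_simps)
  qed (simp_all add: fbar Z_simps \<alpha> ex)
  fix u v
  assume "u \<in> Ar C" "v \<in> Ar C" "Dom C v = Dom C u"
  note uv = this
  {
    assume "Cod C u = Dom C fbar" "Cod C v = Dom C fbar" and eq: "fbar \<cdot> u = fbar \<cdot> v"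
    then have c: "Cod C u = Q" "Cod C v = Q" by (simp_all add: fbar)
    obtain e1 x1 where e1: "regular_epi C e1" "e1 \<in> Ar C" "Cod C e1 = Dom C u" "x1 \<in> Ar C" "Dom C x1 = Dom C e1"
      "Cod C x1 = T" "q \<cdot> x1 = u \<cdot> e1"
      using regular_epi_lift[OF q(1), of u] uv c q by metis
    obtain e2 y where e2: "regular_epi C e2" "e2 \<in> Ar C" "Cod C e2 = Dom C e1" "y \<in> Ar C" "Dom C y = Dom C e2"
      "Cod C y = T" "q \<cdot> y = (v \<cdot> e1) \<cdot> e2"
      using regular_epi_lift[OF q(1), of "v \<cdot> e1"] uv c q e1 by auto
    define e x where "e = e1 \<cdot> e2" and "x = x1 \<cdot> e2"
    have e: "regular_epi C e" "e \<in> Ar C" "Cod C e = Dom C u"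
      using regular_epi_comp[OF e2(1) e1(1)] e1 e2 by (simp_all add: e_def)
    have x: "x \<in> Ar C" "Dom C x = Dom C e" "Cod C x = T" "q \<cdot> x = u \<cdot> e"
      using e1 e2 uv c comp_left_cong[OF e1(7), of e2] by (simp_all add: x_def e_def q q_simps)
    have y: "y \<in> Ar C" "Dom C y = Dom C e" "Cod C y = T" "q \<cdot> y = v \<cdot> e"
      using e1 e2 uv c by (simp_all add: e_def)
    have fxy: "f \<cdot> (t1 \<cdot> x) = f \<cdot> (t1 \<cdot> y)"
      using bar_el(1)[OF x(1,3)] bar_el(1)[OF y(1,3)] x(4) y(4) comp_left_cong[OF eq, of e] uv c e
      by (simp add: fbar)
    have fxy': "f \<cdot> (t1 \<cdot> (x \<cdot> z)) = f \<cdot> (t1 \<cdot> (y \<cdot> z))" if "z \<in> Ar C" "Cod C z = Dom C e" for z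
      using comp_left_cong[OF fxy, of z] that x(1-3) y(1-3) by (simp add: f_simps f T_simps)
    \<comment> \<open>The element \<open>v\<close> is also represented by \<open>(t1 \<cdot> x, g)\<close>,
      which has the same first component as \<open>x\<close>.\<close>
    define g where "g = mul (\<omega> (t1 \<cdot> x) (t1 \<cdot> y)) (t2 \<cdot> y)"
    have g: "g \<in> Ar C" "Dom C g = Dom C e" "Cod C g = G" "d \<cdot> g = d \<cdot> (t2 \<cdot> x)" "c \<cdot> g = c \<cdot> (t2 \<cdot> y)"
      "z \<in> Ar C \<Longrightarrow> Cod C z = Dom C e \<Longrightarrow>
        g \<cdot> z = mul (\<omega> (t1 \<cdot> (x \<cdot> z)) (t1 \<cdot> (y \<cdot> z))) (t2 \<cdot> (y \<cdot> z))" for z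
      unfolding g_def using x(1-3) y(1-3) fxy
      by (simp_all add: mul_simps omega_simps T_simps T_comm)
    define k where "k = mul (inv \<cdot> (t2 \<cdot> x)) g"
    have k: "k \<in> Ar C" "Dom C k = Dom C e" "Cod C k = G" "d \<cdot> k = c \<cdot> (t2 \<cdot> x)" "c \<cdot> k = c \<cdot> (t2 \<cdot> y)"
      unfolding k_def using x(1-3) y(1-3) g(1-5)
      by (simp_all add: mul_simps T_simps ar graph_el)
    \<comment> \<open>Unlike the formula for \<open>k\<close>, this equation makes independence of the
      representatives a matter of cancellation.\<close>
    have xk: "mul (t2 \<cdot> x) k = g"
    proof -
      have "mul (t2 \<cdot> x) k = mul (mul (t2 \<cdot> x) (inv \<cdot> (t2 \<cdot> x))) g"
        unfolding k_def using x(1-3) g(1-5)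
        by (intro mul_assoc[symmetric]) (simp_all add: T_simps ar graph_el)
      also have "\<dots> = mul (i \<cdot> (d \<cdot> g)) g"
        using x(1-3) g(1-4) by (simp add: mul_inv T_simps)
      also have "\<dots> = g" using g(1-3) by (simp add: mul_unit)
      finally show ?thesis .
    qed
    obtain k' where k': "k' \<in> Ar C" "Dom C k' = Dom C u" "Cod C k' = G" "k' \<cdot> e = k"
    proof (rule regular_epi_descend[OF e(1) k(1)])
      fix r s
      assume rs: "r \<in> Ar C" "s \<in> Ar C" "Dom C s = Dom C r" "Cod C r = Dom C e" "Cod C s = Dom C e"
        and ers: "e \<cdot> r = e \<cdot> s"
      have "q \<cdot> (x \<cdot> r) = q \<cdot> (x \<cdot> s)" "q \<cdot> (y \<cdot> r) = q \<cdot> (y \<cdot> s)"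
        using comp_left_cong[OF x(4), of r] comp_left_cong[OF x(4), of s] ers
          comp_left_cong[OF y(4), of r] comp_left_cong[OF y(4), of s] rs x(1-3) y(1-3) e uv c
        by (simp_all add: q q_simps)
      from q_eqD[OF this(1)] q_eqD[OF this(2)] rs x(1-3) y(1-3)
      have fr: "f \<cdot> (t1 \<cdot> (x \<cdot> r)) = f \<cdot> (t1 \<cdot> (x \<cdot> s))" "f \<cdot> (t1 \<cdot> (y \<cdot> r)) = f \<cdot> (t1 \<cdot> (y \<cdot> s))"
        and tr: "t2 \<cdot> (x \<cdot> r) = mul (\<omega> (t1 \<cdot> (x \<cdot> r)) (t1 \<cdot> (x \<cdot> s))) (t2 \<cdot> (x \<cdot> s))"
        "t2 \<cdot> (y \<cdot> r) = mul (\<omega> (t1 \<cdot> (y \<cdot> r)) (t1 \<cdot> (y \<cdot> s))) (t2 \<cdot> (y \<cdot> s))"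
        by simp_all
      note A = rs x(1-3) y(1-3)
      have xk_r: "mul (t2 \<cdot> (x \<cdot> z)) (k \<cdot> z) = g \<cdot> z" if "z \<in> Ar C" "Cod C z = Dom C e" for z
        using arg_cong[OF xk, of "\<lambda>a. a \<cdot> z"] that x(1-3) k by (simp add: mul_simps T_simps)
      have dk: "d \<cdot> (k \<cdot> z) = c \<cdot> (t2 \<cdot> (x \<cdot> z))" if "z \<in> Ar C" "Cod C z = Dom C e" for z
        using comp_left_cong[OF k(4), of z] that k x(1-3) by (simp add: ar T_simps)
      let ?w = "\<omega> (t1 \<cdot> (x \<cdot> r)) (t1 \<cdot> (x \<cdot> s))"
      have ct: "c \<cdot> (t2 \<cdot> (x \<cdot> r)) = c \<cdot> (t2 \<cdot> (x \<cdot> s))"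
        unfolding tr(1) using A fr by (simp add: mul_simps omega_simps T_simps T_comm)
      have "g \<cdot> r = mul (\<omega> (t1 \<cdot> (x \<cdot> r)) (t1 \<cdot> (y \<cdot> r)))
          (mul (\<omega> (t1 \<cdot> (y \<cdot> r)) (t1 \<cdot> (y \<cdot> s))) (t2 \<cdot> (y \<cdot> s)))"
        using A tr(2) by (simp add: g)
      also have "\<dots> = mul (\<omega> (t1 \<cdot> (x \<cdot> r)) (t1 \<cdot> (y \<cdot> s))) (t2 \<cdot> (y \<cdot> s))"
        using A fr fxy' by (intro omega_mul_assoc) (simp_all add: T_simps T_comm)
      also have "\<dots> = mul ?w (mul (\<omega> (t1 \<cdot> (x \<cdot> s)) (t1 \<cdot> (y \<cdot> s))) (t2 \<cdot> (y \<cdot> s)))"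
        using A fr fxy' by (intro omega_mul_assoc[symmetric]) (simp_all add: T_simps T_comm)
      also have "\<dots> = mul ?w (mul (t2 \<cdot> (x \<cdot> s)) (k \<cdot> s))"
        using A by (simp add: xk_r g)
      also have "\<dots> = mul (mul ?w (t2 \<cdot> (x \<cdot> s))) (k \<cdot> s)"
        using A fr k by (intro mul_assoc[symmetric]) (simp_all add: T_simps T_comm omega_simps dk)
      also have "\<dots> = mul (t2 \<cdot> (x \<cdot> r)) (k \<cdot> s)"
        using tr(1) by simp
      finally have eqk: "mul (t2 \<cdot> (x \<cdot> r)) (k \<cdot> r) = mul (t2 \<cdot> (x \<cdot> r)) (k \<cdot> s)"
        using rs by (simp add: xk_r)
      show "k \<cdot> r = k \<cdot> s"
        by (rule mul_left_cancel[OF _ _ _ _ _ _ _ _ _ _ eqk])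
          (use A k ct in \<open>simp_all add: T_simps dk\<close>)
    qed (simp_all add: k e)
    have "cbar \<cdot> u = d \<cdot> k'"
    proof (rule regular_epi_cancel[OF e(1)])
      have "cbar \<cdot> (u \<cdot> e) = c \<cdot> (t2 \<cdot> x)" using x(4)[symmetric] x(1-3) by (simp add: bar_el)
      then show "(cbar \<cdot> u) \<cdot> e = (d \<cdot> k') \<cdot> e"
        using uv c e k k' by (simp add: cbar ar)
    qed (use uv c e k' in \<open>simp_all add: cbar ar\<close>)
    note P = Z_pair[OF uv(1) k'(1) k'(2)[symmetric] c(1) k'(3) this]
    have "\<alpha> \<cdot> pair z1 z2 u k' = v"
    proof (rule regular_epi_cancel[OF e(1)])
      have s: "pair z1 z2 u k' \<cdot> e = pair z1 z2 (u \<cdot> e) k"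
        using P(6)[of e] e k' by simp
      have *: "z1 \<cdot> (pair z1 z2 u k' \<cdot> e) = u \<cdot> e" "z2 \<cdot> (pair z1 z2 u k' \<cdot> e) = k"
        using comp_left_cong[OF P(4), of e] comp_left_cong[OF P(5), of e] P(1-3) e k' Z_simps by simp_all
      have "\<alpha> \<cdot> (pair z1 z2 u k' \<cdot> e) = q \<cdot> pair t1 t2 (t1 \<cdot> x) g"
        using act[of "pair z1 z2 u k' \<cdot> e" x] P(1-3) e k'(1-3) x * xk by simp
      also have "\<dots> = q \<cdot> y"
        using x(1-3) y(1-3) fxy g(1-5)
        by (subst q_kernel) (simp_all add: related_def T_pair T_simps T_comm g_def[symmetric])
      finally show "(\<alpha> \<cdot> pair z1 z2 u k') \<cdot> e = v \<cdot> e"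
        using y(4) P(1-3) e k'(1-3) \<alpha> by simp
    qed (use P(1-3) k'(1-3) \<alpha> uv c e in simp_all)
    then show "\<exists>w. w \<in> Ar C \<and> Dom C w = Dom C u \<and> Cod C w = Dom C z1 \<and> z1 \<cdot> w = u \<and> \<alpha> \<cdot> w = v"
      using P k' Z_simps by (intro exI[of _ "pair z1 z2 u k'"]) simp
  }
  {
    assume "Cod C u = Dom C z1" "Cod C v = Dom C z1" and eq: "z1 \<cdot> u = z1 \<cdot> v" "\<alpha> \<cdot> u = \<alpha> \<cdot> v"
    then have c: "Cod C u = Z" "Cod C v = Z" by (simp_all add: Z_simps)
    obtain e x where e: "regular_epi C e" "e \<in> Ar C" "Cod C e = Dom C u" "x \<in> Ar C" "Dom C x = Dom C e"
      "Cod C x = T" "q \<cdot> x = (z1 \<cdot> u) \<cdot> e"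
      using regular_epi_lift[OF q(1), of "z1 \<cdot> u"] uv c q Z_simps by auto
    have z1u: "z1 \<cdot> (u \<cdot> e) = q \<cdot> x" "z1 \<cdot> (v \<cdot> e) = q \<cdot> x"
      using e uv c comp_left_cong[OF eq(1), of e] by (simp_all add: Z_simps)
    have au: "\<alpha> \<cdot> (u \<cdot> e) = \<alpha> \<cdot> (v \<cdot> e)"
      using comp_left_cong[OF eq(2), of e] uv c e \<alpha> by simp
    have dzu: "d \<cdot> (z2 \<cdot> (u \<cdot> e)) = c \<cdot> (t2 \<cdot> x)" "d \<cdot> (z2 \<cdot> (v \<cdot> e)) = c \<cdot> (t2 \<cdot> x)"
      using dz[of "u \<cdot> e" x] dz[of "v \<cdot> e" x] z1u uv c e by simp_all
    have "q \<cdot> pair t1 t2 (t1 \<cdot> x) (mul (t2 \<cdot> x) (z2 \<cdot> (u \<cdot> e))) =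
        q \<cdot> pair t1 t2 (t1 \<cdot> x) (mul (t2 \<cdot> x) (z2 \<cdot> (v \<cdot> e)))"
      using act[of "u \<cdot> e" x] act[of "v \<cdot> e" x] au z1u uv c e by simp
    from q_eqD(2)[OF this]
    have "mul (t2 \<cdot> x) (z2 \<cdot> (u \<cdot> e)) = mul (\<omega> (t1 \<cdot> x) (t1 \<cdot> x)) (mul (t2 \<cdot> x) (z2 \<cdot> (v \<cdot> e)))"
      using uv c e(1-6) dzu by (simp add: T_pair mul_simps T_simps Z_simps T_comm)
    also have "\<dots> = mul (t2 \<cdot> x) (z2 \<cdot> (v \<cdot> e))"
      using uv c e(1-6) dzu by (intro omega_refl_mul) (simp_all add: mul_simps T_simps Z_simps T_comm)
    finally have m: "mul (t2 \<cdot> x) (z2 \<cdot> (u \<cdot> e)) = mul (t2 \<cdot> x) (z2 \<cdot> (v \<cdot> e))" .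
    have "z2 \<cdot> (u \<cdot> e) = z2 \<cdot> (v \<cdot> e)"
      by (rule mul_left_cancel[OF _ _ _ _ _ _ _ _ _ _ m])
        (use uv c e(1-6) dzu in \<open>simp_all add: T_simps Z_simps\<close>)
    then have "(z2 \<cdot> u) \<cdot> e = (z2 \<cdot> v) \<cdot> e"
      using uv c e(1-6) by (simp add: Z_simps)
    then have "z2 \<cdot> u = z2 \<cdot> v"
      by (rule regular_epi_cancel[OF e(1)]) (use uv c e(1-6) in \<open>simp_all add: Z_simps\<close>)
    then show "u = v"
      by - (rule pullback_eqI[OF Z(1) eq(1)]; simp add: uv c Z_simps)
  }
qed (simp_all add: fbar Z_simps \<alpha>)

text \<open>The identities of the groupoid act trivially.\<close>

lemma diagonal:
  assumes \<alpha>: "\<alpha> \<in> Ar C" "Dom C \<alpha> = Z" "Cod C \<alpha> = Q"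
    and act: "\<And>s x. \<lbrakk>s \<in> Ar C; x \<in> Ar C; Dom C s = Dom C x; Cod C s = Z; Cod C x = T; z1 \<cdot> s = q \<cdot> x\<rbrakk> \<Longrightarrow>
      \<alpha> \<cdot> s = q \<cdot> pair t1 t2 (t1 \<cdot> x) (mul (t2 \<cdot> x) (z2 \<cdot> s))"
  obtains \<delta> where "\<delta> \<in> Ar C" "Dom C \<delta> = Q" "Cod C \<delta> = Z" "z1 \<cdot> \<delta> = Id C Q" "\<alpha> \<cdot> \<delta> = Id C Q"
proof -
  define \<delta> where "\<delta> = pair z1 z2 (Id C Q) (i \<cdot> cbar)"
  have \<delta>: "\<delta> \<in> Ar C" "Dom C \<delta> = Q" "Cod C \<delta> = Z" "z1 \<cdot> \<delta> = Id C Q" "z2 \<cdot> \<delta> = i \<cdot> cbar"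
    unfolding \<delta>_def by (subst Z_pair; simp add: q_simps cbar ar graph_el)+
  have "z1 \<cdot> (\<delta> \<cdot> q) = q" "z2 \<cdot> (\<delta> \<cdot> q) = i \<cdot> (c \<cdot> t2)"
    using comp_left_cong[OF \<delta>(4), of q] comp_left_cong[OF \<delta>(5), of q] \<delta>
    by (simp_all add: q q_simps Z_simps ar cbar)
  then have "\<alpha> \<cdot> (\<delta> \<cdot> q) = q \<cdot> pair t1 t2 t1 t2"
    using act[of "\<delta> \<cdot> q" "Id C T"] \<delta> mul_unit(2)[of t2] by (simp add: q q_simps T_simps)
  also have "pair t1 t2 t1 t2 = Id C T"
    by (rule T_eqI) (simp_all add: T_pair T_simps T_comm)
  finally have "\<alpha> \<cdot> \<delta> = Id C Q"
    using \<alpha> \<delta> by - (rule regular_epi_cancel[OF q(1)]; simp add: q q_simps)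
  with \<delta> show ?thesis using that by blast
qed

end

section \<open>Special extensions\<close>

context admissible_reflection
begin

text \<open>Factor \<open>k\<close> through the unit of its domain; the pullback of \<open>d\<close> along the second factor stays in the
  subcategory and is split there.\<close>

lemma pullback_of_sub_split_epi_trivial:
  assumes PB: "is_pullback C z1 z2 k d" and X: "Dom C d \<in> X" "Cod C d \<in> X"
    and i: "i \<in> Ar C" "Dom C i = Cod C d" "Cod C i = Dom C d" "d \<cdot> i = Id C (Cod C d)"
  shows "trivial_extension C I \<eta> z1"
proof -
  interpret sub: plain_category D by (rule plain_category_sub)
  note PD = pullbackD[OF PB]
  define Q G0 G Z where "Q = Dom C k" "G0 = Cod C d" "G = Dom C d" "Z = Dom C z1"
  have ob: "Dom C k = Q" "Cod C k = G0" "Cod C d = G0" "Dom C d = G" "Dom C z1 = Z" "Dom C z2 = Z"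
    "Cod C z1 = Q" "Cod C z2 = G" "Dom C i = G0" "Cod C i = G"
    "Q \<in> Ob C" "Z \<in> Ob C" "G0 \<in> X" "G \<in> X" "G0 \<in> Ob C" "G \<in> Ob C"
    using PD X i by (auto simp: Q_G0_G_Z_def)
  note ar = PD(1-4) i(1)
  obtain k' where k': "k' \<in> Ar C" "Dom C k' = \<rho> Q" "Cod C k' = G0" "k' \<cdot> \<eta> Q = k"
    using unit_extend[of k Q] ar ob by metis
  obtain y1 y2 where Y: "is_pullback C y1 y2 k' d" "Dom C y1 \<in> X"
    using sub_pullback[of k' d] ar ob k' reflector_simps(1) by metis
  define Y0 where "Y0 = Dom C y1"
  have Y0: "y1 \<in> Ar C" "y2 \<in> Ar C" "Dom C y1 = Y0" "Dom C y2 = Y0" "Cod C y1 = \<rho> Q" "Cod C y2 = G"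
    "Y0 \<in> X" "Y0 \<in> Ob C"
    using pullbackD[OF Y(1)] Y(2) k' ob by (auto simp: Y0_def)
  note Y_pair = pair[OF Y(1), unfolded Y0(3) k' ob] pair_comp[OF Y(1), unfolded Y0(3) k' ob]
  have di: "d \<cdot> (i \<cdot> x) = x" if "x \<in> Ar C" "Cod C x = G0" for x
    using comp_left_cong[OF i(4), of x] that ar ob by simp
  have k'\<eta>: "k' \<cdot> (\<eta> Q \<cdot> x) = k \<cdot> x" if "x \<in> Ar C" "Cod C x = Q" for x
    using comp_left_cong[OF k'(4), of x] that k' ob by simp
  define s where "s = pair y1 y2 (Id C (\<rho> Q)) (i \<cdot> k')"
  have s: "s \<in> Ar C" "Dom C s = \<rho> Q" "Cod C s = Y0" "y1 \<cdot> s = Id C (\<rho> Q)"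
    unfolding s_def by (subst Y_pair; simp add: ob ar k' di)+
  have y1_reg: "regular_epi D y1"
    by (rule sub.split_epi_regular[of y1 s]) (simp_all add: s Y0 ob)
  have comm: "k' \<cdot> (\<eta> Q \<cdot> z1) = d \<cdot> z2"
    using PD(9) by (simp add: k'\<eta> ar ob)
  define j where "j = pair y1 y2 (\<eta> Q \<cdot> z1) z2"
  have j: "j \<in> Ar C" "Dom C j = Z" "Cod C j = Y0" "y1 \<cdot> j = \<eta> Q \<cdot> z1" "y2 \<cdot> j = z2"
    unfolding j_def by (subst Y_pair; simp add: ob ar comm)+
  have "is_pullback C z1 j (\<eta> Q) y1"
  proof (rule pullbackI)
    fix u v
    assume "u \<in> Ar C" "v \<in> Ar C" "Dom C v = Dom C u" "Cod C u = Dom C (\<eta> Q)"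
      "Cod C v = Dom C y1" and eq: "\<eta> Q \<cdot> u = y1 \<cdot> v"
    then have uv: "u \<in> Ar C" "v \<in> Ar C" "Dom C v = Dom C u" "Cod C u = Q" "Cod C v = Y0"
      using ob Y0 by simp_all
    have c: "k \<cdot> u = d \<cdot> (y2 \<cdot> v)"
      using pullback_comm[OF Y(1), of v] uv Y0 k'\<eta>[of u] eq by simp
    define x where "x = pair z1 z2 u (y2 \<cdot> v)"
    have x: "x \<in> Ar C" "Dom C x = Dom C u" "Cod C x = Z" "z1 \<cdot> x = u" "z2 \<cdot> x = y2 \<cdot> v"
      unfolding x_def by (subst pair[OF PB]; simp add: uv Y0 ob c)+
    have "j \<cdot> x = v"
    proof (rule pullback_eqI[OF Y(1)])
      show "y1 \<cdot> (j \<cdot> x) = y1 \<cdot> v" "y2 \<cdot> (j \<cdot> x) = y2 \<cdot> v"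
        using comp_left_cong[OF j(4), of x] comp_left_cong[OF j(5), of x] j(1-3) x ar ob Y0 eq by simp_all
    qed (use j(1-3) x uv Y0 in simp_all)
    then show "\<exists>w. w \<in> Ar C \<and> Dom C w = Dom C u \<and> Cod C w = Dom C z1 \<and> z1 \<cdot> w = u \<and> j \<cdot> w = v"
      using x ob by auto
  next
    fix u v
    assume uv: "u \<in> Ar C" "v \<in> Ar C" "Dom C v = Dom C u" "Cod C u = Dom C z1"
      "Cod C v = Dom C z1" "z1 \<cdot> u = z1 \<cdot> v" "j \<cdot> u = j \<cdot> v"
    have "z2 \<cdot> u = y2 \<cdot> (j \<cdot> u)" "z2 \<cdot> v = y2 \<cdot> (j \<cdot> v)"
      using comp_left_cong[OF j(5), of u] comp_left_cong[OF j(5), of v] uv(1-5) j(1-3) Y0 ob by simp_all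
    then show "u = v"
      using uv by - (rule pullback_eqI[OF PB uv(6)]; simp)
  qed (use ob ar j Y0 in simp_all)
  then show ?thesis by (rule trivial_if_pullback[OF ob(11) y1_reg])
qed

text \<open>The reflector preserves the pullback of composable pairs of the kernel pair of a special \<open>g\<close>.
  Triviality of \<open>p1\<close> identifies this pullback with the pullback of a split epimorphism \<open>y1\<close> of the
  subcategory along the unit of \<open>R\<close>, and admissibility computes its reflection.\<close>

lemma reflected_composites_jointly_monic:
  assumes K: "is_pullback C p1 p2 g g" and tr: "is_pullback C p1 (\<eta> R) (\<eta> A) (\<Phi> p1)"
    and \<delta>: "\<delta> \<in> Ar C" "Dom C \<delta> = A" "Cod C \<delta> = R" "p1 \<cdot> \<delta> = Id C A" "p2 \<cdot> \<delta> = Id C A"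
    and ob: "Dom C g = A" "Dom C p1 = R"
    and S: "is_pullback C s1 s2 p2 p1" "Dom C s1 = R3"
    and h: "h \<in> Ar C" "h' \<in> Ar C" "Dom C h = Dom C h'" "Cod C h = \<rho> R3" "Cod C h' = \<rho> R3"
      "\<Phi> s1 \<cdot> h = \<Phi> s1 \<cdot> h'" "\<Phi> s2 \<cdot> h = \<Phi> s2 \<cdot> h'"
  shows "h = h'"
proof -
  interpret sub: plain_category D by (rule plain_category_sub)
  note KD = pullbackD[OF K] and SD = pullbackD[OF S(1)]
  have r: "p1 \<in> Ar C" "p2 \<in> Ar C" "Dom C p1 = R" "Dom C p2 = R" "Cod C p1 = A" "Cod C p2 = A"
    "s1 \<in> Ar C" "s2 \<in> Ar C" "Dom C s1 = R3" "Dom C s2 = R3" "Cod C s1 = R" "Cod C s2 = R"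
    "A \<in> Ob C" "R \<in> Ob C" "R3 \<in> Ob C"
    using KD SD ob S by auto
  \<comment> \<open>The pullback of the reflections; \<open>j\<close> compares it with the reflection of the
    pullback and is shown to be split monic.\<close>
  obtain y1 y2 where Y: "is_pullback C y1 y2 (\<Phi> p2) (\<Phi> p1)" "Dom C y1 \<in> X"
    using sub_pullback[of "\<Phi> p2" "\<Phi> p1"] r by auto
  define Y0 where "Y0 = Dom C y1"
  have Y0: "y1 \<in> Ar C" "y2 \<in> Ar C" "Dom C y1 = Y0" "Dom C y2 = Y0" "Cod C y1 = \<rho> R" "Cod C y2 = \<rho> R"
    "Y0 \<in> X" "Y0 \<in> Ob C"
    using pullbackD[OF Y(1)] Y(2) r by (auto simp: Y0_def)
  have \<Phi>_dom: "Dom C (\<Phi> p1) = \<rho> R" "Dom C (\<Phi> p2) = \<rho> R" using r by simp_all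
  note Y_pair = pair[OF Y(1), unfolded Y0(3) \<Phi>_dom] pair_comp[OF Y(1), unfolded Y0(3) \<Phi>_dom]
  have \<Phi>\<delta>: "\<Phi> p1 \<cdot> \<Phi> \<delta> = Id C (\<rho> A)"
    using reflector_simps(6)[of \<delta> p1] \<delta> r by simp
  have \<Phi>\<delta>_el: "\<Phi> p1 \<cdot> (\<Phi> \<delta> \<cdot> x) = x" if "x \<in> Ar C" "Cod C x = \<rho> A" for x
    using comp_left_cong[OF \<Phi>\<delta>, of x] that r \<delta> by simp
  define s where "s = pair y1 y2 (Id C (\<rho> R)) (\<Phi> \<delta> \<cdot> \<Phi> p2)"
  have s: "s \<in> Ar C" "Dom C s = \<rho> R" "Cod C s = Y0" "y1 \<cdot> s = Id C (\<rho> R)"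
    unfolding s_def by (subst Y_pair; simp add: r \<delta>(1-3) \<Phi>\<delta>_el)+
  have y1_reg: "regular_epi D y1"
    by (rule sub.split_epi_regular[of y1 s]) (simp_all add: s Y0 r)
  have comm: "\<Phi> p2 \<cdot> \<Phi> s1 = \<Phi> p1 \<cdot> \<Phi> s2"
    using reflector_simps(6)[of s1 p2] reflector_simps(6)[of s2 p1] SD(9) r by simp
  define j where "j = pair y1 y2 (\<Phi> s1) (\<Phi> s2)"
  have j: "j \<in> Ar C" "Dom C j = \<rho> R3" "Cod C j = Y0" "y1 \<cdot> j = \<Phi> s1" "y2 \<cdot> j = \<Phi> s2"
    unfolding j_def by (subst Y_pair; simp add: r comm)+
  have j_el: "y1 \<cdot> (j \<cdot> x) = \<Phi> s1 \<cdot> x" "y2 \<cdot> (j \<cdot> x) = \<Phi> s2 \<cdot> x" if "x \<in> Ar C" "Cod C x = \<rho> R3" for x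
    using j(4,5)[THEN comp_left_cong, of x] that j(1-3) Y0 by simp_all
  have "is_pullback C s1 (j \<cdot> \<eta> R3) (\<eta> R) y1"
  proof (rule pullbackI)
    fix u v
    assume "u \<in> Ar C" "v \<in> Ar C" "Dom C v = Dom C u" "Cod C u = Dom C (\<eta> R)"
      "Cod C v = Dom C y1" and eq: "\<eta> R \<cdot> u = y1 \<cdot> v"
    then have uv: "u \<in> Ar C" "v \<in> Ar C" "Dom C v = Dom C u" "Cod C u = R" "Cod C v = Y0"
      using r Y0 by simp_all
    have c: "\<eta> A \<cdot> (p2 \<cdot> u) = \<Phi> p1 \<cdot> (y2 \<cdot> v)"
      using pullback_comm[OF Y(1), of v] uv Y0 r eq[symmetric] by simp
    define t where "t = pair p1 (\<eta> R) (p2 \<cdot> u) (y2 \<cdot> v)"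
    have t: "t \<in> Ar C" "Dom C t = Dom C u" "Cod C t = R" "p1 \<cdot> t = p2 \<cdot> u" "\<eta> R \<cdot> t = y2 \<cdot> v"
      unfolding t_def by (subst pair[OF tr]; simp add: r uv Y0 c)+
    define x where "x = pair s1 s2 u t"
    have x: "x \<in> Ar C" "Dom C x = Dom C u" "Cod C x = R3" "s1 \<cdot> x = u" "s2 \<cdot> x = t"
      unfolding x_def by (subst pair[OF S(1)]; simp add: r uv t)+
    have "j \<cdot> (\<eta> R3 \<cdot> x) = v"
    proof (rule pullback_eqI[OF Y(1)])
      show "y1 \<cdot> (j \<cdot> (\<eta> R3 \<cdot> x)) = y1 \<cdot> v" "y2 \<cdot> (j \<cdot> (\<eta> R3 \<cdot> x)) = y2 \<cdot> v"
        using x t r eq by (simp_all add: j_el)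
    qed (use j(1-3) x uv Y0 r in simp_all)
    then show "\<exists>w. w \<in> Ar C \<and> Dom C w = Dom C u \<and> Cod C w = Dom C s1 \<and> s1 \<cdot> w = u \<and> (j \<cdot> \<eta> R3) \<cdot> w = v"
      using x r j by (intro exI[of _ x]) simp
  next
    fix u v
    assume "u \<in> Ar C" "v \<in> Ar C" "Dom C v = Dom C u" "Cod C u = Dom C s1"
      "Cod C v = Dom C s1" and eq: "s1 \<cdot> u = s1 \<cdot> v" "(j \<cdot> \<eta> R3) \<cdot> u = (j \<cdot> \<eta> R3) \<cdot> v"
    then have uv: "u \<in> Ar C" "v \<in> Ar C" "Dom C v = Dom C u" "Cod C u = R3" "Cod C v = R3"
      using r by simp_all
    have "\<eta> R \<cdot> (s2 \<cdot> z) = y2 \<cdot> ((j \<cdot> \<eta> R3) \<cdot> z)" if "z \<in> Ar C" "Cod C z = R3" for z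
      using that r j(1-3) by (simp add: j_el)
    then have e1: "\<eta> R \<cdot> (s2 \<cdot> u) = \<eta> R \<cdot> (s2 \<cdot> v)" using eq(2) uv by metis
    have "p1 \<cdot> (s2 \<cdot> z) = p2 \<cdot> (s1 \<cdot> z)" if "z \<in> Ar C" "Cod C z = R3" for z
      using pullback_comm[OF S(1), of z] that r by simp
    then have e2: "p1 \<cdot> (s2 \<cdot> u) = p1 \<cdot> (s2 \<cdot> v)" using eq(1) uv by metis
    have "s2 \<cdot> u = s2 \<cdot> v"
      by (rule pullback_eqI[OF tr e2 e1]) (use uv r in simp_all)
    then show "u = v"
      using uv r by - (rule pullback_eqI[OF S(1) eq(1)]; simp)
  qed (use r j Y0 in \<open>simp_all add: j_el\<close>)
  then have un: "universal (j \<cdot> \<eta> R3)"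
    by (rule pullback_universal[OF r(14) y1_reg])
  obtain \<sigma> where \<sigma>: "\<sigma> \<in> Ar C" "Dom C \<sigma> = Y0" "Cod C \<sigma> = \<rho> R3" "\<sigma> \<cdot> (j \<cdot> \<eta> R3) = \<eta> R3"
    using universal_extend[OF un, of "\<eta> R3"] r j by auto
  have \<sigma>j: "\<sigma> \<cdot> j = Id C (\<rho> R3)"
    by (rule unit_cancel[of _ R3]) (use \<sigma> j(1-3) r in simp_all)
  have "j \<cdot> h = j \<cdot> h'"
    by (rule pullback_eqI[OF Y(1)]) (use h r j(1-3) Y0 in \<open>simp_all add: j_el\<close>)
  moreover have "\<sigma> \<cdot> (j \<cdot> x) = x" if "x \<in> Ar C" "Cod C x = \<rho> R3" for x
    using comp_left_cong[OF \<sigma>j, of x] that \<sigma>(1-3) j(1-3) by simp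
  ultimately show ?thesis using h by metis
qed

end

section \<open>The reflection of a regular epimorphism\<close>

text \<open>The elements of \<open>R\<close> are the pairs identified by \<open>f\<close>; those of \<open>R3\<close> are the composable pairs
  \<open>((x, y), (y, z))\<close> of such, that is, triples.\<close>

locale extension_kernel = protomodular_reflection C X I \<eta>
  for C :: "('o, 'm) cat" (structure) and X I \<eta> +
  fixes f p1 p2 s1 s2 :: 'm and A B R R3 :: 'o
  assumes exact: "barr_exact C"
    and f: "regular_epi C f" "Dom C f = A" "Cod C f = B"
    and K: "is_pullback C p1 p2 f f" "Dom C p1 = R"
    and S: "is_pullback C s1 s2 p2 p1" "Dom C s1 = R3"
begin

lemma kernel_simps:
  "f \<in> Ar C" "A \<in> Ob C" "B \<in> Ob C"
  "p1 \<in> Ar C" "p2 \<in> Ar C" "Dom C p1 = R" "Dom C p2 = R" "Cod C p1 = A" "Cod C p2 = A"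
  "s1 \<in> Ar C" "s2 \<in> Ar C" "Dom C s1 = R3" "Dom C s2 = R3" "Cod C s1 = R" "Cod C s2 = R"
  "R \<in> Ob C" "R3 \<in> Ob C"
  using pullbackD[OF K(1)] pullbackD[OF S(1)] K S f by auto

lemma R_comm: "x \<in> Ar C \<Longrightarrow> Cod C x = R \<Longrightarrow> f \<cdot> (p1 \<cdot> x) = f \<cdot> (p2 \<cdot> x)" "f \<cdot> p1 = f \<cdot> p2"
  using pullback_comm[OF K(1)] K(2) pullbackD(9)[OF K(1)] by simp_all

lemma R3_comm: "x \<in> Ar C \<Longrightarrow> Cod C x = R3 \<Longrightarrow> p2 \<cdot> (s1 \<cdot> x) = p1 \<cdot> (s2 \<cdot> x)" "p2 \<cdot> s1 = p1 \<cdot> s2"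
  using pullback_comm[OF S(1)] S(2) pullbackD(9)[OF S(1)] by simp_all

abbreviation pairR where "pairR \<equiv> pair p1 p2"
abbreviation pairR3 where "pairR3 \<equiv> pair s1 s2"

lemma R_pair:
  assumes "x \<in> Ar C" "y \<in> Ar C" "Dom C x = Dom C y" "Cod C x = A" "Cod C y = A" "f \<cdot> x = f \<cdot> y"
  shows "pairR x y \<in> Ar C" "Dom C (pairR x y) = Dom C y" "Cod C (pairR x y) = R"
    "p1 \<cdot> pairR x y = x" "p2 \<cdot> pairR x y = y"
    "k \<in> Ar C \<Longrightarrow> Cod C k = Dom C y \<Longrightarrow> pairR x y \<cdot> k = pairR (x \<cdot> k) (y \<cdot> k)"
  by (subst pair[OF K(1)] pair_comp[OF K(1)]; simp add: f assms K)+

lemma R3_pair: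
  assumes "x \<in> Ar C" "y \<in> Ar C" "Dom C x = Dom C y" "Cod C x = R" "Cod C y = R" "p2 \<cdot> x = p1 \<cdot> y"
  shows "pairR3 x y \<in> Ar C" "Dom C (pairR3 x y) = Dom C y" "Cod C (pairR3 x y) = R3"
    "s1 \<cdot> pairR3 x y = x" "s2 \<cdot> pairR3 x y = y"
    "k \<in> Ar C \<Longrightarrow> Cod C k = Dom C y \<Longrightarrow> pairR3 x y \<cdot> k = pairR3 (x \<cdot> k) (y \<cdot> k)"
  by (subst pair[OF S(1)] pair_comp[OF S(1)]; simp add: kernel_simps assms S)+

lemma R_eqI:
  assumes "p1 \<cdot> u = p1 \<cdot> v" "p2 \<cdot> u = p2 \<cdot> v" "u \<in> Ar C" "v \<in> Ar C" "Dom C u = Dom C v"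
    "Cod C u = R" "Cod C v = R"
  shows "u = v"
  by (rule pullback_eqI[OF K(1) assms(1-5)]) (simp_all add: assms K)

definition diag where "diag = pairR (Id C A) (Id C A)"
definition twist where "twist = pairR p2 p1"
definition compose where "compose = pairR (p1 \<cdot> s1) (p2 \<cdot> s2)"

lemma diag: "diag \<in> Ar C" "Dom C diag = A" "Cod C diag = R" "p1 \<cdot> diag = Id C A" "p2 \<cdot> diag = Id C A"
  unfolding diag_def by (subst R_pair; simp add: kernel_simps)+

lemma twist: "twist \<in> Ar C" "Dom C twist = R" "Cod C twist = R" "p1 \<cdot> twist = p2" "p2 \<cdot> twist = p1"
  unfolding twist_def by (subst R_pair; simp add: kernel_simps R_comm)+

lemma compose: "compose \<in> Ar C" "Dom C compose = R3" "Cod C compose = R"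
  "p1 \<cdot> compose = p1 \<cdot> s1" "p2 \<cdot> compose = p2 \<cdot> s2"
  unfolding compose_def by (subst R_pair; simp add: kernel_simps R_comm R3_comm)+

lemma p_el:
  assumes "x \<in> Ar C"
  shows "Cod C x = A \<Longrightarrow> p1 \<cdot> (diag \<cdot> x) = x" "Cod C x = A \<Longrightarrow> p2 \<cdot> (diag \<cdot> x) = x"
    "Cod C x = R \<Longrightarrow> p1 \<cdot> (twist \<cdot> x) = p2 \<cdot> x" "Cod C x = R \<Longrightarrow> p2 \<cdot> (twist \<cdot> x) = p1 \<cdot> x"
    "Cod C x = R3 \<Longrightarrow> p1 \<cdot> (compose \<cdot> x) = p1 \<cdot> (s1 \<cdot> x)"
    "Cod C x = R3 \<Longrightarrow> p2 \<cdot> (compose \<cdot> x) = p2 \<cdot> (s2 \<cdot> x)"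
  using diag(4,5)[THEN comp_left_cong, OF assms] twist(4,5)[THEN comp_left_cong, OF assms]
    compose(4,5)[THEN comp_left_cong, OF assms] assms
  by (simp_all add: diag(1-3) twist(1-3) compose(1-3) kernel_simps)

lemma reflect_eq:
  "x \<cdot> y = u \<Longrightarrow> x \<in> Ar C \<Longrightarrow> y \<in> Ar C \<Longrightarrow> Cod C y = Dom C x \<Longrightarrow> \<Phi> x \<cdot> \<Phi> y = \<Phi> u"
  using reflector_simps(6) by metis

text \<open>The reflector need not preserve the pullback \<open>R3\<close>, so the composition of \<open>R\<close> becomes multivalued.
  The equations, being equations between arrows, are preserved.\<close>

lemma reflected_multivalued_groupoid:
  "multivalued_groupoid C X I \<eta> (\<rho> A) (\<rho> R) (\<rho> R3) (\<Phi> p1) (\<Phi> p2) (\<Phi> diag) (\<Phi> twist)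
     (\<Phi> s1) (\<Phi> s2) (\<Phi> compose) (\<Phi> (pairR3 (Id C R) (diag \<cdot> p2))) (\<Phi> (pairR3 (diag \<cdot> p1) (Id C R)))
     (\<Phi> (pairR3 (Id C R) twist)) (\<Phi> (pairR3 twist (Id C R)))"
proof -
  let ?l = "pairR3 (Id C R) (diag \<cdot> p2)" and ?l' = "pairR3 (diag \<cdot> p1) (Id C R)"
    and ?n = "pairR3 (Id C R) twist" and ?n' = "pairR3 twist (Id C R)"
  note simps = kernel_simps diag twist p_el
  have l: "?l \<in> Ar C" "Dom C ?l = R" "Cod C ?l = R3" "s1 \<cdot> ?l = Id C R" "s2 \<cdot> ?l = diag \<cdot> p2"
    and l': "?l' \<in> Ar C" "Dom C ?l' = R" "Cod C ?l' = R3" "s1 \<cdot> ?l' = diag \<cdot> p1" "s2 \<cdot> ?l' = Id C R"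
    and n: "?n \<in> Ar C" "Dom C ?n = R" "Cod C ?n = R3" "s1 \<cdot> ?n = Id C R" "s2 \<cdot> ?n = twist"
    and n': "?n' \<in> Ar C" "Dom C ?n' = R" "Cod C ?n' = R3" "s1 \<cdot> ?n' = twist" "s2 \<cdot> ?n' = Id C R"
    by (subst R3_pair; simp add: simps)+
  have m: "compose \<cdot> ?l = Id C R" "compose \<cdot> ?l' = Id C R" "compose \<cdot> ?n = diag \<cdot> p1" "compose \<cdot> ?n' = diag \<cdot> p2"
    by (rule R_eqI; simp add: simps compose(1-3) l l' n n')+
  note typs = kernel_simps diag(1-3) twist(1-3) compose(1-3) l(1-3) l'(1-3) n(1-3) n'(1-3)
  show ?thesis
    by unfold_locales
      (use reflect_eq[OF diag(4)] reflect_eq[OF diag(5)] reflect_eq[OF twist(4)] reflect_eq[OF twist(5)] reflect_eq[OF R3_comm(2)]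
      reflect_eq[OF compose(4)] reflect_eq[OF compose(5)]
      reflect_eq[OF l(4)] reflect_eq[OF l(5)] reflect_eq[OF l'(4)] reflect_eq[OF l'(5)]
      reflect_eq[OF n(4)] reflect_eq[OF n(5)] reflect_eq[OF n'(4)] reflect_eq[OF n'(5)]
      m[THEN reflect_eq] in \<open>simp_all add: typs\<close>)
qed

end

text \<open>A morphism \<open>(a, b)\<close> from \<open>f\<close> to an arrow \<open>g\<close> that is special through the kernel pair \<open>p1'\<close>, \<open>p2'\<close>.\<close>

locale special_target = extension_kernel C X I \<eta> f p1 p2 s1 s2 A B R R3
  for C :: "('o, 'm) cat" (structure) and X I \<eta> f p1 p2 s1 s2 A B R R3 +
  fixes g a b p1' p2' \<delta>' s1' s2' :: 'm and A' B' R' R3' :: 'o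
  assumes g: "g \<in> Ar C" "Dom C g = A'" "Cod C g = B'"
    and a: "a \<in> Ar C" "Dom C a = A" "Cod C a = A'"
    and b: "b \<in> Ar C" "Dom C b = B" "Cod C b = B'"
    and square: "g \<cdot> a = b \<cdot> f"
    and K': "is_pullback C p1' p2' g g" "Dom C p1' = R'"
    and \<delta>': "\<delta>' \<in> Ar C" "Dom C \<delta>' = A'" "Cod C \<delta>' = R'" "p1' \<cdot> \<delta>' = Id C A'" "p2' \<cdot> \<delta>' = Id C A'"
    and trivial: "is_pullback C p1' (\<eta> R') (\<eta> A') (\<Phi> p1')"
    and S': "is_pullback C s1' s2' p2' p1'" "Dom C s1' = R3'"
begin

lemma target_simps:
  "p1' \<in> Ar C" "p2' \<in> Ar C" "Dom C p1' = R'" "Dom C p2' = R'" "Cod C p1' = A'" "Cod C p2' = A'"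
  "s1' \<in> Ar C" "s2' \<in> Ar C" "Dom C s1' = R3'" "Dom C s2' = R3'" "Cod C s1' = R'" "Cod C s2' = R'"
  "A' \<in> Ob C" "B' \<in> Ob C" "R' \<in> Ob C" "R3' \<in> Ob C"
  using pullbackD[OF K'(1)] pullbackD[OF S'(1)] K' S' g by auto

lemma square_el: "x \<in> Ar C \<Longrightarrow> Cod C x = A \<Longrightarrow> g \<cdot> (a \<cdot> x) = b \<cdot> (f \<cdot> x)"
  using comp_left_cong[OF square, of x] g a b f by (simp add: kernel_simps)

lemma R'_comm: "x \<in> Ar C \<Longrightarrow> Cod C x = R' \<Longrightarrow> g \<cdot> (p1' \<cdot> x) = g \<cdot> (p2' \<cdot> x)" "g \<cdot> p1' = g \<cdot> p2'"
  using pullback_comm[OF K'(1)] K'(2) pullbackD(9)[OF K'(1)] by simp_all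

lemma R3'_comm: "x \<in> Ar C \<Longrightarrow> Cod C x = R3' \<Longrightarrow> p2' \<cdot> (s1' \<cdot> x) = p1' \<cdot> (s2' \<cdot> x)" "p2' \<cdot> s1' = p1' \<cdot> s2'"
  using pullback_comm[OF S'(1)] S'(2) pullbackD(9)[OF S'(1)] by simp_all

lemma R'_pair:
  assumes "x \<in> Ar C" "y \<in> Ar C" "Dom C x = Dom C y" "Cod C x = A'" "Cod C y = A'" "g \<cdot> x = g \<cdot> y"
  shows "pair p1' p2' x y \<in> Ar C" "Dom C (pair p1' p2' x y) = Dom C y" "Cod C (pair p1' p2' x y) = R'"
    "p1' \<cdot> pair p1' p2' x y = x" "p2' \<cdot> pair p1' p2' x y = y"
    "k \<in> Ar C \<Longrightarrow> Cod C k = Dom C y \<Longrightarrow> pair p1' p2' x y \<cdot> k = pair p1' p2' (x \<cdot> k) (y \<cdot> k)"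
  by (subst pair[OF K'(1)] pair_comp[OF K'(1)]; simp add: g assms K')+

lemma R3'_pair:
  assumes "x \<in> Ar C" "y \<in> Ar C" "Dom C x = Dom C y" "Cod C x = R'" "Cod C y = R'" "p2' \<cdot> x = p1' \<cdot> y"
  shows "pair s1' s2' x y \<in> Ar C" "Dom C (pair s1' s2' x y) = Dom C y" "Cod C (pair s1' s2' x y) = R3'"
    "s1' \<cdot> pair s1' s2' x y = x" "s2' \<cdot> pair s1' s2' x y = y"
    "k \<in> Ar C \<Longrightarrow> Cod C k = Dom C y \<Longrightarrow> pair s1' s2' x y \<cdot> k = pair s1' s2' (x \<cdot> k) (y \<cdot> k)"
  by (subst pair[OF S'(1)] pair_comp[OF S'(1)]; simp add: target_simps assms S')+

lemma R'_eqI: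
  assumes "p1' \<cdot> u = p1' \<cdot> v" "p2' \<cdot> u = p2' \<cdot> v" "u \<in> Ar C" "v \<in> Ar C" "Dom C u = Dom C v"
    "Cod C u = R'" "Cod C v = R'"
  shows "u = v"
  by (rule pullback_eqI[OF K'(1) assms(1-5)]) (simp_all add: assms K')

definition compose' where "compose' = pair p1' p2' (p1' \<cdot> s1') (p2' \<cdot> s2')"
definition r where "r = pair p1' p2' (a \<cdot> p1) (a \<cdot> p2)"
definition r3 where "r3 = pair s1' s2' (r \<cdot> s1) (r \<cdot> s2)"

lemma compose': "compose' \<in> Ar C" "Dom C compose' = R3'" "Cod C compose' = R'"
  "p1' \<cdot> compose' = p1' \<cdot> s1'" "p2' \<cdot> compose' = p2' \<cdot> s2'"
  unfolding compose'_def by (subst R'_pair; simp add: target_simps R'_comm R3'_comm)+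

lemma compose'_el:
  assumes "x \<in> Ar C" "Cod C x = R3'"
  shows "p1' \<cdot> (compose' \<cdot> x) = p1' \<cdot> (s1' \<cdot> x)" "p2' \<cdot> (compose' \<cdot> x) = p2' \<cdot> (s2' \<cdot> x)"
  using compose'(4,5)[THEN comp_left_cong, OF assms(1)] assms compose'(1-3)
  by (simp_all add: target_simps)

lemma r: "r \<in> Ar C" "Dom C r = R" "Cod C r = R'" "p1' \<cdot> r = a \<cdot> p1" "p2' \<cdot> r = a \<cdot> p2"
  unfolding r_def by (subst R'_pair; simp add: kernel_simps a square_el R_comm)+

lemma r_el:
  assumes "x \<in> Ar C" "Cod C x = R"
  shows "p1' \<cdot> (r \<cdot> x) = a \<cdot> (p1 \<cdot> x)" "p2' \<cdot> (r \<cdot> x) = a \<cdot> (p2 \<cdot> x)"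
  using r(4,5)[THEN comp_left_cong, OF assms(1)] assms r(1-3)
  by (simp_all add: target_simps kernel_simps a)

lemma r3: "r3 \<in> Ar C" "Dom C r3 = R3" "Cod C r3 = R3'" "s1' \<cdot> r3 = r \<cdot> s1" "s2' \<cdot> r3 = r \<cdot> s2"
  unfolding r3_def by (subst R3'_pair; simp add: kernel_simps r(1-3) r_el R3_comm)+

lemma compose'_r3: "compose' \<cdot> r3 = r \<cdot> compose"
proof (rule R'_eqI)
  have e: "p1' \<cdot> (s1' \<cdot> r3) = a \<cdot> (p1 \<cdot> s1)" "p2' \<cdot> (s2' \<cdot> r3) = a \<cdot> (p2 \<cdot> s2)"
    unfolding r3(4,5) by (simp_all add: r_el kernel_simps)
  show "p1' \<cdot> (compose' \<cdot> r3) = p1' \<cdot> (r \<cdot> compose)" "p2' \<cdot> (compose' \<cdot> r3) = p2' \<cdot> (r \<cdot> compose)"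
    by (simp_all add: compose'_el r3(1-3) e r_el compose)
qed (simp_all add: compose'(1-3) r3(1-3) r(1-3) compose(1-3))

text \<open>The arrow \<open>r : R \<rightarrow> R'\<close> induced by \<open>a\<close> is a functor between equivalence relations. Since \<open>\<Phi> s1'\<close> and
  \<open>\<Phi> s2'\<close> are jointly monic, the composition reflected from \<open>R'\<close> is single-valued, and \<open>\<Phi> r\<close>
  respects the multivalued composition reflected from \<open>R\<close>.\<close>

lemma reflected_functor:
  assumes h: "h \<in> Ar C" "Cod C h = \<rho> R3" and k: "k \<in> Ar C" "Dom C k = Dom C h" "Cod C k = \<rho> R3'"
    and eq: "\<Phi> s1' \<cdot> k = \<Phi> r \<cdot> (\<Phi> s1 \<cdot> h)" "\<Phi> s2' \<cdot> k = \<Phi> r \<cdot> (\<Phi> s2 \<cdot> h)"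
  shows "\<Phi> compose' \<cdot> k = \<Phi> r \<cdot> (\<Phi> compose \<cdot> h)"
proof -
  note typs = kernel_simps target_simps r(1-3) r3(1-3) compose(1-3) compose'(1-3)
  have "\<Phi> s1' \<cdot> \<Phi> r3 = \<Phi> r \<cdot> \<Phi> s1" "\<Phi> s2' \<cdot> \<Phi> r3 = \<Phi> r \<cdot> \<Phi> s2" "\<Phi> compose' \<cdot> \<Phi> r3 = \<Phi> r \<cdot> \<Phi> compose"
    using reflect_eq[OF r3(4)] reflect_eq[OF r3(5)] reflect_eq[OF compose'_r3] by (simp_all add: typs)
  from this[THEN comp_left_cong, OF h(1)] h
  have e: "\<Phi> s1' \<cdot> (\<Phi> r3 \<cdot> h) = \<Phi> r \<cdot> (\<Phi> s1 \<cdot> h)" "\<Phi> s2' \<cdot> (\<Phi> r3 \<cdot> h) = \<Phi> r \<cdot> (\<Phi> s2 \<cdot> h)"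
    "\<Phi> compose' \<cdot> (\<Phi> r3 \<cdot> h) = \<Phi> r \<cdot> (\<Phi> compose \<cdot> h)"
    by (simp_all add: typs)
  have "k = \<Phi> r3 \<cdot> h"
    by (rule reflected_composites_jointly_monic[OF K'(1) trivial \<delta>' g(2) K'(2) S'])
      (simp_all add: typs h k eq e)
  then show ?thesis using e(3) by simp
qed

lemma reflected_functor_compatible:
  assumes h: "h \<in> Ar C" "h' \<in> Ar C" "Dom C h = Dom C h'" "Cod C h = \<rho> R3" "Cod C h' = \<rho> R3"
    "\<Phi> s1 \<cdot> h = \<Phi> s1 \<cdot> h'" "\<Phi> s2 \<cdot> h = \<Phi> s2 \<cdot> h'"
  shows "\<Phi> r \<cdot> (\<Phi> compose \<cdot> h) = \<Phi> r \<cdot> (\<Phi> compose \<cdot> h')"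
proof -
  note typs = kernel_simps target_simps r(1-3) r3(1-3) compose(1-3) compose'(1-3)
  have "\<Phi> s1' \<cdot> \<Phi> r3 = \<Phi> r \<cdot> \<Phi> s1" "\<Phi> s2' \<cdot> \<Phi> r3 = \<Phi> r \<cdot> \<Phi> s2"
    using reflect_eq[OF r3(4)] reflect_eq[OF r3(5)] by (simp_all add: typs)
  from this[THEN comp_left_cong, OF h(1)] h(1-5)
  have e: "\<Phi> s1' \<cdot> (\<Phi> r3 \<cdot> h) = \<Phi> r \<cdot> (\<Phi> s1 \<cdot> h)" "\<Phi> s2' \<cdot> (\<Phi> r3 \<cdot> h) = \<Phi> r \<cdot> (\<Phi> s2 \<cdot> h)"
    by (simp_all add: typs)
  have "\<Phi> compose' \<cdot> (\<Phi> r3 \<cdot> h) = \<Phi> r \<cdot> (\<Phi> compose \<cdot> h)"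
    by (rule reflected_functor) (simp_all add: h(1-5) typs e)
  moreover have "\<Phi> compose' \<cdot> (\<Phi> r3 \<cdot> h) = \<Phi> r \<cdot> (\<Phi> compose \<cdot> h')"
    by (rule reflected_functor) (use h e in \<open>simp_all add: typs\<close>)
  ultimately show ?thesis by simp
qed

end

text \<open>The groupoid generated by the reflection of \<open>R\<close>, with \<open>\<rho> A\<close> as its object of objects. Composing
  the unit of \<open>R\<close> with \<open>w\<close> gives the cocycle \<open>\<omega>\<close>.\<close>

locale extension_groupoid = extension_kernel C X I \<eta> f p1 p2 s1 s2 A B R R3
  for C :: "('o, 'm) cat" (structure) and X I \<eta> f p1 p2 s1 s2 A B R R3 +
  fixes W :: 'o and w d c i inv :: 'm and mul :: "'m \<Rightarrow> 'm \<Rightarrow> 'm"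
  assumes gpd: "internal_groupoid C (\<rho> A) W d c i inv mul"
    and i_def: "i = w \<cdot> \<Phi> diag"
    and W: "W \<in> X" and w: "regular_epi C w" "Dom C w = \<rho> R" "Cod C w = W" "d \<cdot> w = \<Phi> p1" "c \<cdot> w = \<Phi> p2"
    and mul_w: "\<And>h. h \<in> Ar C \<Longrightarrow> Cod C h = \<rho> R3 \<Longrightarrow>
      mul (w \<cdot> (\<Phi> s1 \<cdot> h)) (w \<cdot> (\<Phi> s2 \<cdot> h)) = w \<cdot> (\<Phi> compose \<cdot> h)"
    and w_cover: "\<And>x y. \<lbrakk>x \<in> Ar C; y \<in> Ar C; Dom C x = Dom C y; Cod C x = W; Cod C y = W; c \<cdot> x = d \<cdot> y\<rbrakk> \<Longrightarrow>
      \<exists>e h. regular_epi C e \<and> Cod C e = Dom C y \<and> h \<in> Ar C \<and> Dom C h = Dom C e \<and> Cod C h = \<rho> R3 \<and>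
        w \<cdot> (\<Phi> s1 \<cdot> h) = x \<cdot> e \<and> w \<cdot> (\<Phi> s2 \<cdot> h) = y \<cdot> e"
    and w_universal: "\<And>g. \<lbrakk>g \<in> Ar C; Dom C g = \<rho> R; Cod C g \<in> X;
      \<forall>h h'. h \<in> Ar C \<and> h' \<in> Ar C \<and> Dom C h = Dom C h' \<and> Cod C h = \<rho> R3 \<and> Cod C h' = \<rho> R3 \<and>
        \<Phi> s1 \<cdot> h = \<Phi> s1 \<cdot> h' \<and> \<Phi> s2 \<cdot> h = \<Phi> s2 \<cdot> h' \<longrightarrow> g \<cdot> (\<Phi> compose \<cdot> h) = g \<cdot> (\<Phi> compose \<cdot> h')\<rbrakk> \<Longrightarrow>
      \<exists>g'. g' \<in> Ar C \<and> Dom C g' = W \<and> Cod C g' = Cod C g \<and> g' \<cdot> w = g"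
begin

sublocale gp: internal_groupoid C "\<rho> A" W d c i inv mul by (rule gpd)

lemma w_Ar: "w \<in> Ar C" using w by simp

definition \<omega> where "\<omega> x y = w \<cdot> (\<eta> R \<cdot> pairR x y)"

lemma w_el:
  assumes "x \<in> Ar C" "Cod C x = \<rho> R"
  shows "d \<cdot> (w \<cdot> x) = \<Phi> p1 \<cdot> x" "c \<cdot> (w \<cdot> x) = \<Phi> p2 \<cdot> x"
  using w(4,5)[THEN comp_left_cong, OF assms(1)] assms w(2,3) w_Ar by (simp_all add: gp.ar)

sublocale cocycle C "\<rho> A" W d c i inv mul f "\<eta> A" p1 p2 A B \<omega>
proof
  fix x y k
  assume xy: "x \<in> Ar C" "y \<in> Ar C" "Dom C x = Dom C y" "Cod C x = A" "Cod C y = A" "f \<cdot> x = f \<cdot> y"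
  note P = R_pair[OF xy]
  show "\<omega> x y \<in> hom C (Dom C y) W \<and> d \<cdot> \<omega> x y = \<eta> A \<cdot> x \<and> c \<cdot> \<omega> x y = \<eta> A \<cdot> y"
    using P w(2,3) w_Ar by (simp add: \<omega>_def kernel_simps w_el)
  show "k \<in> Ar C \<Longrightarrow> Cod C k = Dom C y \<Longrightarrow> \<omega> x y \<cdot> k = \<omega> (x \<cdot> k) (y \<cdot> k)"
    using P w(2,3) w_Ar by (simp add: \<omega>_def kernel_simps)
  fix z assume z: "z \<in> Ar C" "Dom C y = Dom C z" "Cod C z = A" "f \<cdot> y = f \<cdot> z"
  have yz: "p2 \<cdot> pairR x y = p1 \<cdot> pairR y z"
    using xy z by (simp add: R_pair)
  define h where "h = pairR3 (pairR x y) (pairR y z)"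
  have h: "h \<in> Ar C" "Dom C h = Dom C z" "Cod C h = R3" "s1 \<cdot> h = pairR x y" "s2 \<cdot> h = pairR y z"
    unfolding h_def by (subst R3_pair; simp add: xy z yz R_pair)+
  have "compose \<cdot> h = pairR x z"
    by (rule R_eqI) (use h xy z in \<open>simp_all add: p_el compose(1-3) R_pair\<close>)
  then show "mul (\<omega> x y) (\<omega> y z) = \<omega> x z"
    using mul_w[of "\<eta> R3 \<cdot> h"] h by (simp add: \<omega>_def kernel_simps compose(1-3))
qed (use exact f K in \<open>simp_all add: kernel_simps\<close>)

end

locale extension_pairs = extension_groupoid C X I \<eta> f p1 p2 s1 s2 A B R R3 W w d c i inv mul
  for C :: "('o, 'm) cat" (structure) and X I \<eta> f p1 p2 s1 s2 A B R R3 W w d c i inv mul +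
  fixes t1 t2 :: 'm and T :: 'o
  assumes T: "is_pullback C t1 t2 (\<eta> A) d" "Dom C t1 = T"

sublocale extension_pairs \<subseteq> cocycle_pairs C "\<rho> A" W d c i inv mul f "\<eta> A" p1 p2 A B \<omega> t1 t2 T
  by unfold_locales (rule T)+

locale extension_reflection = extension_pairs C X I \<eta> f p1 p2 s1 s2 A B R R3 W w d c i inv mul t1 t2 T
  for C :: "('o, 'm) cat" (structure) and X I \<eta> f p1 p2 s1 s2 A B R R3 W w d c i inv mul t1 t2 T +
  fixes q :: 'm and Q :: 'o
  assumes q: "regular_epi C q" "Dom C q = T" "Cod C q = Q"
    and q_kernel: "\<And>x y. \<lbrakk>x \<in> Ar C; y \<in> Ar C; Dom C x = Dom C y; Cod C x = T; Cod C y = T\<rbrakk> \<Longrightarrow>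
      q \<cdot> x = q \<cdot> y \<longleftrightarrow> related x y"

sublocale extension_reflection \<subseteq> cocycle_quotient C "\<rho> A" W d c i inv mul f "\<eta> A" p1 p2 A B \<omega> t1 t2 T q Q
  by unfold_locales (use q q_kernel in simp_all)

context extension_reflection
begin

text \<open>Since the bundle is principal, the kernel pair projection of \<open>fbar\<close> is a pullback of the source
  arrow of the groupoid, which is a split epimorphism of the subcategory.\<close>

lemma fbar_special: "special C (trivial_points C I \<eta>) fbar"
proof -
  obtain z1 z2 where Z: "is_pullback C z1 z2 cbar d"
    using pullback[of cbar d] cbar(1,3) gp.ar(1,3) by metis
  interpret act: cocycle_action C "\<rho> A" W d c i inv mul f "\<eta> A" p1 p2 A B \<omega> t1 t2 T q Q z1 z2 "Dom C z1"
    by unfold_locales (simp_all add: Z)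
  obtain \<alpha> where \<alpha>: "\<alpha> \<in> Ar C" "Dom C \<alpha> = Dom C z1" "Cod C \<alpha> = Q"
    "\<And>s x. \<lbrakk>s \<in> Ar C; x \<in> Ar C; Dom C s = Dom C x; Cod C s = Dom C z1; Cod C x = T; z1 \<cdot> s = q \<cdot> x\<rbrakk> \<Longrightarrow>
      \<alpha> \<cdot> s = q \<cdot> pair t1 t2 (t1 \<cdot> x) (mul (t2 \<cdot> x) (z2 \<cdot> s))"
    using act.action by blast
  obtain \<delta> where \<delta>: "\<delta> \<in> Ar C" "Dom C \<delta> = Q" "Cod C \<delta> = Dom C z1" "z1 \<cdot> \<delta> = Id C Q" "\<alpha> \<cdot> \<delta> = Id C Q"
    using act.diagonal[OF \<alpha>] by blast
  have "is_kernel_pair C z1 \<alpha> fbar"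
    unfolding is_kernel_pair_def by (rule act.kernel_pair_fbar[OF \<alpha>])
  moreover have "trivial_extension C I \<eta> z1"
    by (rule pullback_of_sub_split_epi_trivial[OF Z, of i]) (simp_all add: gp.ar gp.graph W kernel_simps)
  ultimately show ?thesis
    unfolding special_def trivial_points_def is_point_def
    by (intro exI[of _ z1] exI[of _ \<alpha>] exI[of _ \<delta>]) (simp add: \<delta> act.Z_simps(1,5) fbar(2))
qed

text \<open>The unit of the reflection at \<open>f\<close>: an element \<open>x\<close> goes to the class of \<open>(x, 1)\<close>.\<close>

definition u where "u = q \<cdot> pair t1 t2 (Id C A) (i \<cdot> \<eta> A)"

lemma u: "u \<in> Ar C" "Dom C u = A" "Cod C u = Q"
  by (simp_all add: u_def T_pair kernel_simps gp.ar gp.graph_el q q_simps)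

lemma u_el: "x \<in> Ar C \<Longrightarrow> Cod C x = A \<Longrightarrow> u \<cdot> x = q \<cdot> pair t1 t2 x (i \<cdot> (\<eta> A \<cdot> x))"
  by (simp add: u_def T_pair kernel_simps gp.ar gp.graph_el q q_simps)

lemma fbar_u: "fbar \<cdot> u = f"
  using bar_el(1)[of "pair t1 t2 (Id C A) (i \<cdot> \<eta> A)"]
  by (simp add: u_def T_pair kernel_simps gp.ar gp.graph_el T_simps f(2))

lemma pair_R_id: "pairR p1 p2 = Id C R"
  by (rule R_eqI) (simp_all add: R_pair R_comm kernel_simps)

text \<open>Since \<open>\<omega> x y 1 = \<omega> x y\<close>, the pairs \<open>(x, \<omega> x y)\<close> and \<open>(y, 1)\<close> are related.\<close>

lemma u_p2: "u \<cdot> p2 = q \<cdot> pair t1 t2 p1 (w \<cdot> \<eta> R)"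
proof -
  have "\<omega> p1 p2 = w \<cdot> \<eta> R" by (simp add: \<omega>_def pair_R_id kernel_simps w(2) w_Ar)
  then have om: "\<omega> p1 p2 = w \<cdot> \<eta> R" "d \<cdot> (w \<cdot> \<eta> R) = \<eta> A \<cdot> p1" "c \<cdot> (w \<cdot> \<eta> R) = \<eta> A \<cdot> p2"
    by (simp_all add: w_el kernel_simps)
  have "mul (w \<cdot> \<eta> R) (i \<cdot> (\<eta> A \<cdot> p2)) = w \<cdot> \<eta> R"
    using gp.mul_unit(2)[of "w \<cdot> \<eta> R"] om by (simp add: w(2,3) w_Ar kernel_simps)
  then have "related (pair t1 t2 p1 (w \<cdot> \<eta> R)) (pair t1 t2 p2 (i \<cdot> (\<eta> A \<cdot> p2)))"
    by (simp add: related_def T_pair om kernel_simps gp.ar gp.graph_el w(2,3) w_Ar R_comm)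
  then have "q \<cdot> pair t1 t2 p1 (w \<cdot> \<eta> R) = q \<cdot> pair t1 t2 p2 (i \<cdot> (\<eta> A \<cdot> p2))"
    by (subst q_kernel) (simp_all add: T_pair om kernel_simps gp.ar gp.graph_el w(2,3) w_Ar)
  then show ?thesis by (simp add: u_el kernel_simps)
qed

lemma t2_universal: "universal t2"
proof -
  interpret sub: plain_category D by (rule plain_category_sub)
  have "regular_epi D d"
    by (rule sub.split_epi_regular[of d i]) (simp_all add: gp.ar gp.graph W kernel_simps)
  then show ?thesis by (rule pullback_universal[OF kernel_simps(2) _ T(1)])
qed

end

locale extension_reflection_target = 
  extension_reflection C X I \<eta> f p1 p2 s1 s2 A B R R3 W w d c i inv mul t1 t2 T q Q +
  special_target C X I \<eta> f p1 p2 s1 s2 A B R R3 g a b p1' p2' \<delta>' s1' s2' A' B' R' R3'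
  for C :: "('o, 'm) cat" (structure) and X I \<eta> f p1 p2 s1 s2 A B R R3 W w d c i inv mul t1 t2 T q Q
    g a b p1' p2' \<delta>' s1' s2' A' B' R' R3'
begin

text \<open>A factorisation \<open>z\<close> corresponds to the arrow \<open>\<theta> : T \<rightarrow> R'\<close> with components \<open>a \<cdot> t1\<close> and \<open>z \<cdot> q\<close>. By
  triviality of \<open>p1'\<close> this \<open>\<theta>\<close> is determined by its image in \<open>\<rho> R'\<close>, which factors through the universal
  arrow \<open>t2\<close> as some \<open>\<psi> : W \<rightarrow> \<rho> R'\<close>. Restricting to the pairs \<open>(x, \<omega> x y)\<close> shows \<open>\<psi> \<cdot> w = \<Phi> r\<close>, and \<open>w\<close> is
  an epimorphism.\<close>

lemma factorisation_unique:
  assumes x: "x \<in> Ar C" "Dom C x = Q" "Cod C x = A'" "x \<cdot> u = a" "g \<cdot> x = b \<cdot> fbar"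
    and y: "y \<in> Ar C" "Dom C y = Q" "Cod C y = A'" "y \<cdot> u = a" "g \<cdot> y = b \<cdot> fbar"
  shows "x = y"
proof -
  have main: "\<exists>\<theta> \<psi>. \<theta> \<in> Ar C \<and> Dom C \<theta> = T \<and> Cod C \<theta> = R' \<and> p1' \<cdot> \<theta> = a \<cdot> t1 \<and> p2' \<cdot> \<theta> = z \<cdot> q \<and>
      \<psi> \<in> Ar C \<and> Dom C \<psi> = W \<and> Cod C \<psi> = \<rho> R' \<and> \<eta> R' \<cdot> \<theta> = \<psi> \<cdot> t2 \<and> \<psi> \<cdot> w = \<Phi> r"
    if z: "z \<in> Ar C" "Dom C z = Q" "Cod C z = A'" "z \<cdot> u = a" "g \<cdot> z = b \<cdot> fbar" for z
  proof -
    have gz: "g \<cdot> (a \<cdot> t1) = g \<cdot> (z \<cdot> q)"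
      using comp_left_cong[OF z(5), of q] z(1-3)
      by (simp add: square_el T_simps q q_simps g b fbar)
    define \<theta> where "\<theta> = pair p1' p2' (a \<cdot> t1) (z \<cdot> q)"
    have \<theta>: "\<theta> \<in> Ar C" "Dom C \<theta> = T" "Cod C \<theta> = R'" "p1' \<cdot> \<theta> = a \<cdot> t1" "p2' \<cdot> \<theta> = z \<cdot> q"
      unfolding \<theta>_def by (subst R'_pair; simp add: a T_simps z(1-3) q q_simps gz)+
    have t2X: "Cod C t2 = W" "t2 \<in> Ar C" "Dom C t2 = T" by (simp_all add: T_simps)
    obtain \<psi> where \<psi>: "\<psi> \<in> Ar C" "Dom C \<psi> = W" "Cod C \<psi> = \<rho> R'" "\<psi> \<cdot> t2 = \<eta> R' \<cdot> \<theta>"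
      by (rule universal_extend[OF t2_universal, of "\<eta> R' \<cdot> \<theta>"])
        (use \<theta>(1-3) t2X target_simps that in auto)
    \<comment> \<open>The family of all pairs \<open>(x, \<omega> x y)\<close>, whose classes are those of
      \<open>(y, 1)\<close>.\<close>
    define j where "j = pair t1 t2 p1 (w \<cdot> \<eta> R)"
    have j: "j \<in> Ar C" "Dom C j = R" "Cod C j = T" "t1 \<cdot> j = p1" "t2 \<cdot> j = w \<cdot> \<eta> R"
      unfolding j_def by (subst T_pair; simp add: kernel_simps w(2,3) w_Ar w_el)+
    have qj: "q \<cdot> j = u \<cdot> p2" by (simp add: u_p2 j_def)
    have "\<theta> \<cdot> j = r"
    proof (rule R'_eqI)
      show "p1' \<cdot> (\<theta> \<cdot> j) = p1' \<cdot> r"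
        using comp_left_cong[OF \<theta>(4), of j] \<theta>(1-3) j r by (simp add: target_simps T_simps a)
      show "p2' \<cdot> (\<theta> \<cdot> j) = p2' \<cdot> r"
        using comp_left_cong[OF \<theta>(5), of j] comp_left_cong[OF z(4), of p2] \<theta>(1-3) j(1-3) r z(1-3) qj u
        by (simp add: target_simps q q_simps kernel_simps)
    qed (use \<theta>(1-3) j(1-3) r(1-3) in simp_all)
    then have "(\<psi> \<cdot> w) \<cdot> \<eta> R = \<Phi> r \<cdot> \<eta> R"
      using comp_left_cong[OF \<psi>(4), of j] \<psi>(1-3) \<theta>(1-3) j r(1-3)
      by (simp add: T_simps target_simps kernel_simps w(2,3) w_Ar)
    then have "\<psi> \<cdot> w = \<Phi> r"
      by (rule unit_cancel) (simp_all add: \<psi>(1-3) w(2,3) w_Ar r(1-3) kernel_simps target_simps)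
    then show ?thesis using \<theta> \<psi>(1-3) \<psi>(4)[symmetric] by blast
  qed
  obtain \<theta> \<psi> where 1: "\<theta> \<in> Ar C" "Dom C \<theta> = T" "Cod C \<theta> = R'" "p1' \<cdot> \<theta> = a \<cdot> t1" "p2' \<cdot> \<theta> = x \<cdot> q"
    "\<psi> \<in> Ar C" "Dom C \<psi> = W" "Cod C \<psi> = \<rho> R'" "\<eta> R' \<cdot> \<theta> = \<psi> \<cdot> t2" "\<psi> \<cdot> w = \<Phi> r"
    using main[OF x] by blast
  obtain \<theta>' \<psi>' where 2: "\<theta>' \<in> Ar C" "Dom C \<theta>' = T" "Cod C \<theta>' = R'" "p1' \<cdot> \<theta>' = a \<cdot> t1" "p2' \<cdot> \<theta>' = y \<cdot> q"
    "\<psi>' \<in> Ar C" "Dom C \<psi>' = W" "Cod C \<psi>' = \<rho> R'" "\<eta> R' \<cdot> \<theta>' = \<psi>' \<cdot> t2" "\<psi>' \<cdot> w = \<Phi> r"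
    using main[OF y] by blast
  have "\<psi> = \<psi>'"
    by (rule regular_epi_cancel[OF w(1)]) (simp_all add: 1(6-8,10) 2(6-8,10) w)
  then have "\<theta> = \<theta>'"
    by - (rule pullback_eqI[OF trivial]; simp add: 1(1-4,9) 2(1-4,9) target_simps)
  then have "x \<cdot> q = y \<cdot> q" using 1(5) 2(5) by simp
  then show ?thesis
    by (rule regular_epi_cancel[OF q(1)]) (simp_all add: x(1-3) y(1-3) q)
qed

text \<open>The functor \<open>\<Phi> r\<close> extends to \<open>\<Psi> : W \<rightarrow> \<rho> R'\<close> by universality of \<open>w\<close>. The pair \<open>(x, v)\<close> is sent to the
  second component of the element of \<open>R'\<close> whose first component is \<open>a x\<close> and whose image in \<open>\<rho> R'\<close> is
  \<open>\<Psi> v\<close>. That this respects the relation on \<open>T\<close> is the functoriality of \<open>\<Psi>\<close>.\<close>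

lemma factorisation_exists:
  "\<exists>x. x \<in> Ar C \<and> Dom C x = Q \<and> Cod C x = A' \<and> x \<cdot> u = a \<and> g \<cdot> x = b \<cdot> fbar"
proof -
  have \<Phi>r: "\<Phi> r \<in> Ar C" "Dom C (\<Phi> r) = \<rho> R" "Cod C (\<Phi> r) = \<rho> R'"
    using r(1-3) by simp_all
  obtain \<Psi> where \<Psi>: "\<Psi> \<in> Ar C" "Dom C \<Psi> = W" "Cod C \<Psi> = \<rho> R'" "\<Psi> \<cdot> w = \<Phi> r"
    using w_universal[of "\<Phi> r"] reflected_functor_compatible \<Phi>r target_simps(15) reflector_simps(1)
    by metis
  have \<Psi>_el: "\<Psi> \<cdot> (w \<cdot> x) = \<Phi> r \<cdot> x" if "x \<in> Ar C" "Cod C x = \<rho> R" for x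
    using comp_left_cong[OF \<Psi>(4), of x] that \<Psi>(1-3) w(2,3) w_Ar by simp
  have \<Phi>p1'\<Psi>: "\<Phi> p1' \<cdot> \<Psi> = \<Phi> a \<cdot> d"
  proof (rule regular_epi_cancel[OF w(1)])
    have "\<Phi> p1' \<cdot> \<Phi> r = \<Phi> a \<cdot> \<Phi> p1"
      using reflect_eq[OF r(4)] r(1-3) a by (simp add: target_simps kernel_simps)
    then show "(\<Phi> p1' \<cdot> \<Psi>) \<cdot> w = (\<Phi> a \<cdot> d) \<cdot> w"
      using \<Psi> w w_Ar a by (simp add: target_simps kernel_simps gp.ar)
  qed (use \<Psi>(1-3) w a in \<open>simp_all add: target_simps kernel_simps gp.ar\<close>)
  have \<Psi>_mul: "\<Phi> compose' \<cdot> k = \<Psi> \<cdot> mul x y"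
    if xy: "x \<in> Ar C" "y \<in> Ar C" "Dom C x = Dom C y" "Cod C x = W" "Cod C y = W" "c \<cdot> x = d \<cdot> y"
      and k: "k \<in> Ar C" "Dom C k = Dom C y" "Cod C k = \<rho> R3'" "\<Phi> s1' \<cdot> k = \<Psi> \<cdot> x" "\<Phi> s2' \<cdot> k = \<Psi> \<cdot> y"
    for x y k
  proof -
    obtain e h where e: "regular_epi C e" "Cod C e = Dom C y" "h \<in> Ar C" "Dom C h = Dom C e" "Cod C h = \<rho> R3"
      "w \<cdot> (\<Phi> s1 \<cdot> h) = x \<cdot> e" "w \<cdot> (\<Phi> s2 \<cdot> h) = y \<cdot> e"
      using w_cover[OF xy] by blast
    have eA: "e \<in> Ar C" using e(1) by simp
    have 1: "\<Phi> s1' \<cdot> (k \<cdot> e) = \<Phi> r \<cdot> (\<Phi> s1 \<cdot> h)" "\<Phi> s2' \<cdot> (k \<cdot> e) = \<Phi> r \<cdot> (\<Phi> s2 \<cdot> h)"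
      using comp_left_cong[OF k(4), of e] comp_left_cong[OF k(5), of e] xy k(1-3) e(2-5) eA \<Psi>(1-3)
        \<Psi>_el[of "\<Phi> s1 \<cdot> h"] \<Psi>_el[of "\<Phi> s2 \<cdot> h"] e(6,7)
      by (simp_all add: target_simps kernel_simps)
    have "\<Phi> compose' \<cdot> (k \<cdot> e) = \<Phi> r \<cdot> (\<Phi> compose \<cdot> h)"
      by (rule reflected_functor) (use e(2-5) eA k(1-3) xy(3) 1 in simp_all)
    also have "\<dots> = \<Psi> \<cdot> (w \<cdot> (\<Phi> compose \<cdot> h))"
      using e(3-5) by (simp add: \<Psi>_el compose(1-3) kernel_simps)
    also have "\<dots> = \<Psi> \<cdot> (mul x y \<cdot> e)"
      using mul_w[OF e(3,5)] e(2-7) eA xy by (simp add: gp.mul_simps)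
    finally have "(\<Phi> compose' \<cdot> k) \<cdot> e = (\<Psi> \<cdot> mul x y) \<cdot> e"
      using xy k(1-3) e(2) eA \<Psi>(1-3) by (simp add: gp.mul_simps compose'(1-3) target_simps)
    then show ?thesis
      by (rule regular_epi_cancel[OF e(1)])
        (use xy k(1-3) e(2) \<Psi>(1-3) in \<open>simp_all add: gp.mul_simps compose'(1-3) target_simps\<close>)
  qed
  define \<theta> where "\<theta> = pair p1' (\<eta> R') (a \<cdot> t1) (\<Psi> \<cdot> t2)"
  have comm: "\<eta> A' \<cdot> (a \<cdot> t1) = \<Phi> p1' \<cdot> (\<Psi> \<cdot> t2)"
  proof -
    have "\<Phi> p1' \<cdot> (\<Psi> \<cdot> t2) = (\<Phi> a \<cdot> d) \<cdot> t2"
      by (rule comp_left_cong[OF \<Phi>p1'\<Psi>]) (simp_all add: T_simps \<Psi>(1-3) target_simps)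
    then show ?thesis by (simp add: T_simps a gp.ar kernel_simps T_comm)
  qed
  have \<theta>: "\<theta> \<in> Ar C" "Dom C \<theta> = T" "Cod C \<theta> = R'" "p1' \<cdot> \<theta> = a \<cdot> t1" "\<eta> R' \<cdot> \<theta> = \<Psi> \<cdot> t2"
    unfolding \<theta>_def by (subst pair[OF trivial]; simp add: T_simps \<Psi>(1-3) a target_simps comm)+
  have \<theta>_el: "p1' \<cdot> (\<theta> \<cdot> x) = a \<cdot> (t1 \<cdot> x)" "\<eta> R' \<cdot> (\<theta> \<cdot> x) = \<Psi> \<cdot> (t2 \<cdot> x)" if "x \<in> Ar C" "Cod C x = T" for x
    using \<theta>(4,5)[THEN comp_left_cong, of x] that \<theta>(1-3) by (simp_all add: T_simps target_simps a \<Psi>(1-3))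
  have compat: "p2' \<cdot> (\<theta> \<cdot> x) = p2' \<cdot> (\<theta> \<cdot> y)"
    if xy: "x \<in> Ar C" "y \<in> Ar C" "Dom C x = Dom C y" "Cod C x = T" "Cod C y = T"
      "f \<cdot> (t1 \<cdot> x) = f \<cdot> (t1 \<cdot> y)" "t2 \<cdot> x = mul (\<omega> (t1 \<cdot> x) (t1 \<cdot> y)) (t2 \<cdot> y)" for x y
  proof -
    define v where "v = r \<cdot> pairR (t1 \<cdot> x) (t1 \<cdot> y)"
    have v: "v \<in> Ar C" "Dom C v = Dom C y" "Cod C v = R'" "p1' \<cdot> v = a \<cdot> (t1 \<cdot> x)" "p2' \<cdot> v = a \<cdot> (t1 \<cdot> y)"
      "\<eta> R' \<cdot> v = \<Psi> \<cdot> \<omega> (t1 \<cdot> x) (t1 \<cdot> y)"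
      unfolding v_def \<omega>_def using xy(1-6) r(1-3)
      by (simp_all add: R_pair T_simps r_el \<Psi>_el kernel_simps)
    \<comment> \<open>The composite in \<open>R'\<close> of \<open>(a x, a y)\<close> with the value of
      \<open>\<theta>\<close> at \<open>y\<close> is the value of \<open>\<theta>\<close> at \<open>x\<close>;
      both have the same second component.\<close>
    define k where "k = pair s1' s2' v (\<theta> \<cdot> y)"
    have k: "k \<in> Ar C" "Dom C k = Dom C y" "Cod C k = R3'" "s1' \<cdot> k = v" "s2' \<cdot> k = \<theta> \<cdot> y"
      unfolding k_def by (subst R3'_pair; simp add: v xy(1-5) \<theta>(1-3) \<theta>_el)+
    have "\<Phi> compose' \<cdot> (\<eta> R3' \<cdot> k) = \<Psi> \<cdot> mul (\<omega> (t1 \<cdot> x) (t1 \<cdot> y)) (t2 \<cdot> y)"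
      by (rule \<Psi>_mul)
        (use xy(1-6) k v(6) \<theta>_el(2)[of y] in \<open>simp_all add: omega_simps T_simps target_simps T_comm\<close>)
    then have e: "\<eta> R' \<cdot> (compose' \<cdot> k) = \<eta> R' \<cdot> (\<theta> \<cdot> x)"
      using xy(1,4) k(1-3) by (simp add: compose'(1-3) xy(7)[symmetric] \<theta>_el)
    have "compose' \<cdot> k = \<theta> \<cdot> x"
    proof (rule pullback_eqI[OF trivial _ e])
      show "p1' \<cdot> (compose' \<cdot> k) = p1' \<cdot> (\<theta> \<cdot> x)"
        using k v(4) xy(1,4) by (simp add: compose'_el \<theta>_el)
    qed (use k(1-3) xy(1-5) \<theta>(1-3) in \<open>simp_all add: compose'(1-3) target_simps\<close>)
    then have "p2' \<cdot> (\<theta> \<cdot> x) = p2' \<cdot> (compose' \<cdot> k)" by simp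
    also have "\<dots> = p2' \<cdot> (\<theta> \<cdot> y)" using k by (simp add: compose'_el)
    finally show ?thesis .
  qed
  have typ2: "p2' \<cdot> \<theta> \<in> Ar C" "Dom C (p2' \<cdot> \<theta>) = T" "Cod C (p2' \<cdot> \<theta>) = A'"
    using \<theta>(1-3) by (simp_all add: target_simps)
  define x where "x = descended (p2' \<cdot> \<theta>)"
  have x: "x \<in> Ar C" "Dom C x = Q" "Cod C x = A'" "x \<cdot> q = p2' \<cdot> \<theta>"
    using descended[OF typ2(1,2)] compat typ2 \<theta>(1-3) unfolding x_def by (simp_all add: target_simps)
  have "x \<cdot> u = a"
  proof -
    define y where "y = pair t1 t2 (Id C A) (i \<cdot> \<eta> A)"
    have y: "y \<in> Ar C" "Dom C y = A" "Cod C y = T" "t1 \<cdot> y = Id C A" "t2 \<cdot> y = i \<cdot> \<eta> A"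
      unfolding y_def by (subst T_pair; simp add: kernel_simps gp.ar gp.graph_el)+
    have i\<eta>: "i \<cdot> \<eta> A = w \<cdot> (\<eta> R \<cdot> diag)"
      by (simp add: i_def diag kernel_simps w(2,3) w_Ar)
    have "\<theta> \<cdot> y = r \<cdot> diag"
    proof (rule pullback_eqI[OF trivial])
      show "p1' \<cdot> (\<theta> \<cdot> y) = p1' \<cdot> (r \<cdot> diag)"
        using y by (simp add: \<theta>_el r_el diag)
      show "\<eta> R' \<cdot> (\<theta> \<cdot> y) = \<eta> R' \<cdot> (r \<cdot> diag)"
        using y by (simp add: \<theta>_el i\<eta> \<Psi>_el diag kernel_simps r(1-3))
    qed (use y \<theta>(1-3) in \<open>simp_all add: r(1-3) diag(1-3) target_simps\<close>)
    then have "p2' \<cdot> (\<theta> \<cdot> y) = a" by (simp add: r_el diag a)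
    moreover have "x \<cdot> (q \<cdot> y) = (p2' \<cdot> \<theta>) \<cdot> y"
      by (rule comp_left_cong[OF x(4)]) (simp_all add: y x q q_simps)
    ultimately show ?thesis
      using y \<theta>(1-3) by (simp add: u_def y_def[symmetric] target_simps)
  qed
  moreover have "g \<cdot> x = b \<cdot> fbar"
  proof (rule regular_epi_cancel[OF q(1)])
    have "g \<cdot> (p2' \<cdot> \<theta>) = g \<cdot> (a \<cdot> t1)"
      using R'_comm(1)[of \<theta>] \<theta> by simp
    then show "(g \<cdot> x) \<cdot> q = (b \<cdot> fbar) \<cdot> q"
      using x by (simp add: g b fbar q q_simps square_el T_simps)
  qed (use x in \<open>simp_all add: g b fbar q\<close>)
  ultimately show ?thesis using x by blast
qed

end

text \<open>The principal bundle of the cocycle is a universal special extension under \<open>f\<close>. The codomain is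
  kept: a morphism to a special \<open>g\<close> over any \<open>b\<close> factors uniquely through it over the same \<open>b\<close>.\<close>

theorem (in protomodular_reflection) special_reflection:
  assumes exact: "barr_exact C" and f: "regular_epi C f"
  obtains h u where "regular_epi C h" "special C (trivial_points C I \<eta>) h" "Cod C h = Cod C f"
    "u \<in> Ar C" "Dom C u = Dom C f" "Cod C u = Dom C h" "h \<cdot> u = f"
    "\<And>g a b. \<lbrakk>special C (trivial_points C I \<eta>) g; a \<in> hom C (Dom C f) (Dom C g);
      b \<in> hom C (Cod C f) (Cod C g); g \<cdot> a = b \<cdot> f\<rbrakk> \<Longrightarrow>
      \<exists>!x. x \<in> hom C (Dom C h) (Dom C g) \<and> x \<cdot> u = a \<and> g \<cdot> x = b \<cdot> h"
proof -
  have fA: "f \<in> Ar C" using f by simp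
  obtain p1 p2 where K: "is_pullback C p1 p2 f f" using pullback[OF fA fA] by blast
  note KD = pullbackD[OF K]
  obtain s1 s2 where S: "is_pullback C s1 s2 p2 p1" using pullback[of p2 p1] KD by metis
  interpret ek: extension_kernel C X I \<eta> f p1 p2 s1 s2 "Dom C f" "Cod C f" "Dom C p1" "Dom C s1"
    by unfold_locales (use exact f K S in simp_all)
  obtain W w d c inv mul where W: "internal_groupoid C (\<rho> (Dom C f)) W d c (w \<cdot> \<Phi> ek.diag) inv mul"
    "W \<in> X" "regular_epi C w" "Dom C w = \<rho> (Dom C p1)" "Cod C w = W" "d \<cdot> w = \<Phi> p1" "c \<cdot> w = \<Phi> p2"
    "\<And>h. h \<in> Ar C \<Longrightarrow> Cod C h = \<rho> (Dom C s1) \<Longrightarrow>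
      mul (w \<cdot> (\<Phi> s1 \<cdot> h)) (w \<cdot> (\<Phi> s2 \<cdot> h)) = w \<cdot> (\<Phi> ek.compose \<cdot> h)"
    "\<And>x y. \<lbrakk>x \<in> Ar C; y \<in> Ar C; Dom C x = Dom C y; Cod C x = W; Cod C y = W; c \<cdot> x = d \<cdot> y\<rbrakk> \<Longrightarrow>
      \<exists>e h. regular_epi C e \<and> Cod C e = Dom C y \<and> h \<in> Ar C \<and> Dom C h = Dom C e \<and> Cod C h = \<rho> (Dom C s1) \<and>
        w \<cdot> (\<Phi> s1 \<cdot> h) = x \<cdot> e \<and> w \<cdot> (\<Phi> s2 \<cdot> h) = y \<cdot> e"
    "\<And>g. \<lbrakk>g \<in> Ar C; Dom C g = \<rho> (Dom C p1); Cod C g \<in> X;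
      \<forall>h h'. h \<in> Ar C \<and> h' \<in> Ar C \<and> Dom C h = Dom C h' \<and> Cod C h = \<rho> (Dom C s1) \<and> Cod C h' = \<rho> (Dom C s1) \<and>
        \<Phi> s1 \<cdot> h = \<Phi> s1 \<cdot> h' \<and> \<Phi> s2 \<cdot> h = \<Phi> s2 \<cdot> h' \<longrightarrow>
        g \<cdot> (\<Phi> ek.compose \<cdot> h) = g \<cdot> (\<Phi> ek.compose \<cdot> h')\<rbrakk> \<Longrightarrow>
      \<exists>g'. g' \<in> Ar C \<and> Dom C g' = W \<and> Cod C g' = Cod C g \<and> g' \<cdot> w = g"
    by (rule multivalued_groupoid.generated_groupoid_exists[OF ek.reflected_multivalued_groupoid])
      (rule that; assumption)
  interpret eg: extension_groupoid C X I \<eta> f p1 p2 s1 s2 "Dom C f" "Cod C f" "Dom C p1" "Dom C s1"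
      W w d c "w \<cdot> \<Phi> ek.diag" inv mul
    by (rule extension_groupoid.intro[OF ek.extension_kernel_axioms], rule extension_groupoid_axioms.intro)
      (rule W refl; assumption?)+
  obtain t1 t2 where T: "is_pullback C t1 t2 (\<eta> (Dom C f)) d"
    using pullback[of "\<eta> (Dom C f)" d] eg.gp.ar fA by auto
  interpret ep: extension_pairs C X I \<eta> f p1 p2 s1 s2 "Dom C f" "Cod C f" "Dom C p1" "Dom C s1"
      W w d c "w \<cdot> \<Phi> ek.diag" inv mul t1 t2 "Dom C t1"
    by unfold_locales (use T in simp_all)
  obtain q where q: "regular_epi C q" "Dom C q = Dom C t1"
    and q_kernel: "\<And>x y. \<lbrakk>x \<in> Ar C; y \<in> Ar C; Dom C x = Dom C y; Cod C x = Dom C t1; Cod C y = Dom C t1\<rbrakk> \<Longrightarrow>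
      q \<cdot> x = q \<cdot> y \<longleftrightarrow> ep.related x y"
    by (rule ep.quotient) (rule that; assumption)
  interpret er: extension_reflection C X I \<eta> f p1 p2 s1 s2 "Dom C f" "Cod C f" "Dom C p1" "Dom C s1"
      W w d c "w \<cdot> \<Phi> ek.diag" inv mul t1 t2 "Dom C t1" q "Cod C q"
    by unfold_locales (use q q_kernel in simp_all)
  show ?thesis
  proof (rule that)
    show "regular_epi C er.fbar" "special C (trivial_points C I \<eta>) er.fbar" "Cod C er.fbar = Cod C f"
      "er.u \<in> Ar C" "Dom C er.u = Dom C f" "Cod C er.u = Dom C er.fbar" "er.fbar \<cdot> er.u = f"
      using er.fbar_regular_epi er.fbar_special er.fbar(2,3) er.u er.fbar_u by simp_all
    fix g a b
    assume g: "special C (trivial_points C I \<eta>) g" and a: "a \<in> hom C (Dom C f) (Dom C g)"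
      and b: "b \<in> hom C (Cod C f) (Cod C g)" and sq: "g \<cdot> a = b \<cdot> f"
    obtain p1' p2' \<delta>' where K': "is_pullback C p1' p2' g g" "\<delta>' \<in> Ar C" "Dom C \<delta>' = Dom C g"
      "Cod C \<delta>' = Dom C p1'" "p1' \<cdot> \<delta>' = Id C (Dom C g)" "p2' \<cdot> \<delta>' = Id C (Dom C g)"
      "trivial_extension C I \<eta> p1'"
      using g unfolding special_def is_kernel_pair_def trivial_points_def by auto
    note K'D = pullbackD[OF K'(1)]
    have tr: "is_pullback C p1' (\<eta> (Dom C p1')) (\<eta> (Dom C g)) (\<Phi> p1')"
      using K'(7) K'D(7) unfolding trivial_extension_def by simp
    obtain s1' s2' where S': "is_pullback C s1' s2' p2' p1'"
      using pullback[of p2' p1'] K'D by metis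
    interpret et: extension_reflection_target C X I \<eta> f p1 p2 s1 s2 "Dom C f" "Cod C f" "Dom C p1" "Dom C s1"
      W w d c "w \<cdot> \<Phi> ek.diag" inv mul t1 t2 "Dom C t1" q "Cod C q"
      g a b p1' p2' \<delta>' s1' s2' "Dom C g" "Cod C g" "Dom C p1'" "Dom C s1'"
      by unfold_locales (use K'D(1) a b sq K' tr S' in simp_all)
    obtain x where x: "x \<in> Ar C" "Dom C x = Cod C q" "Cod C x = Dom C g" "x \<cdot> er.u = a" "g \<cdot> x = b \<cdot> er.fbar"
      using et.factorisation_exists by blast
    show "\<exists>!x. x \<in> hom C (Dom C er.fbar) (Dom C g) \<and> x \<cdot> er.u = a \<and> g \<cdot> x = b \<cdot> er.fbar"
    proof (rule ex1I[of _ x])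
      fix y assume "y \<in> hom C (Dom C er.fbar) (Dom C g) \<and> y \<cdot> er.u = a \<and> g \<cdot> y = b \<cdot> er.fbar"
      then show "y = x"
        using et.factorisation_unique[of y x] x by (simp add: er.fbar(2))
    qed (use x in \<open>simp add: er.fbar(2)\<close>)
  qed
qed

section \<open>Reflections from universal arrows\<close>

text \<open>A universal arrow from each object suffices; the reflector is then determined on arrows by the
  universal property.\<close>

lemma (in plain_category) reflectiveI:
  assumes S: "S \<subseteq> Ob C"
    and un: "\<And>A. A \<in> Ob C \<Longrightarrow> \<exists>R u. R \<in> S \<and> u \<in> hom C A R \<and>
      (\<forall>Y\<in>S. \<forall>f\<in>hom C A Y. \<exists>!g. g \<in> hom C R Y \<and> g \<cdot> u = f)"
  shows "reflective C S"
proof -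
  obtain R u where Ru: "\<And>A. A \<in> Ob C \<Longrightarrow> R A \<in> S \<and> u A \<in> hom C A (R A) \<and>
      (\<forall>Y\<in>S. \<forall>f\<in>hom C A Y. \<exists>!g. g \<in> hom C (R A) Y \<and> g \<cdot> u A = f)"
    using un by metis
  have RS: "R A \<in> S" "R A \<in> Ob C" "u A \<in> Ar C" "Dom C (u A) = A" "Cod C (u A) = R A" if "A \<in> Ob C" for A
    using Ru[OF that] S by auto
  have ex: "\<exists>!g. g \<in> hom C (R A) Y \<and> g \<cdot> u A = f" if "A \<in> Ob C" "Y \<in> S" "f \<in> hom C A Y" for A Y f
    using Ru[OF that(1)] that(2,3) by blast
  have uniq: "g = h" if "A \<in> Ob C" "g \<in> Ar C" "h \<in> Ar C" "Dom C g = R A" "Dom C h = R A"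
      "Cod C h = Cod C g" "Cod C g \<in> S" "g \<cdot> u A = h \<cdot> u A" for A g h
  proof -
    have "g \<cdot> u A \<in> hom C A (Cod C g)" using that RS[OF that(1)] by simp
    from ex[OF that(1,7) this] show ?thesis using that by auto
  qed
  define m where "m f = (THE g. g \<in> hom C (R (Dom C f)) (R (Cod C f)) \<and> g \<cdot> u (Dom C f) = u (Cod C f) \<cdot> f)" for f
  have m: "m f \<in> Ar C" "Dom C (m f) = R (Dom C f)" "Cod C (m f) = R (Cod C f)"
      "m f \<cdot> u (Dom C f) = u (Cod C f) \<cdot> f" if f: "f \<in> Ar C" for f
  proof -
    have "u (Cod C f) \<cdot> f \<in> hom C (Dom C f) (R (Cod C f))"
      using f RS[of "Cod C f"] by simp
    then have "\<exists>!g. g \<in> hom C (R (Dom C f)) (R (Cod C f)) \<and> g \<cdot> u (Dom C f) = u (Cod C f) \<cdot> f"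
      using f RS[of "Cod C f"] by (intro ex) simp_all
    from theI'[OF this] show "m f \<in> Ar C" "Dom C (m f) = R (Dom C f)" "Cod C (m f) = R (Cod C f)"
      "m f \<cdot> u (Dom C f) = u (Cod C f) \<cdot> f"
      unfolding m_def by auto
  qed
  have "is_functor C (full_subcat C S) \<lparr>FOb = R, FAr = m\<rparr>"
    unfolding is_functor_def
  proof (intro conjI ballI impI)
    fix A assume A: "A \<in> Ob C"
    then show "FOb \<lparr>FOb = R, FAr = m\<rparr> A \<in> Ob (full_subcat C S)"
      using RS by (simp add: full_subcat_def)
    have "m (Id C A) = Id C (R A)"
      by (rule uniq[OF A]) (use A m[of "Id C A"] RS[OF A] in simp_all)
    then show "FAr \<lparr>FOb = R, FAr = m\<rparr> (Id C A) = Id (full_subcat C S) (FOb \<lparr>FOb = R, FAr = m\<rparr> A)"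
      by (simp add: full_subcat_def)
  next
    fix f assume f: "f \<in> Ar C"
    then show "FAr \<lparr>FOb = R, FAr = m\<rparr> f \<in> hom (full_subcat C S) (FOb \<lparr>FOb = R, FAr = m\<rparr> (Dom C f))
        (FOb \<lparr>FOb = R, FAr = m\<rparr> (Cod C f))"
      using m[OF f] RS[of "Dom C f"] RS[of "Cod C f"] by (simp add: full_subcat_def hom_def)
    fix g assume g: "g \<in> Ar C" and fg: "Cod C f = Dom C g"
    have "m (g \<cdot> f) = m g \<cdot> m f"
    proof (rule uniq[of "Dom C f"])
      have "m g \<cdot> (m f \<cdot> u (Dom C f)) = m g \<cdot> (u (Dom C g) \<cdot> f)"
        using m(4)[OF f] fg by simp
      also have "\<dots> = (u (Cod C g) \<cdot> g) \<cdot> f"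
        by (rule comp_left_cong[OF m(4)[OF g]]) (use m(1-3)[OF g] RS[of "Dom C g"] f g fg in simp_all)
      also have "\<dots> = u (Cod C g) \<cdot> (g \<cdot> f)"
        using RS[of "Cod C g"] f g fg by simp
      finally show "m (g \<cdot> f) \<cdot> u (Dom C f) = (m g \<cdot> m f) \<cdot> u (Dom C f)"
        using m[of "g \<cdot> f"] m(1-3)[OF f] m(1-3)[OF g] RS[of "Dom C f"] f g fg by simp
    qed (use m(1-3)[of "g \<cdot> f"] m(1-3)[OF f] m(1-3)[OF g] RS[of "Cod C g"] f g fg in simp_all)
    then show "FAr \<lparr>FOb = R, FAr = m\<rparr> (g \<cdot> f) =
        Comp (full_subcat C S) (FAr \<lparr>FOb = R, FAr = m\<rparr> g) (FAr \<lparr>FOb = R, FAr = m\<rparr> f)"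
      by (simp add: full_subcat_def)
  qed
  then have "reflector C S \<lparr>FOb = R, FAr = m\<rparr> u"
    unfolding reflector_def using S Ru m(4) by simp
  then show ?thesis unfolding reflective_def by blast
qed

lemma category_full_subcat:
  assumes "category C"
  shows "category (full_subcat C S)"
  using assms by (simp add: category_def full_subcat_def hom_def)

lemma (in plain_category) category_arrow_cat: "category (arrow_cat C)"
proof -
  have ar: "t \<in> Ar (arrow_cat C) \<longleftrightarrow> (\<exists>f g h k. t = (f, g, h, k) \<and> f \<in> Ar C \<and> g \<in> Ar C \<and>
      h \<in> Ar C \<and> Dom C h = Dom C f \<and> Cod C h = Dom C g \<and>
      k \<in> Ar C \<and> Dom C k = Cod C f \<and> Cod C k = Cod C g \<and> g \<cdot> h = k \<cdot> f)" for t
    by (auto simp: arrow_cat_def)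
  have comp: "g' \<cdot> (h' \<cdot> h) = k' \<cdot> (k \<cdot> f)"
    if "f \<in> Ar C" "g \<in> Ar C" "g' \<in> Ar C" "h \<in> Ar C" "h' \<in> Ar C" "k \<in> Ar C" "k' \<in> Ar C"
      "Dom C h = Dom C f" "Cod C h = Dom C g" "Dom C k = Cod C f" "Cod C k = Cod C g"
      "Dom C h' = Dom C g" "Cod C h' = Dom C g'" "Dom C k' = Cod C g" "Cod C k' = Cod C g'"
      "g \<cdot> h = k \<cdot> f" "g' \<cdot> h' = k' \<cdot> g" for f g g' h h' k k'
  proof -
    have "g' \<cdot> (h' \<cdot> h) = (k' \<cdot> g) \<cdot> h" using that by (intro comp_left_cong) simp_all
    also have "\<dots> = k' \<cdot> (g \<cdot> h)" using that(1-15) by simp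
    finally show ?thesis using that(16) by simp
  qed
  show ?thesis
    unfolding category_def
  proof (intro conjI ballI impI)
    fix t assume "t \<in> Ar (arrow_cat C)"
    then obtain f g h k where t: "t = (f, g, h, k)" "f \<in> Ar C" "g \<in> Ar C"
      "h \<in> Ar C" "Dom C h = Dom C f" "Cod C h = Dom C g"
      "k \<in> Ar C" "Dom C k = Cod C f" "Cod C k = Cod C g" "g \<cdot> h = k \<cdot> f"
      unfolding ar by blast
    show "Dom (arrow_cat C) t \<in> Ob (arrow_cat C)" "Cod (arrow_cat C) t \<in> Ob (arrow_cat C)"
      "Comp (arrow_cat C) t (Id (arrow_cat C) (Dom (arrow_cat C) t)) = t"
      "Comp (arrow_cat C) (Id (arrow_cat C) (Cod (arrow_cat C) t)) t = t"
      using t(2-9) by (simp_all add: t(1) arrow_cat_def)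
    fix t' assume "t' \<in> Ar (arrow_cat C)" and tt': "Cod (arrow_cat C) t = Dom (arrow_cat C) t'"
    then obtain f' g' h' k' where "t' = (f', g', h', k')" "f' \<in> Ar C" "g' \<in> Ar C"
      "h' \<in> Ar C" "Dom C h' = Dom C f'" "Cod C h' = Dom C g'"
      "k' \<in> Ar C" "Dom C k' = Cod C f'" "Cod C k' = Cod C g'" "g' \<cdot> h' = k' \<cdot> f'"
      unfolding ar by blast
    moreover from this(1) have "f' = g" using tt' t(1) by (simp add: arrow_cat_def)
    ultimately have t': "t' = (g, g', h', k')" "g' \<in> Ar C"
      "h' \<in> Ar C" "Dom C h' = Dom C g" "Cod C h' = Dom C g'"
      "k' \<in> Ar C" "Dom C k' = Cod C g" "Cod C k' = Cod C g'" "g' \<cdot> h' = k' \<cdot> g"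
      by simp_all
    have "g' \<cdot> (h' \<cdot> h) = k' \<cdot> (k \<cdot> f)"
      by (rule comp[of f g g']) (fact t t')+
    then show "Comp (arrow_cat C) t' t \<in> hom (arrow_cat C) (Dom (arrow_cat C) t) (Cod (arrow_cat C) t')"
      using t(2-9) t'(2-8) by (simp add: t(1) t'(1) arrow_cat_def hom_def)
    fix t'' assume "t'' \<in> Ar (arrow_cat C)" and tt'': "Cod (arrow_cat C) t' = Dom (arrow_cat C) t''"
    then obtain f'' g'' h'' k'' where t'': "t'' = (f'', g'', h'', k'')"
      "h'' \<in> Ar C" "Dom C h'' = Dom C f''" "k'' \<in> Ar C" "Dom C k'' = Cod C f''"
      unfolding ar by blast
    have "f'' = g'" using tt'' t'(1) t''(1) by (simp add: arrow_cat_def)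
    then show "Comp (arrow_cat C) (Comp (arrow_cat C) t'' t') t = Comp (arrow_cat C) t'' (Comp (arrow_cat C) t' t)"
      using t(2-9) t'(2-8) t''(2-) by (simp add: t(1) t'(1) t''(1) arrow_cat_def)
  next
    fix f assume "f \<in> Ob (arrow_cat C)"
    then show "Id (arrow_cat C) f \<in> hom (arrow_cat C) f f"
      by (simp add: arrow_cat_def hom_def)
  qed
qed

theorem theorem4p8:
  fixes C :: "('o, 'm) cat"
    and X :: "'o set"
    and I :: "('o, 'm, 'o, 'm) ftor"
    and \<eta> :: "'o \<Rightarrow> 'm"
  assumes "category C"
    and "finitely_complete C"
    and "barr_exact C"
    and "has_coequalisers_of_reflexive_graphs C"
    and "reflector C X I \<eta>"
    and "barr_exact (full_subcat C X)"
    and "\<And>f. regular_epi (full_subcat C X) f \<Longrightarrow> regular_epi C f"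
    and "admissible C X I \<eta>"
    and "protomodular_wrt C (trivial_points C I \<eta>)"
  shows "reflective
           (full_subcat (arrow_cat C) {f. regular_epi C f})
           {f. regular_epi C f \<and> special C (trivial_points C I \<eta>) f}"
proof -
  interpret protomodular_reflection C X I \<eta>
    by unfold_locales (use assms in \<open>simp_all add: barr_exact_def\<close>)
  let ?K = "full_subcat (arrow_cat C) {f. regular_epi C f}"
  let ?S = "{f. regular_epi C f \<and> special C (trivial_points C I \<eta>) f}"
  have hom_K: "t \<in> hom ?K f g \<longleftrightarrow> (\<exists>h k. t = (f, g, h, k) \<and> regular_epi C f \<and> regular_epi C g \<and>
      h \<in> hom C (Dom C f) (Dom C g) \<and> k \<in> hom C (Cod C f) (Cod C g) \<and> Comp C g h = Comp C k f)" for t f g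
    using regular_epi_Ar by (auto simp: full_subcat_def arrow_cat_def hom_def)
  have comp_K: "Comp ?K (g, g', h', k') (f, f', h, k) = (f, g', Comp C h' h, Comp C k' k)"
    for f f' h k g g' h' k'
    by (simp add: full_subcat_def arrow_cat_def)
  interpret K: plain_category ?K
    by unfold_locales (rule category_full_subcat[OF category_arrow_cat])
  show ?thesis
  proof (rule K.reflectiveI)
    show "?S \<subseteq> Ob ?K" by (auto simp: full_subcat_def arrow_cat_def)
    fix f assume "f \<in> Ob ?K"
    then have f: "regular_epi C f" by (simp add: full_subcat_def)
    obtain h u where h: "regular_epi C h" "special C (trivial_points C I \<eta>) h" "Cod C h = Cod C f"
      and u: "u \<in> Ar C" "Dom C u = Dom C f" "Cod C u = Dom C h" "Comp C h u = f"
      and un: "\<And>g a b. \<lbrakk>special C (trivial_points C I \<eta>) g; a \<in> hom C (Dom C f) (Dom C g);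
        b \<in> hom C (Cod C f) (Cod C g); Comp C g a = Comp C b f\<rbrakk> \<Longrightarrow>
        \<exists>!x. x \<in> hom C (Dom C h) (Dom C g) \<and> Comp C x u = a \<and> Comp C g x = Comp C b h"
      by (rule special_reflection[OF assms(3) f]) (rule that; assumption)
    let ?B = "Cod C f"
    let ?e = "(f, h, u, Id C ?B)"
    have B: "?B \<in> Ob C" using f by simp
    have e: "?e \<in> hom ?K f h"
      unfolding hom_K using h u f B by simp
    have "\<exists>!x. x \<in> hom ?K h g \<and> Comp ?K x ?e = t"
      if g: "g \<in> ?S" and t: "t \<in> hom ?K f g" for g t
    proof -
      obtain a b where ab: "t = (f, g, a, b)" "a \<in> hom C (Dom C f) (Dom C g)" "b \<in> hom C (Cod C f) (Cod C g)"
        "Comp C g a = Comp C b f"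
        using t unfolding hom_K by blast
      have ex1: "\<exists>!x. x \<in> hom C (Dom C h) (Dom C g) \<and> Comp C x u = a \<and> Comp C g x = Comp C b h"
        using g ab by (intro un) simp_all
      then obtain x where x: "x \<in> hom C (Dom C h) (Dom C g)" "Comp C x u = a" "Comp C g x = Comp C b h"
        by blast
      show ?thesis
      proof (rule ex1I[of _ "(h, g, x, b)"])
        show "(h, g, x, b) \<in> hom ?K h g \<and> Comp ?K (h, g, x, b) ?e = t"
          unfolding hom_K comp_K using g h ab x B by simp
        fix y assume y: "y \<in> hom ?K h g \<and> Comp ?K y ?e = t"
        then obtain x' b' where y': "y = (h, g, x', b')" "x' \<in> hom C (Dom C h) (Dom C g)"
          "b' \<in> hom C (Cod C h) (Cod C g)" "Comp C g x' = Comp C b' h"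
          unfolding hom_K by blast
        have "Comp C x' u = a" "b' = b"
          using y y'(3) h(3) ab(1) unfolding y'(1) comp_K by simp_all
        then show "y = (h, g, x, b)" using ex1 x y' by blast
      qed
    qed
    with h e show "\<exists>R u. R \<in> ?S \<and> u \<in> hom ?K f R \<and>
        (\<forall>Y\<in>?S. \<forall>t\<in>hom ?K f Y. \<exists>!g. g \<in> hom ?K R Y \<and> Comp ?K g u = t)"
      by (intro exI[of _ h] exI[of _ ?e]) blast
  qed
qed

end
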